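(* Let $s\in[1,\infty)$ be fixed, and let $w$ be a $(\mathfrak T\times\mathfrak X)$-measurable function on $\mathcal T\times\mathcal X$ satisfying Assumption (A1) (stated in the context). If $M_s(w)<\infty$, then for any $z>0$ $$\mathbb P\{\|\xi_w\|_{s,\tau}\ge\rho_s(w,f)+z\}\le\exp\Big\{-\frac{z^2}{\frac13\omega_s^2(w,f)+\frac43c_*(s)M_s(w)z}\Big\}.$$
   Context: Setting. $(\mathcal T,\mathfrak T,\tau)$ and $(\mathcal X,\mathfrak X,\nu)$ are $\sigma$-finite measure spaces, $\mathcal X$ being a separable Banach space. $X$ is an $\mathcal X$-valued random element defined on a complete probability space with density $f$ with respect to $\nu$; $X_1,\dots,X_n$ ($n\ge1$) are independent copies of $X$ with joint law $\mathbb P$, expectation $\mathbb E$. For measurable $w:\mathcal T\times\mathcal X\to\mathbb R$, $\xi_w(t):=\sum_{i=1}^n[w(t,X_i)-\mathbb Ew(t,X)]$, and $\|\xi_w\|_{s,\tau}=[\int|\xi_w(t)|^s\tau(dt)]^{1/s}$. Assumption (A1). There is a countable dense subset $\bar{\mathcal X}$ of $\mathcal X$ such that for any $\delta>0$ and any $x\in\mathcal X$ there exists $\bar x\in\bar{\mathcal X}$ with $\|w(\cdot,x)-w(\cdot,\bar x)\|_{s,\tau}\le\delta$. Notation. $\nu'(dx)=f(x)\nu(dx)$; $$\Sigma_s(w,f)=\Big[\int\Big(\int w^2(t,x)f(x)\nu(dx)\Big)^{s/2}\tau(dt)\Big]^{1/s};$$ for a measure $\chi$ on $\mathcal X$ and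 $p\ge1$, $M_{p,\tau,\chi}(w)=\sup_{x\in\mathcal X}\|w(\cdot,x)\|_{p,\tau}\vee\sup_{t\in\mathcal T}\|w(t,\cdot)\|_{p,\chi}$; $M_p(w):=M_{p,\tau,\nu}(w)$. Constants. $c_1(s)=15s/\ln s$ for $s>2$, $c_1(s)=1$ for $s\in[1,2]$. For $p>1$, $c_2(p)$ is a numerical constant (independent of $w$) such that $\|\int w(\cdot,x)R(x)\chi(dx)\|_{r,\tau}\le c_2(p)M_{q,\tau,\chi}(w)\|R\|_{p,\chi}$ for all $1<p<r<\infty$, $1/q=1+1/r-1/p$, $R\in L_p(\mathcal X,\chi)$, and $\sigma$-finite $\tau,\chi$. $c_3(s)=c_1(s)\vee c_2(s/(s-1))$ for $s>2$. $c_*(s)=0$ if $1\le s<2$, $c_*(2)=1$, $c_*(s)=c_3(s)$ if $s>2$. The quantities in the claim are $$\rho_s(w,f)=\begin{cases}[\sqrt n\,\Sigma_s(w,f)]\wedge[4n^{1/s}M_s(w)],&s<2,\\ \sqrt n\,M_2(w),&s=2,\\ c_1(s)[\sqrt n\,\Sigma_s(w,f)+2n^{1/s}M_s(w)],&s>2,\end{cases}$$ $$\omega_s^2(w,f)=\begin{cases}M_s^2(w)[14n+96n^{1/s}],&s<2,\\ 6nM^2_{1,\tau,\nu'}(w)+24\sqrt n\,M_2^2(w),&s=2,\\ 6c_3(s)\big[nM^2_{2s/(s+2),\tau,\nu'}(w)+4\sqrt n\,\Sigma_s(w,f)M_s(w)+8n^{1/s}M_s^2(w)\big],&s>2.\end{cases}$$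 *)

theory Defs
  imports "HOL-Probability.Probability"
begin

text \<open>
  Norms and the quantities built from them take values in \<^typ>\<open>ennreal\<close>, because they may be
  infinite: even if \<open>M_norm s \<tau> \<nu> w < \<infinity>\<close>, the norms \<open>M_norm 1 \<tau> \<nu>' w\<close> and
  \<open>M_norm (2*s/(s+2)) \<tau> \<nu>' w\<close> occurring in \<open>omega_sq\<close> need not be finite.
\<close>

text \<open>Intended for exponents \<open>a > 0\<close> only, so that \<open>0\<close> and \<open>\<infinity>\<close> are fixed.\<close>

definition enn_powr :: "ennreal \<Rightarrow> real \<Rightarrow> ennreal" where
  "enn_powr x a = (if x = \<top> then \<top> else ennreal (enn2real x powr a))"

text \<open>\<open>exp (- x)\<close> with \<open>exp (- \<infinity>) = 0\<close>.\<close>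

definition exp_minus :: "ennreal \<Rightarrow> real" where
  "exp_minus x = (if x = \<top> then 0 else exp (- enn2real x))"

definition Lp_norm :: "real \<Rightarrow> 'a measure \<Rightarrow> ('a \<Rightarrow> real) \<Rightarrow> ennreal" where
  "Lp_norm p \<mu> g = enn_powr (\<integral>\<^sup>+ y. ennreal (\<bar>g y\<bar> powr p) \<partial>\<mu>) (1 / p)"

text \<open>The suprema are genuine, not essential, suprema.\<close>

definition M_norm :: "real \<Rightarrow> 't measure \<Rightarrow> 'x measure \<Rightarrow> ('t \<Rightarrow> 'x \<Rightarrow> real) \<Rightarrow> ennreal" where
  "M_norm p \<tau> \<kappa> w =
     max (SUP x\<in>space \<kappa>. Lp_norm p \<tau> (\<lambda>t. w t x)) (SUP t\<in>space \<tau>. Lp_norm p \<kappa> (w t))"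

definition Sigma_norm ::
  "real \<Rightarrow> 't measure \<Rightarrow> 'x measure \<Rightarrow> ('t \<Rightarrow> 'x \<Rightarrow> real) \<Rightarrow> ('x \<Rightarrow> real) \<Rightarrow> ennreal" where
  "Sigma_norm s \<tau> \<nu> w f =
     enn_powr (\<integral>\<^sup>+ t. enn_powr (\<integral>\<^sup>+ x. ennreal ((w t x)\<^sup>2 * f x) \<partial>\<nu>) (s / 2) \<partial>\<tau>) (1 / s)"

text \<open>Assumption (A1); the ambient space is the whole Banach space.\<close>

definition assumption_A1 ::
  "real \<Rightarrow> 't measure \<Rightarrow> ('t \<Rightarrow> 'x::real_normed_vector \<Rightarrow> real) \<Rightarrow> bool" where
  "assumption_A1 s \<tau> w \<longleftrightarrow>
     (\<exists>D. countable D \<and> closure D = UNIV \<and>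
        (\<forall>\<delta>>0. \<forall>x. \<exists>y\<in>D. Lp_norm s \<tau> (\<lambda>t. w t x - w t y) \<le> ennreal \<delta>))"

text \<open>
  \<open>xi P X Xs n w \<omega> t\<close> is the value at \<open>t\<close> of the sum over \<open>i = 1..n\<close> of the centred variables
  \<open>w(t, X\<^sub>i) - E w(t, X)\<close> at the outcome \<open>\<omega>\<close>.
\<close>

definition xi ::
  "'a measure \<Rightarrow> ('a \<Rightarrow> 'x) \<Rightarrow> (nat \<Rightarrow> 'a \<Rightarrow> 'x) \<Rightarrow> nat \<Rightarrow> ('t \<Rightarrow> 'x \<Rightarrow> real) \<Rightarrow> 'a \<Rightarrow> 't \<Rightarrow> real" where
  "xi P X Xs n w \<omega> t = (\<Sum>i=1..n. (w t (Xs i \<omega>) - (\<integral>\<omega>'. w t (X \<omega>') \<partial>P)))"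

text \<open>
  \<open>c\<close> is an admissible constant at exponent \<open>p\<close> in the \<open>L\<^sub>p\<close>--\<open>L\<^sub>r\<close> bound for integral operators,
  uniformly over kernels and over \<open>\<sigma>\<close>-finite measures on the two given types. The measures
  range over arbitrary carriers and \<open>\<sigma>\<close>-algebras on these types.
\<close>

definition operator_bound_const :: "'a itself \<Rightarrow> 'b itself \<Rightarrow> real \<Rightarrow> real \<Rightarrow> bool" where
  "operator_bound_const _ _ p c \<longleftrightarrow>
     (\<forall>(\<tau> :: 'a measure) (\<kappa> :: 'b measure) (w :: 'a \<Rightarrow> 'b \<Rightarrow> real) (R :: 'b \<Rightarrow> real) q r.
        sigma_finite_measure \<tau> \<longrightarrow> sigma_finite_measure \<kappa> \<longrightarrow>
        case_prod w \<in> borel_measurable (\<tau> \<Otimes>\<^sub>M \<kappa>) \<longrightarrow>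
        R \<in> borel_measurable \<kappa> \<longrightarrow> Lp_norm p \<kappa> R < \<infinity> \<longrightarrow>
        1 < p \<longrightarrow> p < r \<longrightarrow> 1 / q = 1 + 1 / r - 1 / p \<longrightarrow>
        Lp_norm r \<tau> (\<lambda>t. \<integral>x. w t x * R x \<partial>\<kappa>)
          \<le> ennreal c * M_norm q \<tau> \<kappa> w * Lp_norm p \<kappa> R)"

definition c1 :: "real \<Rightarrow> real" where
  "c1 s = (if s > 2 then 15 * s / ln s else 1)"

definition c3 :: "(real \<Rightarrow> real) \<Rightarrow> real \<Rightarrow> real" where
  "c3 c2 s = max (c1 s) (c2 (s / (s - 1)))"

definition c_star :: "(real \<Rightarrow> real) \<Rightarrow> real \<Rightarrow> real" where
  "c_star c2 s = (if s < 2 then 0 else if s = 2 then 1 else c3 c2 s)"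

definition rho ::
  "nat \<Rightarrow> real \<Rightarrow> 't measure \<Rightarrow> 'x measure \<Rightarrow> ('t \<Rightarrow> 'x \<Rightarrow> real) \<Rightarrow> ('x \<Rightarrow> real) \<Rightarrow> ennreal" where
  "rho n s \<tau> \<nu> w f =
     (let M = M_norm s \<tau> \<nu> w; \<Sigma> = Sigma_norm s \<tau> \<nu> w f;
          rn = ennreal (sqrt (real n)); ns = ennreal (real n powr (1 / s))
      in if s < 2 then min (rn * \<Sigma>) (4 * ns * M)
         else if s = 2 then rn * M
         else ennreal (c1 s) * (rn * \<Sigma> + 2 * ns * M))"

text \<open>The square \<open>\<omega>\<^sub>s\<^sup>2(w, f)\<close>; \<open>\<nu>'\<close> is the law \<open>f(x) \<nu>(dx)\<close>.\<close>

definition omega_sq ::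
  "(real \<Rightarrow> real) \<Rightarrow> nat \<Rightarrow> real \<Rightarrow> 't measure \<Rightarrow> 'x measure \<Rightarrow> ('t \<Rightarrow> 'x \<Rightarrow> real) \<Rightarrow> ('x \<Rightarrow> real)
     \<Rightarrow> ennreal" where
  "omega_sq c2 n s \<tau> \<nu> w f =
     (let M = M_norm s \<tau> \<nu> w; \<Sigma> = Sigma_norm s \<tau> \<nu> w f;
          \<nu>' = density \<nu> (\<lambda>x. ennreal (f x));
          rn = ennreal (sqrt (real n)); ns = ennreal (real n powr (1 / s))
      in if s < 2 then M\<^sup>2 * (14 * of_nat n + 96 * ns)
         else if s = 2 then 6 * of_nat n * (M_norm 1 \<tau> \<nu>' w)\<^sup>2 + 24 * rn * M\<^sup>2
         else 6 * ennreal (c3 c2 s) *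
                (of_nat n * (M_norm (2 * s / (s + 2)) \<tau> \<nu>' w)\<^sup>2 + 4 * rn * \<Sigma> * M + 8 * ns * M\<^sup>2))"

end

theory Submission
  imports Defs
begin

text \<open>
  Through the norming functional of \<open>L\<^sub>s\<close>, the norm \<open>Z\<close> of a sum of \<open>n\<close> independent random functions
  is a supremum of linear empirical processes, attained explicitly. For \<open>s \<ge> 2\<close> the deviation
  of \<open>Z\<close> from its mean is bounded by Bousquet's form of Talagrand's inequality, proved by the entropy method: the entropy of
  \<open>exp (l Z)\<close> is tensorized, each term is compared with the norm of the sum without the \<open>k\<close>-th
  summand, and the resulting differential inequality for the moment generating function is
  integrated. The weak variance is at most the square of the mixed norm with exponent
  \<open>2 s / (s + 2)\<close>, with constant one. For \<open>s < 2\<close> bounded differences suffice.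

  By Jensen's inequality and Fubini's theorem the mean of \<open>Z\<close> is bounded through the \<open>s\<close>-th moments
  of the scalar sums: orthogonality and a one-coordinate symmetrization for \<open>s \<le> 2\<close>, and Rosenthal's
  inequality for \<open>s > 2\<close>. The latter follows from truncation at the standard deviation of the sum: the
  bounded part has exponential moments at the scale \<open>ln s\<close>, and the number of large summands has
  mean at most one.
\<close>

section \<open>The entropy function\<close>

text \<open>Talagrand-type bounds are usually stated for countable classes, because a maximizer has
  to be chosen measurably. Here the maximizer is a formula: the norming functional of the sum
  without the \<open>k\<close>-th summand. It is jointly measurable and does not see coordinate
  \<open>k\<close>, so its pairing with the \<open>k\<close>-th summand is centred given the other
  coordinates, and its conditional variance is bounded by one deterministic constant. This requires
  \<open>1 < s\<close>; the value \<open>s = 1\<close> falls into the range of bounded differences.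
  The constants come from rescaling. With \<open>b\<close> a bound for the norms of
  \<open>w(., x)\<close>, one summand changes the norm by at most \<open>2 * b\<close>. Dividing by
  \<open>2 * b\<close>, applying the bound with variance factor
  \<open>n * \<sigma>2 + 2 * E Z\<close> and scaling back gives the denominator
  \<open>2 * (n * \<sigma>2 + 4 * b * E Z) + 4/3 * b * z\<close>. Once \<open>E Z\<close> is
  replaced by \<open>rho\<close>, and \<open>\<sigma>2\<close> by the squared mixed norm, six times
  the bracket is \<open>omega_sq\<close> for \<open>s = 2\<close>, and is at most
  \<open>omega_sq\<close> for \<open>s > 2\<close>, where \<open>c3\<close> enlarges the
  coefficients.\<close>

definition ent_fun :: "real \<Rightarrow> real" where
  "ent_fun y = 1 - exp y + y * exp y"

lemma ent_fun_deriv: "(ent_fun has_real_derivative y * exp y) (at y within A)"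
  unfolding ent_fun_def by (auto intro!: derivative_eq_intros simp: algebra_simps)

lemma ent_fun_nonneg: "0 \<le> ent_fun y"
proof -
  have "exp y * (1 - y) \<le> exp y * exp (- y)"
    using exp_ge_add_one_self[of "-y"] by (intro mult_left_mono) auto
  then show ?thesis by (simp add: ent_fun_def exp_minus field_simps)
qed

lemma ent_fun_pos: assumes "0 < y" shows "0 < ent_fun y"
proof -
  have "\<exists>d. (ent_fun has_real_derivative d) (at x) \<and> 0 < d" if "0 < x" for x
    using ent_fun_deriv[of x UNIV] that by (intro exI[of _ "x * exp x"]) auto
  moreover have "continuous_on {0..y} ent_fun"
    unfolding ent_fun_def[abs_def] by (intro continuous_intros)
  ultimately have "ent_fun 0 < ent_fun y"
    using DERIV_pos_imp_increasing_open[OF assms, of ent_fun] by blast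
  then show ?thesis by (simp add: ent_fun_def)
qed

lemma deriv_sign_ineq:
  fixes F F' :: "real \<Rightarrow> real"
  assumes "\<And>x. (F has_real_derivative F' x) (at x)" "\<And>x. 0 \<le> F' x" "F 0 = 0"
  shows "0 \<le> y \<Longrightarrow> 0 \<le> F y" "y \<le> 0 \<Longrightarrow> F y \<le> 0"
  using DERIV_nonneg_imp_nondecreasing[of 0 y F] DERIV_nonneg_imp_nondecreasing[of y 0 F] assms
  by metis+

text \<open>The difference of the two sides has derivative \<open>y * (exp y - 1)\<close>, which is
  nonnegative on the whole line, so the difference changes sign at 0. Thus 1/2 separates the values
  of \<open>ent_fun y / y^2\<close> at negative and at positive \<open>y\<close>.\<close>

lemma ent_fun_half_square:
  shows "0 \<le> y \<Longrightarrow> y\<^sup>2 / 2 \<le> ent_fun y" "y \<le> 0 \<Longrightarrow> ent_fun y \<le> y\<^sup>2 / 2"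
proof -
  let ?F = "\<lambda>y. ent_fun y - y\<^sup>2 / 2"
  have D: "(?F has_real_derivative y * (exp y - 1)) (at y)" for y
    by (auto intro!: derivative_eq_intros ent_fun_deriv simp: algebra_simps)
  have P: "0 \<le> y * (exp y - 1)" for y :: real
    by (cases "y \<ge> 0") (auto simp: zero_le_mult_iff)
  show "0 \<le> y \<Longrightarrow> y\<^sup>2 / 2 \<le> ent_fun y" "y \<le> 0 \<Longrightarrow> ent_fun y \<le> y\<^sup>2 / 2"
    using deriv_sign_ineq[OF D P, of y] by (auto simp: ent_fun_def)
qed

text \<open>The derivative of \<open>2 * ent_fun y - y * (exp y - 1)\<close> is
  \<open>ent_fun y\<close> itself.\<close>

lemma ent_fun_mean:
  shows "0 \<le> y \<Longrightarrow> y * (exp y - 1) \<le> 2 * ent_fun y"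
    "y \<le> 0 \<Longrightarrow> 2 * ent_fun y \<le> y * (exp y - 1)"
proof -
  let ?F = "\<lambda>y. 2 * ent_fun y - y * (exp y - 1)"
  have D: "(?F has_real_derivative ent_fun y) (at y)" for y
    by (auto intro!: derivative_eq_intros ent_fun_deriv simp: ent_fun_def algebra_simps)
  show "0 \<le> y \<Longrightarrow> y * (exp y - 1) \<le> 2 * ent_fun y"
    "y \<le> 0 \<Longrightarrow> 2 * ent_fun y \<le> y * (exp y - 1)"
    using deriv_sign_ineq[OF D ent_fun_nonneg, of y] by (auto simp: ent_fun_def)
qed

lemma ent_fun_over_square_mono:
  assumes "y \<le> l" "0 < l" shows "ent_fun y * l\<^sup>2 \<le> ent_fun l * y\<^sup>2"
proof (cases "y \<le> 0")
  case True
  have "ent_fun y * l\<^sup>2 \<le> (y\<^sup>2 / 2) * l\<^sup>2"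
    using ent_fun_half_square(2)[OF True] by (intro mult_right_mono) auto
  also have "\<dots> = (l\<^sup>2 / 2) * y\<^sup>2" by simp
  also have "\<dots> \<le> ent_fun l * y\<^sup>2"
    using ent_fun_half_square(1)[of l] assms by (intro mult_right_mono) auto
  finally show ?thesis .
next
  case False
  have D0: "((\<lambda>y. y\<^sup>2 * exp y - 2 * ent_fun y) has_real_derivative x\<^sup>2 * exp x) (at x)" for x
    by (auto intro!: derivative_eq_intros ent_fun_deriv simp: power2_eq_square algebra_simps)
  have P: "0 \<le> x\<^sup>2 * exp x - 2 * ent_fun x" if "0 \<le> x" for x
    using deriv_sign_ineq(1)[OF D0] that by (auto simp: ent_fun_def)
  have "ent_fun y / y\<^sup>2 \<le> ent_fun l / l\<^sup>2"
  proof (rule DERIV_nonneg_imp_nondecreasing[OF assms(1)])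
    fix x assume "y \<le> x" "x \<le> l"
    with False have x: "0 < x" by simp
    have "((\<lambda>y. ent_fun y / y\<^sup>2) has_real_derivative
        (x * exp x * x\<^sup>2 - ent_fun x * (2 * x)) / (x\<^sup>2 * x\<^sup>2)) (at x)"
      using x by (auto intro!: derivative_eq_intros ent_fun_deriv)
    moreover have "x * exp x * x\<^sup>2 - ent_fun x * (2 * x) = x * (x\<^sup>2 * exp x - 2 * ent_fun x)"
      by (simp add: algebra_simps)
    ultimately show "\<exists>d. ((\<lambda>y. ent_fun y / y\<^sup>2) has_real_derivative d) (at x) \<and> 0 \<le> d"
      using P[of x] x by (intro exI conjI) auto
  qed
  then show ?thesis using False assms by (simp add: field_simps)
qed

text \<open>The square of \<open>x * exp (x / 2) \<le> exp x - 1\<close>, that is, of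
  \<open>x / 2 \<le> sinh (x / 2)\<close>. It supplies the sign of the derivative in
  \<open>ent_fun_mean_mono\<close>.\<close>

lemma exp_minus_one_ge_half:
  assumes "0 \<le> (x::real)" shows "x\<^sup>2 * exp x \<le> (exp x - 1)\<^sup>2"
proof -
  have D: "((\<lambda>x::real. exp x - 1 - x * exp (x / 2)) has_real_derivative
      exp (x/2) * (exp (x / 2) - (1 + x / 2))) (at x)" for x :: real
    by (auto intro!: derivative_eq_intros simp: algebra_simps mult_exp_exp)
  have P: "0 \<le> exp (x/2) * (exp (x / 2) - (1 + x / 2))" for x :: real
    using exp_ge_add_one_self[of "x/2"] by simp
  have "x * exp (x / 2) \<le> exp x - 1"
    using deriv_sign_ineq(1)[OF D P, of x] assms by simp
  then have "(x * exp (x / 2))\<^sup>2 \<le> (exp x - 1)\<^sup>2"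
    using assms by (intro power_mono) auto
  then show ?thesis by (simp add: power_mult_distrib flip: exp_double)
qed

text \<open>The quotient \<open>y * (exp y - 1) / ent_fun y\<close> is nonincreasing, with 2 as the
  value separating negative from positive \<open>y\<close>; again the product form admits
  \<open>y = 0\<close>. The numerator of its derivative collapses to
  \<open>x^2 * exp x - (exp x - 1)^2\<close>.\<close>

lemma ent_fun_mean_mono:
  assumes "y \<le> l" "0 < l"
  shows "ent_fun y * (l * (exp l - 1)) \<le> ent_fun l * (y * (exp y - 1))"
proof (cases "y \<le> 0")
  case True
  have p: "0 \<le> y * (exp y - 1)" using True by (auto simp: zero_le_mult_iff)
  have "ent_fun y * (l * (exp l - 1)) \<le> (y * (exp y - 1) / 2) * (l * (exp l - 1))"
    using ent_fun_mean(2)[OF True] assms by (intro mult_right_mono) auto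
  also have "\<dots> = (l * (exp l - 1) / 2) * (y * (exp y - 1))" by simp
  also have "\<dots> \<le> ent_fun l * (y * (exp y - 1))"
    using ent_fun_mean(1)[of l] assms p by (intro mult_right_mono) auto
  finally show ?thesis .
next
  case False
  let ?a = "\<lambda>y. y * (exp y - 1) / ent_fun y"
  have "?a l \<le> ?a y"
  proof (rule DERIV_nonpos_imp_nonincreasing[OF assms(1)])
    fix x assume "y \<le> x" "x \<le> l"
    with False have x: "0 < x" by simp
    have "(?a has_real_derivative
        ((exp x - 1 + x * exp x) * ent_fun x - x * (exp x - 1) * (x * exp x)) /
        (ent_fun x * ent_fun x)) (at x)"
      using x ent_fun_pos[OF x] by (auto intro!: derivative_eq_intros ent_fun_deriv)
    moreover have "(exp x - 1 + x * exp x) * ent_fun x - x * (exp x - 1) * (x * exp x) =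
        x\<^sup>2 * exp x - (exp x - 1)\<^sup>2"
      by (simp add: ent_fun_def algebra_simps power2_eq_square)
    ultimately show "\<exists>d. (?a has_real_derivative d) (at x) \<and> d \<le> 0"
      using exp_minus_one_ge_half[of x] x by (intro exI conjI) (auto intro!: divide_nonpos_nonneg)
  qed
  then show ?thesis using False assms ent_fun_pos[of l] ent_fun_pos[of y] by (simp add: field_simps)
qed

text \<open>Split \<open>exp l - 1/2\<close> into \<open>exp l - 1\<close> and \<open>1/2\<close>:
  the first part is governed by \<open>ent_fun_mean_mono\<close>, the second by
  \<open>ent_fun_over_square_mono\<close>, both at \<open>l * x \<le> l\<close>. Equality holds at
  \<open>x = 1\<close>. The right-hand side has the shape the entropy argument needs:
  \<open>x * exp (l * x)\<close> will sum to the derivative of the moment generating function, and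
  in \<open>- x + x^2 / 2\<close> a centred variable of small variance can be substituted.\<close>

lemma bousquet_key_ineq:
  assumes "x \<le> 1" "0 < l"
  shows "ent_fun (l * x) * (exp l - 1/2) \<le> ent_fun l * (x * exp (l * x) - x + x\<^sup>2 / 2)"
proof -
  have y: "l * x \<le> l" using assms by simp
  have "l\<^sup>2 * (ent_fun (l * x) * (exp l - 1/2)) =
      l * (ent_fun (l * x) * (l * (exp l - 1))) + (ent_fun (l * x) * l\<^sup>2) / 2"
    by (simp add: algebra_simps power2_eq_square)
  also have "\<dots> \<le> l * (ent_fun l * (l * x * (exp (l * x) - 1))) + (ent_fun l * (l * x)\<^sup>2) / 2"
    using ent_fun_over_square_mono[OF y assms(2)] ent_fun_mean_mono[OF y assms(2)] assms(2)
    by (intro add_mono mult_left_mono divide_right_mono) auto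
  also have "\<dots> = l\<^sup>2 * (ent_fun l * (x * exp (l * x) - x + x\<^sup>2 / 2))"
    by (simp add: algebra_simps power2_eq_square)
  finally show ?thesis using assms(2) by (simp add: mult_le_cancel_left_pos)
qed

text \<open>The series is compared termwise with a geometric one, by
  \<open>fact (k + 2) \<ge> 2 * 3 ^ k\<close>.\<close>

lemma exp_bound_bernstein:
  fixes l :: real
  assumes "0 \<le> l" "l < 3"
  shows "exp l - 1 - l \<le> l\<^sup>2 / (2 * (1 - l / 3))"
proof -
  have two: "(2::real) * 3 ^ k \<le> fact (k + 2)" for k
  proof (induction k)
    case (Suc k)
    have "(2::real) * 3 ^ Suc k = 3 * (2 * 3 ^ k)" by simp
    also have "\<dots> \<le> (real k + 3) * fact (k + 2)"
      using Suc by (intro mult_mono) auto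
    also have "\<dots> = fact (Suc k + 2)" by (simp add: algebra_simps)
    finally show ?case .
  qed simp
  have s: "(\<lambda>k. l ^ k / fact k) sums exp l"
    using exp_converges[of l] by (simp add: field_simps)
  have "(\<lambda>k. l ^ (k + 2) / fact (k + 2)) sums (exp l - (\<Sum>k<2. l ^ k / fact k))"
    using sums_iff_shift[of "\<lambda>k. l ^ k / fact k" 2 "exp l - (\<Sum>k<2. l ^ k / fact k)"] s by simp
  moreover have "(\<Sum>k<2. l ^ k / fact k) = 1 + l" by (simp add: numeral_2_eq_2)
  ultimately have s1: "(\<lambda>k. l ^ (k + 2) / fact (k + 2)) sums (exp l - 1 - l)"
    by (simp only: diff_diff_eq)
  have s2: "(\<lambda>k. l\<^sup>2 / 2 * (l / 3) ^ k) sums (l\<^sup>2 / 2 * (1 / (1 - l / 3)))"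
    using assms by (intro sums_mult geometric_sums) auto
  have "l ^ (k + 2) / fact (k + 2) \<le> l\<^sup>2 / 2 * (l / 3) ^ k" for k
  proof -
    have "l ^ (k + 2) / fact (k + 2) \<le> l ^ (k + 2) / (2 * 3 ^ k)"
      using two[of k] assms by (intro divide_left_mono) auto
    also have "\<dots> = l\<^sup>2 / 2 * (l / 3) ^ k" by (simp add: power_add power_divide power2_eq_square)
    finally show ?thesis .
  qed
  from sums_le[OF this s1 s2] show ?thesis by simp
qed

section \<open>Tensorization of entropy\<close>

text \<open>The Bregman divergence of \<open>x * ln x\<close> between \<open>y\<close> and
  \<open>u\<close>.\<close>

definition rel_ent :: "real \<Rightarrow> real \<Rightarrow> real" where
  "rel_ent y u = y * (ln y - ln u) - y + u"

text \<open>Both bounds come from \<open>ln x \<le> x - 1\<close>, applied to \<open>u / y\<close>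
  and to \<open>y / u\<close>; the second gives the chi-square expression
  \<open>(y - u)^2 / u\<close>. The upper bound makes \<open>rel_ent\<close> of two bounded
  functions integrable.\<close>

lemma rel_ent_bounds:
  assumes "0 < a" "a \<le> y" "y \<le> b" "a \<le> u" "u \<le> b"
  shows "0 \<le> rel_ent y u" "rel_ent y u \<le> (b - a)\<^sup>2 / a"
proof -
  have p: "0 < y" "0 < u" using assms by auto
  have "ln (u / y) \<le> u / y - 1" using p by (intro ln_le_minus_one) auto
  then have "y * (ln u - ln y) \<le> y * (u / y - 1)" using p by (simp add: ln_div)
  then show "0 \<le> rel_ent y u" using p by (simp add: rel_ent_def right_diff_distrib)
  have "ln (y / u) \<le> y / u - 1" using p by (intro ln_le_minus_one) auto
  then have "y * (ln y - ln u) \<le> y * (y / u - 1)" using p by (intro mult_left_mono) (simp_all add: ln_div)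
  then have "rel_ent y u \<le> y * (y / u - 1) - y + u" by (simp add: rel_ent_def)
  also have "\<dots> = (y - u)\<^sup>2 / u" using p by (simp add: field_simps power2_eq_square)
  also have "\<dots> \<le> (b - a)\<^sup>2 / a"
  proof (rule frac_le)
    have "\<bar>y - u\<bar> \<le> \<bar>b - a\<bar>" using assms by linarith
    then show "(y - u)\<^sup>2 \<le> (b - a)\<^sup>2" by (rule abs_le_square_iff[THEN iffD1])
  qed (use assms in auto)
  finally show "rel_ent y u \<le> (b - a)\<^sup>2 / a" .
qed

text \<open>\<open>rel_ent\<close> is convex and positively homogeneous in the pair, hence a
  supremum of linear functions; this one touches it along the ray \<open>y = c * u\<close>.\<close>

lemma rel_ent_affine_lower:
  assumes "0 < y" "0 < u" "0 < c"
  shows "y * ln c - c * u + u \<le> rel_ent y u"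
proof -
  have "ln (c * u / y) \<le> c * u / y - 1" using assms by (intro ln_le_minus_one) auto
  then have "y * (ln c + ln u - ln y) \<le> y * (c * u / y - 1)"
    using assms by (intro mult_left_mono) (simp_all add: ln_div ln_mult)
  then show ?thesis using assms by (simp add: rel_ent_def right_diff_distrib distrib_left)
qed

text \<open>\<open>ent_fun v\<close> is the divergence of \<open>exp v\<close> from 1, and
  homogeneity supplies the factor. So the divergence between the exponentials of two norms becomes a
  function of the difference of the norms.\<close>

lemma rel_ent_exp: "rel_ent (exp (r + v)) (exp r) = exp r * ent_fun v"
  unfolding rel_ent_def ln_exp by (simp add: ent_fun_def exp_add algebra_simps)

lemma abs_mult_ln_le:
  fixes y :: real
  assumes "0 < a" "a \<le> y" "y \<le> b"
  shows "\<bar>y * ln y\<bar> \<le> b * (\<bar>ln a\<bar> + \<bar>ln b\<bar>)"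
proof -
  have "ln a \<le> ln y" "ln y \<le> ln b" using assms by auto
  then have "\<bar>ln y\<bar> \<le> \<bar>ln a\<bar> + \<bar>ln b\<bar>" by linarith
  then show ?thesis unfolding abs_mult using assms by (intro mult_mono) auto
qed

context prob_space
begin

abbreviation iid :: "'i set \<Rightarrow> ('i \<Rightarrow> 'a) measure" where
  "iid I \<equiv> PiM I (\<lambda>_. M)"

lemma integrable_interval_bounded:
  fixes f :: "'a \<Rightarrow> real"
  assumes "f \<in> borel_measurable M" "\<And>x. x \<in> space M \<Longrightarrow> a \<le> f x" "\<And>x. x \<in> space M \<Longrightarrow> f x \<le> b"
  shows "integrable M f"
proof (rule integrable_const_bound[where B = "max \<bar>a\<bar> \<bar>b\<bar>"])
  show "AE x in M. norm (f x) \<le> max \<bar>a\<bar> \<bar>b\<bar>"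
  proof (rule AE_I2)
    fix x assume "x \<in> space M"
    from assms(2,3)[OF this] show "norm (f x) \<le> max \<bar>a\<bar> \<bar>b\<bar>" by (auto simp: abs_if max_def)
  qed
qed fact

lemma expectation_in_interval:
  fixes f :: "'a \<Rightarrow> real"
  assumes "f \<in> borel_measurable M" "\<And>x. x \<in> space M \<Longrightarrow> a \<le> f x" "\<And>x. x \<in> space M \<Longrightarrow> f x \<le> b"
  shows "a \<le> expectation f" "expectation f \<le> b"
proof -
  have i: "integrable M f" by (rule integrable_interval_bounded[OF assms])
  show "a \<le> expectation f" by (rule integral_ge_const[OF i AE_I2[OF assms(2)]])
  show "expectation f \<le> b" by (rule integral_le_const[OF i AE_I2[OF assms(3)]])
qed

text \<open>Jensen's inequality for the jointly convex \<open>rel_ent\<close>: the supporting linear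
  function whose parameter \<open>c\<close> is the ratio of the means touches at the pair of
  means.\<close>

lemma rel_ent_expectation_le:
  assumes [measurable]: "Y \<in> borel_measurable M" "u \<in> borel_measurable M"
    and a: "0 < a" and Y: "\<And>x. x \<in> space M \<Longrightarrow> a \<le> Y x" "\<And>x. x \<in> space M \<Longrightarrow> Y x \<le> b"
    and u: "\<And>x. x \<in> space M \<Longrightarrow> a \<le> u x" "\<And>x. x \<in> space M \<Longrightarrow> u x \<le> b"
  shows "rel_ent (expectation Y) (expectation u) \<le> expectation (\<lambda>x. rel_ent (Y x) (u x))"
proof -
  have iY: "integrable M Y" by (rule integrable_interval_bounded[OF assms(1) Y])
  have iu: "integrable M u" by (rule integrable_interval_bounded[OF assms(2) u])
  have pY: "0 < expectation Y" by (rule less_le_trans[OF a expectation_in_interval(1)[OF assms(1) Y]])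
  have pu: "0 < expectation u" by (rule less_le_trans[OF a expectation_in_interval(1)[OF assms(2) u]])
  note p = pY pu
  define c where "c = expectation Y / expectation u"
  have c: "0 < c" using p by (simp add: c_def)
  have [measurable]: "(\<lambda>x. rel_ent (Y x) (u x)) \<in> borel_measurable M"
    unfolding rel_ent_def by measurable
  have iR: "integrable M (\<lambda>x. rel_ent (Y x) (u x))"
    by (rule integrable_interval_bounded[OF _ rel_ent_bounds[OF a Y u]]) measurable
  have "expectation (\<lambda>x. Y x * ln c - c * u x + u x) \<le> expectation (\<lambda>x. rel_ent (Y x) (u x))"
  proof (rule integral_mono)
    show "Y x * ln c - c * u x + u x \<le> rel_ent (Y x) (u x)" if "x \<in> space M" for x
      using rel_ent_affine_lower[of "Y x" "u x" c] Y(1)[OF that] u(1)[OF that] a c by linarith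
  qed (use iY iu iR in auto)
  also have "expectation (\<lambda>x. Y x * ln c - c * u x + u x) =
      expectation Y * ln c - c * expectation u + expectation u"
    using iY iu by simp
  also have "\<dots> = rel_ent (expectation Y) (expectation u)"
    using p by (simp add: rel_ent_def c_def ln_div)
  finally show ?thesis .
qed

text \<open>The two sides differ by \<open>rel_ent (expectation Y) u\<close>, so every constant
  \<open>u\<close> gives an upper bound for the entropy, the best one being the mean.\<close>

lemma entropy_variational_le:
  assumes [measurable]: "Y \<in> borel_measurable M"
    and a: "0 < a" and Y: "\<And>x. x \<in> space M \<Longrightarrow> a \<le> Y x" "\<And>x. x \<in> space M \<Longrightarrow> Y x \<le> b"
    and u: "0 < u"
  shows "expectation (\<lambda>x. Y x * ln (Y x)) - expectation Y * ln (expectation Y)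
    \<le> expectation (\<lambda>x. rel_ent (Y x) u)"
proof -
  have iY: "integrable M Y" by (rule integrable_interval_bounded[OF assms(1) Y])
  have p: "0 < expectation Y"
    by (rule less_le_trans[OF a expectation_in_interval(1)[OF assms(1) Y]])
  have bd: "\<bar>Y x * ln (Y x)\<bar> \<le> b * (\<bar>ln a\<bar> + \<bar>ln b\<bar>)" if "x \<in> space M" for x
    using abs_mult_ln_le[OF a] Y[OF that] by blast
  have iL: "integrable M (\<lambda>x. Y x * ln (Y x))"
    by (rule integrable_const_bound[where B = "b * (\<bar>ln a\<bar> + \<bar>ln b\<bar>)"])
      (intro AE_I2, simp only: real_norm_def bd, measurable)
  have "expectation (\<lambda>x. rel_ent (Y x) u) =
      expectation (\<lambda>x. Y x * ln (Y x)) - expectation Y * ln u - expectation Y + u"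
    using iY iL by (simp add: rel_ent_def right_diff_distrib prob_space)
  moreover have "expectation Y * ln u + expectation Y - u \<le> expectation Y * ln (expectation Y)"
    using rel_ent_bounds(1)[of "min (expectation Y) u" "expectation Y" "max (expectation Y) u" u] p u
    by (simp add: rel_ent_def right_diff_distrib)
  ultimately show ?thesis by linarith
qed

section \<open>Sections and iterated integrals of powers of a probability measure\<close>

lemma PiM_prob_space: "prob_space (iid I)"
  by (rule prob_space_PiM) (rule prob_space_axioms)

lemma PiM_upd_measurable [measurable (raw)]:
  assumes "f \<in> borel_measurable (iid (insert i I))" "i \<notin> I"
  shows "(\<lambda>(x, y). f (x(i := y))) \<in> borel_measurable (iid I \<Otimes>\<^sub>M M)"
  using measurable_comp[OF measurable_add_dim[of i I "\<lambda>_. M"] assms(1)]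
  by (simp add: comp_def case_prod_unfold)

lemma PiM_upd_space:
  assumes "x \<in> space (iid I)" "y \<in> space M"
  shows "x(i := y) \<in> space (iid (insert i I))"
  using assms by (auto simp: space_PiM PiE_def extensional_def)

lemma PiM_section_measurable:
  assumes "f \<in> borel_measurable (iid (insert i I))" "x \<in> space (iid I)" "i \<notin> I"
  shows "(\<lambda>y. f (x(i := y))) \<in> borel_measurable M"
  using measurable_comp[OF measurable_component_update[of x I "\<lambda>_. M" i] assms(1)] assms(2,3)
  by (simp add: comp_def)

lemma PiM_section_integral_measurable:
  fixes f :: "('i \<Rightarrow> 'a) \<Rightarrow> real"
  assumes "f \<in> borel_measurable (iid (insert i I))" "i \<notin> I"
  shows "(\<lambda>x. \<integral>y. f (x(i := y)) \<partial>M) \<in> borel_measurable (iid I)"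
  using PiM_upd_measurable[OF assms] by (rule borel_measurable_lebesgue_integral)

lemma PiM_integral_insert:
  fixes f :: "('i \<Rightarrow> 'a) \<Rightarrow> real"
  assumes "finite I" "i \<notin> I" "integrable (iid (insert i I)) f"
  shows "(\<integral>x. f x \<partial>iid (insert i I)) = (\<integral>x. (\<integral>y. f (x(i := y)) \<partial>M) \<partial>iid I)"
proof -
  interpret product_prob_space "\<lambda>_. M" I
    by standard
  show ?thesis by (rule product_integral_insert[OF assms])
qed

text \<open>Induction by the chain rule: with \<open>Y'\<close> the average of \<open>Y\<close> over
  the new coordinate \<open>i\<close>, the entropy of \<open>Y\<close> is the mean of its entropy in
  \<open>i\<close> alone plus the entropy of \<open>Y'\<close>. The first term is compared with
  \<open>u i\<close>, which is constant in \<open>i\<close>. For the second the averages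
  \<open>u'\<close> satisfy the induction hypothesis, and the joint convexity of
  \<open>rel_ent\<close> undoes the averaging. Comparison functions \<open>u k\<close> in place of
  conditional entropies let the leave-one-out norms enter directly.\<close>

lemma entropy_tensorization:
  fixes I :: "'i set" and Y :: "('i \<Rightarrow> 'a) \<Rightarrow> real"
  assumes "finite I" and a: "0 < a"
    and "Y \<in> borel_measurable (iid I)"
    and "\<And>x. x \<in> space (iid I) \<Longrightarrow> a \<le> Y x" "\<And>x. x \<in> space (iid I) \<Longrightarrow> Y x \<le> b"
    and "\<And>k. k \<in> I \<Longrightarrow> u k \<in> borel_measurable (iid I)"
    and "\<And>k x. k \<in> I \<Longrightarrow> x \<in> space (iid I) \<Longrightarrow> a \<le> u k x"
    and "\<And>k x. k \<in> I \<Longrightarrow> x \<in> space (iid I) \<Longrightarrow> u k x \<le> b"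
    and "\<And>k x y. k \<in> I \<Longrightarrow> u k (x(k := y)) = u k x"
  shows "(\<integral>x. Y x * ln (Y x) \<partial>iid I)
      - (\<integral>x. Y x \<partial>iid I) * ln (\<integral>x. Y x \<partial>iid I)
    \<le> (\<Sum>k\<in>I. \<integral>x. rel_ent (Y x) (u k x) \<partial>iid I)"
  using assms(1,3-)
proof (induction I arbitrary: Y u rule: finite_induct)
  case empty
  show ?case by (simp add: PiM_empty lebesgue_integral_count_space_finite)
next
  case (insert i I)
  let ?P = "iid I" and ?Q = "iid (insert i I)"
  interpret P: prob_space ?P by (rule PiM_prob_space)
  interpret Q: prob_space ?Q by (rule PiM_prob_space)
  note [measurable] = insert.prems(1)
  have um[measurable]: "u k \<in> borel_measurable ?Q" if "k \<in> insert i I" for k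
    using insert.prems(4) that by auto
  have i: "i \<notin> I" and fin: "finite I" by fact+
  note upd = PiM_upd_space[of _ I _ i]
    and m1 = PiM_section_measurable[OF _ _ i] and m2 = PiM_section_integral_measurable[OF _ i]
  have bd: "\<bar>Y x * ln (Y x)\<bar> \<le> b * (\<bar>ln a\<bar> + \<bar>ln b\<bar>)" if "x \<in> space ?Q" for x
    using abs_mult_ln_le[OF a insert.prems(2,3)[OF that]] .
  have iL: "integrable ?Q (\<lambda>x. Y x * ln (Y x))"
    by (rule Q.integrable_const_bound[where B = "b * (\<bar>ln a\<bar> + \<bar>ln b\<bar>)"])
      (intro AE_I2, simp only: real_norm_def bd, measurable)
  have iY: "integrable ?Q Y"
    by (rule Q.integrable_interval_bounded[OF insert.prems(1-3)])
  have Rm: "(\<lambda>x. rel_ent (Y x) (u k x)) \<in> borel_measurable ?Q" if "k \<in> insert i I" for k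
    using um[OF that] unfolding rel_ent_def by measurable
  have Rb: "0 \<le> rel_ent (Y x) (u k x)" "rel_ent (Y x) (u k x) \<le> (b - a)\<^sup>2 / a"
    if "k \<in> insert i I" "x \<in> space ?Q" for k x
    using rel_ent_bounds[OF a insert.prems(2,3)[OF that(2)] insert.prems(5,6)[OF that]] by auto
  have iR: "integrable ?Q (\<lambda>x. rel_ent (Y x) (u k x))" if "k \<in> insert i I" for k
    by (rule Q.integrable_interval_bounded[OF Rm[OF that] Rb[OF that]])
  define Y' where "Y' x = (\<integral>y. Y (x(i := y)) \<partial>M)" for x
  define u' where "u' k x = (\<integral>y. u k (x(i := y)) \<partial>M)" for k x
  have Y'm[measurable]: "Y' \<in> borel_measurable ?P"
    unfolding Y'_def using insert.prems(1) by (rule m2)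
  have u'm: "u' k \<in> borel_measurable ?P" if "k \<in> I" for k
    unfolding u'_def using m2[OF um[of k]] that by auto
  have Y'b: "a \<le> Y' x" "Y' x \<le> b" if "x \<in> space ?P" for x
    unfolding Y'_def
    by (rule expectation_in_interval[OF m1[OF insert.prems(1) that] insert.prems(2,3)[OF upd[OF that]]]; assumption)+
  have u'b: "a \<le> u' k x" "u' k x \<le> b" if "k \<in> I" "x \<in> space ?P" for k x
  proof -
    have k: "k \<in> insert i I" using that by simp
    show "a \<le> u' k x" "u' k x \<le> b" unfolding u'_def
      by (rule expectation_in_interval[OF m1[OF um[OF k] that(2)] insert.prems(5,6)[OF k upd[OF that(2)]]]; assumption)+
  qed
  have u'c: "u' k (x(k := z)) = u' k x" if "k \<in> I" for k x z
  proof -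
    have "(x(k := z))(i := y) = (x(i := y))(k := z)" for y
      using that i by (auto simp: fun_upd_twist)
    then show ?thesis unfolding u'_def by (simp only: insert.prems(7)[OF insertI2[OF that]])
  qed
  have R'm: "(\<lambda>x. rel_ent (Y' x) (u' k x)) \<in> borel_measurable ?P" if "k \<in> I" for k
    using u'm[OF that] unfolding rel_ent_def by measurable
  have bd': "\<bar>Y' x * ln (Y' x)\<bar> \<le> b * (\<bar>ln a\<bar> + \<bar>ln b\<bar>)" if "x \<in> space ?P" for x
    using abs_mult_ln_le[OF a Y'b[OF that]] .
  have iL': "integrable ?P (\<lambda>x. Y' x * ln (Y' x))"
    by (rule P.integrable_const_bound[where B = "b * (\<bar>ln a\<bar> + \<bar>ln b\<bar>)"])
      (intro AE_I2, simp only: real_norm_def bd', measurable)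
  have EY: "(\<integral>x. Y x \<partial>?Q) = (\<integral>x. Y' x \<partial>?P)"
    unfolding Y'_def by (rule PiM_integral_insert[OF fin i iY])
  have EL: "(\<integral>x. Y x * ln (Y x) \<partial>?Q) = (\<integral>x. (\<integral>y. Y (x(i:=y)) * ln (Y (x(i:=y))) \<partial>M) \<partial>?P)"
    by (rule PiM_integral_insert[OF fin i iL])
  have ER: "(\<integral>x. rel_ent (Y x) (u k x) \<partial>?Q) =
      (\<integral>x. (\<integral>y. rel_ent (Y (x(i:=y))) (u k (x(i:=y))) \<partial>M) \<partial>?P)" if "k \<in> insert i I" for k
    by (rule PiM_integral_insert[OF fin i iR[OF that]])
  have lm: "(\<lambda>x. Y x * ln (Y x)) \<in> borel_measurable ?Q" by measurable
  have iLi: "integrable ?P (\<lambda>x. \<integral>y. Y (x(i:=y)) * ln (Y (x(i:=y))) \<partial>M)"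
  proof (rule P.integrable_interval_bounded[OF m2[OF lm]])
    fix x assume x: "x \<in> space ?P"
    let ?B = "b * (\<bar>ln a\<bar> + \<bar>ln b\<bar>)"
    have *: "- ?B \<le> Y (x(i:=y)) * ln (Y (x(i:=y)))" "Y (x(i:=y)) * ln (Y (x(i:=y))) \<le> ?B"
      if "y \<in> space M" for y
      using bd[OF upd[OF x that]] by linarith+
    show "- ?B \<le> (\<integral>y. Y (x(i:=y)) * ln (Y (x(i:=y))) \<partial>M)"
      "(\<integral>y. Y (x(i:=y)) * ln (Y (x(i:=y))) \<partial>M) \<le> ?B"
      by (rule expectation_in_interval[OF m1[OF lm x] *]; assumption)+
  qed
  have iRi: "integrable ?P (\<lambda>x. \<integral>y. rel_ent (Y (x(i:=y))) (u k (x(i:=y))) \<partial>M)" if "k \<in> insert i I" for k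
  proof (rule P.integrable_interval_bounded[OF m2[OF Rm[OF that]]])
    fix x assume x: "x \<in> space ?P"
    show "0 \<le> (\<integral>y. rel_ent (Y (x(i:=y))) (u k (x(i:=y))) \<partial>M)"
      "(\<integral>y. rel_ent (Y (x(i:=y))) (u k (x(i:=y))) \<partial>M) \<le> (b - a)\<^sup>2 / a"
      by (rule expectation_in_interval[OF m1[OF Rm[OF that] x] Rb[OF that upd[OF x]]]; assumption)+
  qed
  have step1: "(\<integral>y. Y (x(i:=y)) * ln (Y (x(i:=y))) \<partial>M) - Y' x * ln (Y' x)
      \<le> (\<integral>y. rel_ent (Y (x(i:=y))) (u i (x(i:=y))) \<partial>M)" if x: "x \<in> space ?P" for x
  proof -
    have uc: "u i (x(i:=y)) = u i x" for y by (rule insert.prems(7)) simp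
    have "0 < u i x"
    proof -
      \<comment> \<open>The point \<open>x\<close> lives on \<open>I\<close> only, so positivity is
        read off after filling in an arbitrary value at \<open>i\<close>, which \<open>u i\<close>
        ignores.\<close>
      obtain y where "y \<in> space M" using not_empty by auto
      then have "a \<le> u i (x(i:=y))" by (intro insert.prems(5) upd[OF x]) simp
      then show ?thesis using a by (simp only: uc)
    qed
    then show ?thesis unfolding Y'_def uc
      using entropy_variational_le[OF m1[OF insert.prems(1) x] a insert.prems(2,3)[OF upd[OF x]], of "u i x"]
      by (simp del: fun_upd_apply)
  qed
  have step2: "rel_ent (Y' x) (u' k x) \<le> (\<integral>y. rel_ent (Y (x(i:=y))) (u k (x(i:=y))) \<partial>M)"
    if "x \<in> space ?P" "k \<in> I" for x k
  proof -
    have k: "k \<in> insert i I" using that by simp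
    show ?thesis unfolding Y'_def u'_def
      by (rule rel_ent_expectation_le[OF m1[OF insert.prems(1) that(1)] m1[OF um[OF k] that(1)] a
            insert.prems(2,3)[OF upd[OF that(1)]] insert.prems(5,6)[OF k upd[OF that(1)]]])
  qed
  have "(\<integral>x. Y x * ln (Y x) \<partial>?Q) - (\<integral>x. Y' x * ln (Y' x) \<partial>?P)
      = (\<integral>x. (\<integral>y. Y (x(i:=y)) * ln (Y (x(i:=y))) \<partial>M) - Y' x * ln (Y' x) \<partial>?P)"
    unfolding EL using iLi iL' by simp
  also have "\<dots> \<le> (\<integral>x. (\<integral>y. rel_ent (Y (x(i:=y))) (u i (x(i:=y))) \<partial>M) \<partial>?P)"
    using iLi iL' iRi step1 by (intro integral_mono) auto
  also have "\<dots> = (\<integral>x. rel_ent (Y x) (u i x) \<partial>?Q)" using ER by simp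
  finally have s1: "(\<integral>x. Y x * ln (Y x) \<partial>?Q) - (\<integral>x. Y' x * ln (Y' x) \<partial>?P)
      \<le> (\<integral>x. rel_ent (Y x) (u i x) \<partial>?Q)" .
  have "(\<integral>x. Y' x * ln (Y' x) \<partial>?P) - (\<integral>x. Y' x \<partial>?P) * ln (\<integral>x. Y' x \<partial>?P)
      \<le> (\<Sum>k\<in>I. \<integral>x. rel_ent (Y' x) (u' k x) \<partial>?P)"
    by (rule insert.IH[OF Y'm Y'b u'm u'b u'c])
  also have "\<dots> \<le> (\<Sum>k\<in>I. \<integral>x. rel_ent (Y x) (u k x) \<partial>?Q)"
  proof (rule sum_mono)
    fix k assume k: "k \<in> I"
    have "integrable ?P (\<lambda>x. rel_ent (Y' x) (u' k x))"
      by (rule P.integrable_interval_bounded[OF R'm[OF k]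
            rel_ent_bounds[OF a Y'b u'b[OF k]] ])
    then have "(\<integral>x. rel_ent (Y' x) (u' k x) \<partial>?P) \<le>
        (\<integral>x. (\<integral>y. rel_ent (Y (x(i:=y))) (u k (x(i:=y))) \<partial>M) \<partial>?P)"
      using iRi k step2 by (intro integral_mono) auto
    then show "(\<integral>x. rel_ent (Y' x) (u' k x) \<partial>?P) \<le> (\<integral>x. rel_ent (Y x) (u k x) \<partial>?Q)"
      using ER k by simp
  qed
  finally show ?case using s1 EY fin i by simp
qed

end

section \<open>Bousquet's inequality\<close>

text \<open>Used twice: to differentiate the moment generating function, and to bound exponential
  moments of truncated summands.\<close>

lemma exp_remainder_le: "\<bar>exp y - 1 - y\<bar> \<le> y\<^sup>2 * exp \<bar>y\<bar>" for y :: real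
proof -
  have "exp y * (1 - y) \<le> exp y * exp (- y)"
    using exp_ge_add_one_self[of "-y"] by (intro mult_left_mono) auto
  then have "exp y - 1 - y \<le> y * (exp y - 1)" by (simp add: exp_minus algebra_simps)
  also have "\<dots> \<le> y\<^sup>2 * exp \<bar>y\<bar>"
  proof (cases "0 \<le> y")
    case True
    have "exp y - 1 \<le> y * exp y"
      using \<open>exp y * (1 - y) \<le> exp y * exp (- y)\<close> by (simp add: exp_minus algebra_simps)
    then have "y * (exp y - 1) \<le> y * (y * exp y)" using True by (intro mult_left_mono) auto
    then show ?thesis using True by (simp add: power2_eq_square)
  next
    case False
    have "y * (exp y - 1) = (- y) * (1 - exp y)" by (simp add: algebra_simps)
    also have "\<dots> \<le> (- y) * (- y)"
    proof (rule mult_left_mono)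
      show "1 - exp y \<le> - y" using exp_ge_add_one_self[of y] by linarith
    qed (use False in simp)
    also have "\<dots> = y\<^sup>2 * 1" by (simp add: power2_eq_square)
    also have "\<dots> \<le> y\<^sup>2 * exp \<bar>y\<bar>" by (intro mult_left_mono) auto
    finally show ?thesis .
  qed
  finally show ?thesis using exp_ge_add_one_self[of y] by linarith
qed

section \<open>Moment generating functions of bounded variables and tail bounds\<close>

context prob_space
begin

lemma integrable_exp_bounded:
  fixes Z :: "'a \<Rightarrow> real"
  assumes [measurable]: "Z \<in> borel_measurable M" and Z: "\<And>x. x \<in> space M \<Longrightarrow> \<bar>Z x\<bar> \<le> B"
  shows "integrable M (\<lambda>x. exp (l * Z x))" "integrable M (\<lambda>x. Z x * exp (l * Z x))"
proof -
  have e: "exp (l * Z x) \<le> exp (\<bar>l\<bar> * B)" if "x \<in> space M" for x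
  proof -
    have "l * Z x \<le> \<bar>l\<bar> * \<bar>Z x\<bar>" by (rule order_trans[OF abs_ge_self]) (simp add: abs_mult)
    also have "\<dots> \<le> \<bar>l\<bar> * B" using Z[OF that] by (intro mult_left_mono) auto
    finally show ?thesis by simp
  qed
  show "integrable M (\<lambda>x. exp (l * Z x))"
    by (rule integrable_const_bound[where B = "exp (\<bar>l\<bar> * B)"]) (use e in simp_all)
  show "integrable M (\<lambda>x. Z x * exp (l * Z x))"
  proof (rule integrable_const_bound[where B = "B * exp (\<bar>l\<bar> * B)"], rule AE_I2)
    fix x assume x: "x \<in> space M"
    have "\<bar>Z x\<bar> * exp (l * Z x) \<le> B * exp (\<bar>l\<bar> * B)"
      using Z[OF x] e[OF x] by (intro mult_mono) auto
    then show "norm (Z x * exp (l * Z x)) \<le> B * exp (\<bar>l\<bar> * B)" by (simp add: abs_mult)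
  qed measurable
qed

text \<open>Since \<open>Z\<close> is bounded, the second-order remainder is at most a constant
  times \<open>h^2\<close> uniformly on the space, and the difference quotients converge without a
  limit theorem for integrals.\<close>

lemma mgf_has_derivative:
  fixes Z :: "'a \<Rightarrow> real"
  assumes m[measurable]: "Z \<in> borel_measurable M" and Z: "\<And>x. x \<in> space M \<Longrightarrow> \<bar>Z x\<bar> \<le> B"
  shows "((\<lambda>l. expectation (\<lambda>x. exp (l * Z x))) has_real_derivative
      expectation (\<lambda>x. Z x * exp (l * Z x))) (at l)"
proof -
  let ?F = "\<lambda>l. expectation (\<lambda>x. exp (l * Z x))" and ?D = "expectation (\<lambda>x. Z x * exp (l * Z x))"
  have int: "integrable M (\<lambda>x. exp (l * Z x))" "integrable M (\<lambda>x. Z x * exp (l * Z x))" for l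
    using integrable_exp_bounded[OF m Z] by simp_all
  have B: "0 \<le> B"
  proof -
    obtain x where "x \<in> space M" using not_empty by auto
    from Z[OF this] show ?thesis by linarith
  qed
  let ?K = "exp (\<bar>l\<bar> * B) * (B\<^sup>2 * exp B)"
  have bound: "\<bar>(?F (l + h) - ?F l) / h - ?D\<bar> \<le> ?K * \<bar>h\<bar>" if h: "h \<noteq> 0" "\<bar>h\<bar> < 1" for h
  proof -
    have pw: "\<bar>exp ((l + h) * Z x) - exp (l * Z x) - h * (Z x * exp (l * Z x))\<bar> \<le> ?K * h\<^sup>2"
      if x: "x \<in> space M" for x
    proof -
      have "exp ((l + h) * Z x) - exp (l * Z x) - h * (Z x * exp (l * Z x)) =
          exp (l * Z x) * (exp (h * Z x) - 1 - h * Z x)"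
        by (simp add: algebra_simps exp_add)
      then have "\<bar>exp ((l + h) * Z x) - exp (l * Z x) - h * (Z x * exp (l * Z x))\<bar> =
          exp (l * Z x) * \<bar>exp (h * Z x) - 1 - h * Z x\<bar>" by (simp add: abs_mult)
      also have "\<dots> \<le> exp (\<bar>l\<bar> * B) * ((B\<^sup>2 * exp B) * h\<^sup>2)"
      proof (rule mult_mono)
        have "l * Z x \<le> \<bar>l\<bar> * \<bar>Z x\<bar>" by (rule order_trans[OF abs_ge_self]) (simp add: abs_mult)
        also have "\<dots> \<le> \<bar>l\<bar> * B" using Z[OF x] by (intro mult_left_mono) auto
        finally show "exp (l * Z x) \<le> exp (\<bar>l\<bar> * B)" by simp
        have "\<bar>exp (h * Z x) - 1 - h * Z x\<bar> \<le> (h * Z x)\<^sup>2 * exp \<bar>h * Z x\<bar>" by (rule exp_remainder_le)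
        also have "\<dots> \<le> (h\<^sup>2 * B\<^sup>2) * exp B"
        proof (rule mult_mono)
          have "(Z x)\<^sup>2 \<le> B\<^sup>2" using power_mono[OF Z[OF x], of 2] by simp
          then show "(h * Z x)\<^sup>2 \<le> h\<^sup>2 * B\<^sup>2" by (simp add: power_mult_distrib mult_left_mono)
          have "\<bar>h\<bar> * \<bar>Z x\<bar> \<le> 1 * B" using h Z[OF x] B by (intro mult_mono) auto
          then show "exp \<bar>h * Z x\<bar> \<le> exp B" by (simp add: abs_mult)
        qed auto
        finally show "\<bar>exp (h * Z x) - 1 - h * Z x\<bar> \<le> (B\<^sup>2 * exp B) * h\<^sup>2" by (simp add: ac_simps)
      qed auto
      finally show ?thesis by (simp add: ac_simps)
    qed
    have eq: "?F (l + h) - ?F l - h * ?D =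
        expectation (\<lambda>x. exp ((l + h) * Z x) - exp (l * Z x) - h * (Z x * exp (l * Z x)))"
      by (simp only: Bochner_Integration.integral_diff Bochner_Integration.integrable_diff
          integral_mult_right_zero integrable_mult_right int)
    have "\<bar>?F (l + h) - ?F l - h * ?D\<bar> \<le> expectation (\<lambda>x. \<bar>exp ((l + h) * Z x) - exp (l * Z x) - h * (Z x * exp (l * Z x))\<bar>)"
      unfolding eq by (rule integral_abs_bound)
    also have "\<dots> \<le> ?K * h\<^sup>2"
    proof (rule integral_le_const[OF _ AE_I2[OF pw]])
      show "integrable M (\<lambda>x. \<bar>exp ((l + h) * Z x) - exp (l * Z x) - h * (Z x * exp (l * Z x))\<bar>)"
        by (intro integrable_abs Bochner_Integration.integrable_diff integrable_mult_right int)
    qed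
    finally have "\<bar>?F (l + h) - ?F l - h * ?D\<bar> \<le> ?K * h\<^sup>2" .
    moreover have "(?F (l + h) - ?F l) / h - ?D = (?F (l + h) - ?F l - h * ?D) / h"
      using h by (simp add: field_simps)
    ultimately have "\<bar>(?F (l + h) - ?F l) / h - ?D\<bar> \<le> ?K * h\<^sup>2 / \<bar>h\<bar>"
      using h by (simp only: abs_divide) (intro divide_right_mono, auto)
    moreover have "h\<^sup>2 / \<bar>h\<bar> = \<bar>h\<bar>"
      using h by (cases "0 < h") (simp_all add: power2_eq_square)
    ultimately show ?thesis by (simp only: times_divide_eq_right[symmetric])
  qed
  have "((\<lambda>h. (?F (l + h) - ?F l) / h - ?D) \<longlongrightarrow> 0) (at 0)"
  proof (rule Lim_null_comparison)
    show "eventually (\<lambda>h. norm ((?F (l + h) - ?F l) / h - ?D) \<le> ?K * \<bar>h\<bar>) (at 0)"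
      unfolding eventually_at using bound by (intro exI[of _ 1]) auto
    show "((\<lambda>h. ?K * \<bar>h\<bar>) \<longlongrightarrow> 0) (at 0)" by (auto intro!: tendsto_eq_intros)
  qed
  then show ?thesis unfolding DERIV_def by (rule LIM_zero_cancel)
qed

text \<open>With \<open>k l = exp l - 1 - l / 2\<close>, the hypothesis on the entropy says that
  \<open>(ln F + \<kappa> l) / k\<close> is nonincreasing, where \<open>F\<close> is the moment generating function; its limit
  at \<open>0\<close> is \<open>2 (E Z + \<kappa>)\<close>.\<close>

lemma mgf_le_of_entropy_le:
  fixes Z :: "'a \<Rightarrow> real"
  assumes m[measurable]: "Z \<in> borel_measurable M" and Z: "\<And>x. x \<in> space M \<Longrightarrow> \<bar>Z x\<bar> \<le> B"
    and ent: "\<And>l. 0 < l \<Longrightarrow>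
      l * expectation (\<lambda>x. Z x * exp (l * Z x))
        - expectation (\<lambda>x. exp (l * Z x)) * ln (expectation (\<lambda>x. exp (l * Z x)))
      \<le> ent_fun l / (exp l - 1/2) *
        (expectation (\<lambda>x. Z x * exp (l * Z x)) + \<kappa> * expectation (\<lambda>x. exp (l * Z x)))"
    and l: "0 < l"
  shows "expectation (\<lambda>x. exp (l * Z x))
    \<le> exp (l * expectation Z + 2 * (expectation Z + \<kappa>) * (exp l - 1 - l))"
proof -
  define F where "F l = expectation (\<lambda>x. exp (l * Z x))" for l
  define F' where "F' l = expectation (\<lambda>x. Z x * exp (l * Z x))" for l
  define k where "k l = exp l - 1 - l / 2" for l :: real
  have F: "(F has_real_derivative F' l) (at l)" for l
    unfolding F_def[abs_def] F'_def by (rule mgf_has_derivative[OF m Z])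
  have Fpos: "0 < F l" for l
  proof -
    have "exp (- \<bar>l\<bar> * B) \<le> exp (l * Z x)" if "x \<in> space M" for x
    proof -
      have "- (l * Z x) \<le> \<bar>l\<bar> * \<bar>Z x\<bar>" by (rule order_trans[OF abs_ge_minus_self]) (simp add: abs_mult)
      also have "\<dots> \<le> \<bar>l\<bar> * B" using Z[OF that] by (intro mult_left_mono) auto
      finally show ?thesis by simp
    qed
    then have "exp (- \<bar>l\<bar> * B) \<le> F l" unfolding F_def
      by (intro integral_ge_const integrable_exp_bounded[OF m Z] AE_I2)
    then show ?thesis using exp_gt_zero[of "- \<bar>l\<bar> * B"] by linarith
  qed
  have F0: "F 0 = 1" "F' 0 = expectation Z" by (simp_all add: F_def F'_def prob_space)
  have kpos: "0 < k l" if "0 < l" for l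
    using exp_ge_add_one_self[of l] that unfolding k_def by linarith
  have k'pos: "0 < exp l - 1/2" if "0 < l" for l :: real
    using exp_ge_add_one_self[of l] that by linarith
  have kd: "(k has_real_derivative exp l - 1/2) (at l within A)" for l A
    unfolding k_def by (auto intro!: derivative_eq_intros)
  have Ld: "((\<lambda>l. ln (F l) + \<kappa> * l) has_real_derivative F' l / F l + \<kappa>) (at l)" for l
    using Fpos[of l] by (auto intro!: derivative_eq_intros F)
  let ?D = "\<lambda>l. (ln (F l) + \<kappa> * l) / k l"
  have anti: "?D b \<le> ?D a" if "0 < a" "a \<le> b" for a b
  proof (rule DERIV_nonpos_imp_nonincreasing[OF that(2)])
    fix x assume "a \<le> x" "x \<le> b"
    with that have x: "0 < x" by simp
    let ?L' = "F' x / F x" and ?L = "ln (F x)" and ?k' = "exp x - 1/2"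
    have D: "(?D has_real_derivative ((?L' + \<kappa>) * k x - (?L + \<kappa> * x) * ?k') / (k x * k x)) (at x)"
      using kpos[OF x] by (intro DERIV_divide Ld kd) simp
    have "x * F' x - F x * ln (F x) \<le> ent_fun x / ?k' * (F' x + \<kappa> * F x)"
      using ent[OF x] by (simp only: F_def F'_def)
    then have "(x * F' x - F x * ln (F x)) / F x \<le> ent_fun x / ?k' * (F' x + \<kappa> * F x) / F x"
      using Fpos[of x] by (intro divide_right_mono) auto
    then have "x * ?L' - ?L \<le> ent_fun x / ?k' * (?L' + \<kappa>)"
      using Fpos[of x] by (simp add: diff_divide_distrib add_divide_distrib distrib_left)
    then have "?k' * (x * ?L' - ?L) \<le> ?k' * (ent_fun x / ?k' * (?L' + \<kappa>))"
      using k'pos[OF x] by (intro mult_left_mono) auto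
    also have "\<dots> = ent_fun x * (?L' + \<kappa>)" using k'pos[OF x] by simp
    finally have "?k' * (x * ?L' - ?L) \<le> ent_fun x * (?L' + \<kappa>)" .
    \<comment> \<open>Because \<open>x * ?k' - k x = ent_fun x\<close>, the terms
      \<open>x * ?k' * ?L'\<close> cancel and the numerator of the quotient rule remains. This
      identity is what dictates the choice of \<open>k\<close>.\<close>
    then have "(?L' + \<kappa>) * k x - (?L + \<kappa> * x) * ?k' \<le> 0"
      by (simp add: k_def ent_fun_def algebra_simps)
    then show "\<exists>d. (?D has_real_derivative d) (at x) \<and> d \<le> 0"
      using D by (intro exI conjI) (auto intro!: divide_nonpos_nonneg)
  qed
  \<comment> \<open>Numerator and denominator both vanish at 0, so the limit of the quotient is the
    ratio of their derivatives there; the derivative 1/2 of \<open>k\<close> produces the factor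
    2.\<close>
  have "((\<lambda>h. ((ln (F (0 + h)) + \<kappa> * (0 + h)) - (ln (F 0) + \<kappa> * 0)) / h) \<longlongrightarrow> F' 0 / F 0 + \<kappa>) (at 0)"
    using Ld[of 0] unfolding DERIV_def .
  moreover have "((\<lambda>h. (k (0 + h) - k 0) / h) \<longlongrightarrow> exp 0 - 1/2) (at 0)"
    using kd[of 0 UNIV] unfolding DERIV_def .
  ultimately have "((\<lambda>h. (((ln (F (0 + h)) + \<kappa> * (0 + h)) - (ln (F 0) + \<kappa> * 0)) / h) / ((k (0 + h) - k 0) / h))
      \<longlongrightarrow> (F' 0 / F 0 + \<kappa>) / (exp 0 - 1/2)) (at 0)"
    by (intro tendsto_divide) auto
  moreover have "(F' 0 / F 0 + \<kappa>) / (exp 0 - 1/2) = 2 * (expectation Z + \<kappa>)"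
    "ln (F 0) + \<kappa> * 0 = 0" "k 0 = 0"
    by (simp_all add: F0 k_def)
  ultimately have "((\<lambda>h. ((ln (F h) + \<kappa> * h) / h) / (k h / h)) \<longlongrightarrow> 2 * (expectation Z + \<kappa>)) (at 0)"
    by (simp only: add_0_left diff_zero)
  then have "((\<lambda>h. ((ln (F h) + \<kappa> * h) / h) / (k h / h)) \<longlongrightarrow> 2 * (expectation Z + \<kappa>)) (at_right 0)"
    by (rule tendsto_within_subset) auto
  moreover have "eventually (\<lambda>h. ?D l \<le> ((ln (F h) + \<kappa> * h) / h) / (k h / h)) (at_right 0)"
    unfolding eventually_at_right_field
  proof (intro exI[of _ l] conjI allI impI)
    fix h assume "0 < h" "h < l"
    then show "?D l \<le> ((ln (F h) + \<kappa> * h) / h) / (k h / h)" using anti[of h l] by simp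
  qed (use l in auto)
  ultimately have "?D l \<le> 2 * (expectation Z + \<kappa>)"
    by (rule tendsto_lowerbound) simp
  then have "ln (F l) + \<kappa> * l \<le> 2 * (expectation Z + \<kappa>) * k l"
    using kpos[OF l] by (simp add: field_simps)
  then have "ln (F l) \<le> l * expectation Z + 2 * (expectation Z + \<kappa>) * (exp l - 1 - l)"
    by (simp add: k_def algebra_simps)
  then have "exp (ln (F l)) \<le> exp (l * expectation Z + 2 * (expectation Z + \<kappa>) * (exp l - 1 - l))"
    by (simp only: exp_le_cancel_iff)
  then show ?thesis unfolding exp_ln[OF Fpos] by (simp only: F_def)
qed

text \<open>Chernoff's bound at \<open>l = t / (v + t / 3)\<close>, combined with the series
  estimate for \<open>exp l - 1 - l\<close>.\<close>

lemma bernstein_tail: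
  fixes Z :: "'a \<Rightarrow> real"
  assumes m[measurable]: "Z \<in> borel_measurable M" and Z: "\<And>x. x \<in> space M \<Longrightarrow> \<bar>Z x\<bar> \<le> B"
    and mgf: "\<And>l. 0 < l \<Longrightarrow> expectation (\<lambda>x. exp (l * Z x)) \<le> exp (l * a + v * (exp l - 1 - l))"
    and v: "0 \<le> v" and t: "0 < t"
  shows "prob {x \<in> space M. a + t \<le> Z x} \<le> exp (- (t\<^sup>2 / (2 * v + 2 / 3 * t)))"
proof -
  have chernoff: "prob {x \<in> space M. a + t \<le> Z x} \<le> exp (v * (exp l - 1 - l) - l * t)" if "0 < l" for l
  proof -
    have "{x \<in> space M. a + t \<le> Z x} = {x \<in> space M. exp (l * (a + t)) \<le> exp (l * Z x)}"
      using that by auto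
    also have "prob \<dots> \<le> expectation (\<lambda>x. exp (l * Z x)) / exp (l * (a + t))"
      by (intro integral_Markov_inequality_measure[where A = "{}"] integrable_exp_bounded[OF m Z]) auto
    also have "\<dots> \<le> exp (l * a + v * (exp l - 1 - l)) / exp (l * (a + t))"
      by (intro divide_right_mono mgf that) auto
    also have "\<dots> = exp (v * (exp l - 1 - l) - l * t)" by (simp add: algebra_simps flip: exp_diff)
    finally show ?thesis .
  qed
  show ?thesis
  proof (cases "v = 0")
    \<comment> \<open>For \<open>v = 0\<close> the general choice would be \<open>l = 3\<close>,
      where the series estimate breaks down; \<open>l = 3/2\<close> gives the claimed exponent
      exactly.\<close>
    case True
    have eq: "t\<^sup>2 / (2 * v + 2 / 3 * t) = 3 / 2 * t"
      using t True by (simp add: power2_eq_square)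
    show ?thesis unfolding eq using chernoff[of "3/2"] True by simp
  next
    case False
    then have v: "0 < v" using v by simp
    define d where "d = v + t / 3"
    define l where "l = t / d"
    have d: "0 < d" "2 * v + 2 / 3 * t = 2 * d" using v t by (auto simp: d_def)
    have l: "0 < l" "l < 3" using v t d(1) by (auto simp: l_def d_def field_simps)
    have l1: "1 - l / 3 = v / d" using v t d(1) by (simp add: l_def d_def field_simps)
    have "v * (exp l - 1 - l) - l * t \<le> v * (l\<^sup>2 / (2 * (1 - l / 3))) - l * t"
      using exp_bound_bernstein[of l] l v by (intro diff_right_mono mult_left_mono) auto
    also have "\<dots> = - (t\<^sup>2 / (2 * v + 2 / 3 * t))"
      unfolding l1 d(2) using v t d(1) by (simp add: l_def field_simps power2_eq_square)
    finally show ?thesis using chernoff[OF l(1)] by (meson exp_le_cancel_iff order_trans)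
  qed
qed

text \<open>\<open>Zk k\<close> stands for the norm without the \<open>k\<close>-th summand and
  \<open>W k\<close> for a linear lower bound of the increment \<open>Z - Zk k\<close>, normalized
  to be at most 1. That \<open>W k\<close> is centred with small variance given the other
  coordinates is expressed through integrals weighted by \<open>exp (l * Zk k)\<close>, which
  depends on those coordinates alone.\<close>

lemma bousquet_PiM:
  fixes I :: "'i set" and Z :: "('i \<Rightarrow> 'a) \<Rightarrow> real"
  defines "Q \<equiv> iid I"
  assumes fin: "finite I"
    and m[measurable]: "Z \<in> borel_measurable Q"
    and Z: "\<And>x. x \<in> space Q \<Longrightarrow> 0 \<le> Z x" "\<And>x. x \<in> space Q \<Longrightarrow> Z x \<le> B"
    and mk: "\<And>k. k \<in> I \<Longrightarrow> Zk k \<in> borel_measurable Q"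
    and Zk: "\<And>k x. k \<in> I \<Longrightarrow> x \<in> space Q \<Longrightarrow> 0 \<le> Zk k x" "\<And>k x. k \<in> I \<Longrightarrow> x \<in> space Q \<Longrightarrow> Zk k x \<le> B"
    and Zk_upd: "\<And>k x y. k \<in> I \<Longrightarrow> Zk k (x(k := y)) = Zk k x"
    and mW: "\<And>k. k \<in> I \<Longrightarrow> W k \<in> borel_measurable Q"
    and W_bd: "\<And>k x. k \<in> I \<Longrightarrow> x \<in> space Q \<Longrightarrow> \<bar>W k x\<bar> \<le> 1"
    and W_le: "\<And>k x. k \<in> I \<Longrightarrow> x \<in> space Q \<Longrightarrow> W k x \<le> Z x - Zk k x"
    and V_le: "\<And>k x. k \<in> I \<Longrightarrow> x \<in> space Q \<Longrightarrow> Z x - Zk k x \<le> 1"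
    and V_sum: "\<And>x. x \<in> space Q \<Longrightarrow> (\<Sum>k\<in>I. Z x - Zk k x) \<le> Z x"
    and W_mean: "\<And>k l. k \<in> I \<Longrightarrow> (\<integral>x. exp (l * Zk k x) * W k x \<partial>Q) = 0"
    and W_var: "\<And>k l. k \<in> I \<Longrightarrow>
      (\<integral>x. exp (l * Zk k x) * (W k x)\<^sup>2 \<partial>Q) \<le> \<sigma>2 * (\<integral>x. exp (l * Zk k x) \<partial>Q)"
    and s2: "0 \<le> \<sigma>2" and t: "0 < t"
  shows "measure Q {x \<in> space Q. (\<integral>x. Z x \<partial>Q) + t \<le> Z x}
    \<le> exp (- (t\<^sup>2 / (2 * (real (card I) * \<sigma>2 + 2 * (\<integral>x. Z x \<partial>Q)) + 2 / 3 * t)))"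
proof -
  interpret Q: prob_space Q unfolding Q_def by (rule PiM_prob_space)
  \<comment> \<open>With this value \<open>2 * (E Z + \<kappa>)\<close> is the variance factor
    \<open>n * \<sigma>2 + 2 * E Z\<close>.\<close>
  define \<kappa> where "\<kappa> = real (card I) * \<sigma>2 / 2"
  have Zabs: "\<bar>Z x\<bar> \<le> B" if "x \<in> space Q" for x using Z[OF that] by simp
  have B: "0 \<le> B"
  proof -
    obtain x where "x \<in> space Q" using Q.not_empty by auto
    from Zabs[OF this] show ?thesis by linarith
  qed
  have int: "integrable Q (\<lambda>x. exp (l * Zk k x) * g x)"
    if "k \<in> I" "0 < l" "g \<in> borel_measurable Q" "\<And>x. x \<in> space Q \<Longrightarrow> \<bar>g x\<bar> \<le> C" for k l C and g :: "_ \<Rightarrow> real"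
  proof -
    note [measurable] = mk[OF that(1)] that(3)
    have "exp (l * Zk k x) * \<bar>g x\<bar> \<le> exp (l * B) * C" if "x \<in> space Q" for x
      using Zk(2)[OF \<open>k \<in> I\<close> that] \<open>0 < l\<close> that(1) \<open>\<And>x. x \<in> space Q \<Longrightarrow> \<bar>g x\<bar> \<le> C\<close>[OF that]
      by (intro mult_mono) auto
    then show ?thesis
      by (intro Q.integrable_const_bound[where B = "exp (l * B) * C"]) (auto intro!: AE_I2 simp: abs_mult)
  qed
  have ent: "l * (\<integral>x. Z x * exp (l * Z x) \<partial>Q) - (\<integral>x. exp (l * Z x) \<partial>Q) * ln (\<integral>x. exp (l * Z x) \<partial>Q)
      \<le> ent_fun l / (exp l - 1/2) * ((\<integral>x. Z x * exp (l * Z x) \<partial>Q) + \<kappa> * (\<integral>x. exp (l * Z x) \<partial>Q))"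
    if l: "0 < l" for l
  proof -
    define C where "C = ent_fun l / (exp l - 1/2)"
    have k': "0 < exp l - 1/2" using exp_ge_add_one_self[of l] l by linarith
    have C: "0 \<le> C" using k' ent_fun_nonneg by (simp add: C_def)
    have iZ: "integrable Q (\<lambda>x. exp (l * Z x))" "integrable Q (\<lambda>x. Z x * exp (l * Z x))" for l
      using Q.integrable_exp_bounded[OF m Zabs] by simp_all
    let ?F = "\<integral>x. exp (l * Z x) \<partial>Q"
    have pw: "rel_ent (exp (l * Z x)) (exp (l * Zk k x)) \<le>
        C * ((Z x - Zk k x) * exp (l * Z x) - exp (l * Zk k x) * W k x + exp (l * Zk k x) * (W k x)\<^sup>2 / 2)"
      if k: "k \<in> I" and x: "x \<in> space Q" for k x
    proof -
      define V where "V = Z x - Zk k x"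
      have V: "V \<le> 1" "W k x \<le> V" "W k x \<le> 1" using V_le[OF k x] W_le[OF k x] W_bd[OF k x] by (auto simp: V_def)
      have e: "exp (l * Z x) = exp (l * Zk k x) * exp (l * V)" by (simp add: V_def algebra_simps flip: exp_add)
      have "ent_fun (l * V) * (exp l - 1/2) \<le> ent_fun l * (V * exp (l * V) - V + V\<^sup>2 / 2)"
        by (rule bousquet_key_ineq) (use V l in auto)
      then have "ent_fun (l * V) \<le> C * (V * exp (l * V) - V + V\<^sup>2 / 2)"
        using k' by (simp add: C_def field_simps)
      also have "\<dots> \<le> C * (V * exp (l * V) - W k x + (W k x)\<^sup>2 / 2)"
      proof -
        \<comment> \<open>The function \<open>v^2 / 2 - v\<close> decreases on
          \<open>v \<le> 1\<close>, so the smaller variable \<open>W k\<close>, which is centred,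
          may replace \<open>V\<close>.\<close>
        have "0 \<le> (V - W k x) * (2 - V - W k x)" using V by (intro mult_nonneg_nonneg) auto
        then have "- V + V\<^sup>2 / 2 \<le> - W k x + (W k x)\<^sup>2 / 2"
          by (simp add: algebra_simps power2_eq_square)
        then show ?thesis using C by (intro mult_left_mono) auto
      qed
      finally have "exp (l * Zk k x) * ent_fun (l * V) \<le>
          exp (l * Zk k x) * (C * (V * exp (l * V) - W k x + (W k x)\<^sup>2 / 2))"
        by (intro mult_left_mono) auto
      moreover have "rel_ent (exp (l * Z x)) (exp (l * Zk k x)) = exp (l * Zk k x) * ent_fun (l * V)"
        using rel_ent_exp[of "l * Zk k x" "l * V"] by (simp add: V_def algebra_simps)
      ultimately show ?thesis by (simp add: e V_def algebra_simps)
    qed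
    have Fk: "(\<integral>x. exp (l * Zk k x) \<partial>Q) \<le> ?F" if k: "k \<in> I" for k
    proof -
      have iW: "integrable Q (\<lambda>x. exp (l * Zk k x) * W k x)" by (rule int[OF k l mW[OF k] W_bd[OF k]])
      have i1: "integrable Q (\<lambda>x. exp (l * Zk k x))" using int[OF k l, of "\<lambda>_. 1" 1] by simp
      \<comment> \<open>The term linear in \<open>W k\<close> integrates to 0, so adding the
        \<open>k\<close>-th summand does not decrease the exponential moment.\<close>
      have "exp (l * Zk k x) + l * (exp (l * Zk k x) * W k x) \<le> exp (l * Z x)" if x: "x \<in> space Q" for x
      proof -
        have "1 + l * W k x \<le> 1 + l * (Z x - Zk k x)" using W_le[OF k x] l by simp
        also have "\<dots> \<le> exp (l * (Z x - Zk k x))" by (rule exp_ge_add_one_self)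
        finally have "exp (l * Zk k x) * (1 + l * W k x) \<le> exp (l * Zk k x) * exp (l * (Z x - Zk k x))"
          by (intro mult_left_mono) auto
        then show ?thesis by (simp add: algebra_simps flip: exp_add)
      qed
      then have "(\<integral>x. exp (l * Zk k x) + l * (exp (l * Zk k x) * W k x) \<partial>Q) \<le> ?F"
        using iW i1 iZ by (intro integral_mono) auto
      then show ?thesis using iW i1 W_mean[OF k] by simp
    qed
    have Rk: "(\<integral>x. rel_ent (exp (l * Z x)) (exp (l * Zk k x)) \<partial>Q) \<le>
        C * ((\<integral>x. (Z x - Zk k x) * exp (l * Z x) \<partial>Q) + \<sigma>2 / 2 * ?F)"
      and iV: "integrable Q (\<lambda>x. (Z x - Zk k x) * exp (l * Z x))" if k: "k \<in> I" for k
    proof -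
      note [measurable] = mk[OF k] mW[OF k]
      have iW: "integrable Q (\<lambda>x. exp (l * Zk k x) * W k x)" by (rule int[OF k l mW[OF k] W_bd[OF k]])
      have iW2: "integrable Q (\<lambda>x. exp (l * Zk k x) * (W k x)\<^sup>2)"
      proof (rule int[OF k l])
        show "\<bar>(W k x)\<^sup>2\<bar> \<le> 1" if "x \<in> space Q" for x
          using power_mono[OF W_bd[OF k that], of 2] by simp
      qed measurable
      have "\<bar>Zk k x\<bar> \<le> B" if "x \<in> space Q" for x using Zk[OF k that] by simp
      note * = this
      have eZ: "exp (l * Z x) \<le> exp (l * B)" if "x \<in> space Q" for x using Z[OF that] l by simp
      have "integrable Q (\<lambda>x. Zk k x * exp (l * Z x))"
      proof (rule Q.integrable_const_bound[where B = "B * exp (l * B)"], rule AE_I2)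
        fix x assume x: "x \<in> space Q"
        have "\<bar>Zk k x\<bar> * exp (l * Z x) \<le> B * exp (l * B)" using *[OF x] eZ[OF x] B by (intro mult_mono) auto
        then show "norm (Zk k x * exp (l * Z x)) \<le> B * exp (l * B)" by (simp add: abs_mult)
      qed measurable
      then show iV: "integrable Q (\<lambda>x. (Z x - Zk k x) * exp (l * Z x))"
        using iZ by (simp add: left_diff_distrib)
      have "integrable Q (\<lambda>x. rel_ent (exp (l * Z x)) (exp (l * Zk k x)))"
      proof (rule Q.integrable_interval_bounded)
        fix x assume x: "x \<in> space Q"
        have "1 \<le> exp (l * Z x)" "exp (l * Z x) \<le> exp (l * B)" "1 \<le> exp (l * Zk k x)" "exp (l * Zk k x) \<le> exp (l * B)"
          using Z[OF x] Zk[OF k x] l by auto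
        from rel_ent_bounds[OF zero_less_one this]
        show "0 \<le> rel_ent (exp (l * Z x)) (exp (l * Zk k x))"
          "rel_ent (exp (l * Z x)) (exp (l * Zk k x)) \<le> (exp (l * B) - 1)\<^sup>2 / 1" .
      qed (simp add: rel_ent_def)
      then have "(\<integral>x. rel_ent (exp (l * Z x)) (exp (l * Zk k x)) \<partial>Q) \<le>
          (\<integral>x. C * ((Z x - Zk k x) * exp (l * Z x) - exp (l * Zk k x) * W k x + exp (l * Zk k x) * (W k x)\<^sup>2 / 2) \<partial>Q)"
        using iV iW iW2 pw[OF k] by (intro integral_mono) auto
      also have "\<dots> = C * ((\<integral>x. (Z x - Zk k x) * exp (l * Z x) \<partial>Q) + (\<integral>x. exp (l * Zk k x) * (W k x)\<^sup>2 \<partial>Q) / 2)"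
        using iV iW iW2 W_mean[OF k] by simp
      also have "\<dots> \<le> C * ((\<integral>x. (Z x - Zk k x) * exp (l * Z x) \<partial>Q) + \<sigma>2 / 2 * ?F)"
      proof -
        have "(\<integral>x. exp (l * Zk k x) * (W k x)\<^sup>2 \<partial>Q) \<le> \<sigma>2 * ?F"
          using W_var[OF k, of l] mult_left_mono[OF Fk[OF k] s2] by linarith
        then show ?thesis using C by (intro mult_left_mono) auto
      qed
      finally show "(\<integral>x. rel_ent (exp (l * Z x)) (exp (l * Zk k x)) \<partial>Q) \<le>
        C * ((\<integral>x. (Z x - Zk k x) * exp (l * Z x) \<partial>Q) + \<sigma>2 / 2 * ?F)" .
    qed
    have lnexp: "(\<integral>x. exp (l * Z x) * ln (exp (l * Z x)) \<partial>Q) = l * (\<integral>x. Z x * exp (l * Z x) \<partial>Q)"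
      by (simp add: mult_ac flip: integral_mult_right_zero)
    have tens: "(\<integral>x. exp (l * Z x) * ln (exp (l * Z x)) \<partial>Q) - ?F * ln ?F
        \<le> (\<Sum>k\<in>I. \<integral>x. rel_ent (exp (l * Z x)) (exp (l * Zk k x)) \<partial>Q)"
      unfolding Q_def
    proof (rule entropy_tensorization[OF fin zero_less_one])
      show "(\<lambda>x. exp (l * Z x)) \<in> borel_measurable (iid I)" unfolding Q_def[symmetric] by measurable
      show "(\<lambda>x. exp (l * Zk k x)) \<in> borel_measurable (iid I)" if "k \<in> I" for k
        using mk[OF that] unfolding Q_def[symmetric] by measurable
      show "exp (l * Zk k (x(k := y))) = exp (l * Zk k x)" if "k \<in> I" for k x y
        by (simp only: Zk_upd[OF that])
      show "1 \<le> exp (l * Z x)" "exp (l * Z x) \<le> exp (l * B)" if "x \<in> space (iid I)" for x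
        using Z[unfolded Q_def, OF that] l by auto
      show "1 \<le> exp (l * Zk k x)" "exp (l * Zk k x) \<le> exp (l * B)" if "k \<in> I" "x \<in> space (iid I)" for k x
        using Zk[unfolded Q_def, OF that] l by auto
    qed
    also have "\<dots> \<le> (\<Sum>k\<in>I. C * ((\<integral>x. (Z x - Zk k x) * exp (l * Z x) \<partial>Q) + \<sigma>2 / 2 * ?F))"
      by (rule sum_mono) (rule Rk)
    also have "\<dots> = C * ((\<integral>x. (\<Sum>k\<in>I. (Z x - Zk k x) * exp (l * Z x)) \<partial>Q) + \<kappa> * ?F)"
      using iV by (simp add: sum.distrib \<kappa>_def algebra_simps flip: sum_distrib_left)
    \<comment> \<open>The increments sum to at most \<open>Z\<close> pointwise, so weighted by
      \<open>exp (l * Z)\<close> they are bounded by the derivative of the moment generating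
      function, with coefficient one.\<close>
    also have "\<dots> \<le> C * ((\<integral>x. Z x * exp (l * Z x) \<partial>Q) + \<kappa> * ?F)"
    proof -
      have "(\<integral>x. (\<Sum>k\<in>I. (Z x - Zk k x) * exp (l * Z x)) \<partial>Q) \<le> (\<integral>x. Z x * exp (l * Z x) \<partial>Q)"
      proof (rule integral_mono)
        fix x assume "x \<in> space Q"
        from mult_right_mono[OF V_sum[OF this], of "exp (l * Z x)"]
        show "(\<Sum>k\<in>I. (Z x - Zk k x) * exp (l * Z x)) \<le> Z x * exp (l * Z x)"
          by (simp add: sum_distrib_right)
      qed (use iV iZ in auto)
      then show ?thesis using C by (intro mult_left_mono) auto
    qed
    finally show ?thesis unfolding lnexp C_def .
  qed
  have EZ: "0 \<le> (\<integral>x. Z x \<partial>Q)" by (rule integral_nonneg_AE) (auto intro!: AE_I2 Z)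
  have "measure Q {x \<in> space Q. (\<integral>x. Z x \<partial>Q) + t \<le> Z x}
    \<le> exp (- (t\<^sup>2 / (2 * (2 * ((\<integral>x. Z x \<partial>Q) + \<kappa>)) + 2 / 3 * t)))"
    using Q.mgf_le_of_entropy_le[OF m Zabs ent] EZ s2
    by (intro Q.bernstein_tail[OF m Zabs _ _ t]) (auto simp: \<kappa>_def algebra_simps)
  then show ?thesis by (simp add: \<kappa>_def algebra_simps)
qed

end

section \<open>McDiarmid's inequality\<close>

context prob_space
begin

text \<open>Integrating one coordinate costs a factor \<open>exp (l^2 * c^2 / 8)\<close> by
  Hoeffding's lemma, since a section of \<open>Z\<close> ranges in an interval of length
  \<open>c\<close>; the average \<open>Z'\<close> over that coordinate has oscillation at most
  \<open>c\<close> in each remaining one.\<close>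

lemma mcdiarmid_mgf:
  fixes I :: "'i set" and Z :: "('i \<Rightarrow> 'a) \<Rightarrow> real"
  assumes fin: "finite I"
    and "Z \<in> borel_measurable (iid I)"
    and "\<And>x. x \<in> space (iid I) \<Longrightarrow> \<bar>Z x\<bar> \<le> B"
    and "\<And>k x y y'. k \<in> I \<Longrightarrow> x \<in> space (iid I) \<Longrightarrow> y \<in> space M \<Longrightarrow> y' \<in> space M \<Longrightarrow>
      Z (x(k := y)) \<le> Z (x(k := y')) + c"
    and l: "0 < l"
  shows "(\<integral>x. exp (l * Z x) \<partial>iid I)
    \<le> exp (l * (\<integral>x. Z x \<partial>iid I) + real (card I) * (l\<^sup>2 * c\<^sup>2 / 8))"
  using assms(1-4)
proof (induction I arbitrary: Z rule: finite_induct)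
  case empty
  show ?case by (simp add: PiM_empty lebesgue_integral_count_space_finite)
next
  case (insert i I)
  let ?P = "iid I" and ?Q = "iid (insert i I)"
  interpret P: prob_space ?P by (rule PiM_prob_space)
  interpret Q: prob_space ?Q by (rule PiM_prob_space)
  note m[measurable] = insert.prems(1)
  have i: "i \<notin> I" and fin: "finite I" by fact+
  note upd = PiM_upd_space[of _ I _ i]
    and m1 = PiM_section_measurable[OF _ _ i] and m2 = PiM_section_integral_measurable[OF _ i]
  have Zb: "- B \<le> Z x" "Z x \<le> B" if "x \<in> space ?Q" for x using insert.prems(2)[OF that] by linarith+
  define Z' where "Z' x = (\<integral>y. Z (x(i := y)) \<partial>M)" for x
  have Z'm[measurable]: "Z' \<in> borel_measurable ?P" unfolding Z'_def using m by (rule m2)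
  have iZ1: "integrable M (\<lambda>y. Z (x(i := y)))" if "x \<in> space ?P" for x
    by (rule integrable_interval_bounded[OF m1[OF m that] Zb[OF upd[OF that]]])
  have Z'b: "\<bar>Z' x\<bar> \<le> B" if "x \<in> space ?P" for x
  proof -
    have "- B \<le> Z' x" "Z' x \<le> B" unfolding Z'_def
      by (rule expectation_in_interval[OF m1[OF m that] Zb[OF upd[OF that]]]; assumption)+
    then show ?thesis by linarith
  qed
  have Z'd: "Z' (x(k := y)) \<le> Z' (x(k := y')) + c"
    if k: "k \<in> I" and x: "x \<in> space ?P" and y: "y \<in> space M" "y' \<in> space M" for k x y y'
  proof -
    have s: "x(k := u) \<in> space ?P" if "u \<in> space M" for u
      using PiM_upd_space[OF x that, of k] k by (simp add: insert_absorb)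
    have tw: "x(k := u, i := v) = x(i := v, k := u)" for u v using k i by (auto simp: fun_upd_twist)
    have "Z' (x(k := y)) \<le> (\<integral>v. Z (x(k := y', i := v)) + c \<partial>M)" unfolding Z'_def
    proof (rule integral_mono)
      show "integrable M (\<lambda>v. Z (x(k := y, i := v)))" by (rule iZ1[OF s[OF y(1)]])
      show "integrable M (\<lambda>v. Z (x(k := y', i := v)) + c)"
        by (intro Bochner_Integration.integrable_add iZ1[OF s[OF y(2)]]) simp
      show "Z (x(k := y, i := v)) \<le> Z (x(k := y', i := v)) + c" if "v \<in> space M" for v
        unfolding tw using k by (intro insert.prems(3) upd[OF x that] y) auto
    qed
    also have "\<dots> = Z' (x(k := y')) + c" unfolding Z'_def
      by (subst Bochner_Integration.integral_add[OF iZ1[OF s[OF y(2)]]]) (simp_all add: prob_space)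
    finally show ?thesis .
  qed
  have inner: "(\<integral>y. exp (l * Z (x(i := y))) \<partial>M) \<le> exp (l * Z' x) * exp (l\<^sup>2 * c\<^sup>2 / 8)"
    if x: "x \<in> space ?P" for x
  proof -
    define f where "f y = Z (x(i := y))" for y
    have fm[measurable]: "f \<in> borel_measurable M" unfolding f_def by (rule m1[OF m x])
    have fB: "\<bar>f y\<bar> \<le> B" if "y \<in> space M" for y
      unfolding f_def by (rule insert.prems(2)[OF upd[OF x that]])
    have fd: "f y \<le> f y' + c" if "y \<in> space M" "y' \<in> space M" for y y'
    proof -
      have "Z ((x(i := y))(i := y)) \<le> Z ((x(i := y))(i := y')) + c"
        by (intro insert.prems(3) upd[OF x] that) simp
      then show ?thesis by (simp only: f_def fun_upd_upd)
    qed
    \<comment> \<open>The interval for Hoeffding's lemma starts at the infimum of the section; the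
      oscillation bound \<open>fd\<close> makes \<open>lo + c\<close> an upper end.\<close>
    define lo where "lo = Inf (f ` space M)"
    have bdd: "bdd_below (f ` space M)" by (rule bdd_belowI[of _ "- B"]) (use fB in \<open>force simp: abs_le_iff\<close>)
    have lo1: "lo \<le> f y" if "y \<in> space M" for y
      unfolding lo_def using that by (intro cInf_lower bdd) auto
    have lo2: "f y \<le> lo + c" if "y \<in> space M" for y
    proof -
      have "f y - c \<le> lo" unfolding lo_def
      proof (rule cInf_greatest)
        show "f ` space M \<noteq> {}" using not_empty by simp
        fix u assume "u \<in> f ` space M"
        then obtain y' where "y' \<in> space M" "u = f y'" by auto
        then show "f y - c \<le> u" using fd[OF that, of y'] by simp
      qed
      then show ?thesis by simp
    qed
    interpret f: interval_bounded_random_variable M f lo "lo + c"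
      by unfold_locales (auto intro!: AE_I2 lo1 lo2)
    have ie: "integrable M (\<lambda>y. exp (l * f y))" using integrable_exp_bounded[OF fm fB] by simp
    have "ennreal (\<integral>y. exp (l * (f y - expectation f)) \<partial>M) = (\<integral>\<^sup>+y. exp (l * (f y - expectation f)) \<partial>M)"
    proof (rule nn_integral_eq_integral[symmetric])
      show "integrable M (\<lambda>y. exp (l * (f y - expectation f)))"
        using ie by (simp add: right_diff_distrib exp_diff)
    qed simp
    also have "\<dots> \<le> ennreal (exp (l\<^sup>2 * (lo + c - lo)\<^sup>2 / 8))"
      by (rule f.Hoeffdings_lemma_nn_integral[OF l])
    finally have "(\<integral>y. exp (l * (f y - expectation f)) \<partial>M) \<le> exp (l\<^sup>2 * c\<^sup>2 / 8)"
      by simp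
    then have "exp (l * expectation f) * (\<integral>y. exp (l * (f y - expectation f)) \<partial>M)
        \<le> exp (l * expectation f) * exp (l\<^sup>2 * c\<^sup>2 / 8)"
      by (intro mult_left_mono) auto
    then have "(\<integral>y. exp (l * f y) \<partial>M) \<le> exp (l * expectation f) * exp (l\<^sup>2 * c\<^sup>2 / 8)"
      by (simp add: right_diff_distrib exp_diff)
    then show ?thesis unfolding f_def[abs_def] Z'_def .
  qed
  have iQ: "integrable ?Q (\<lambda>x. exp (l * Z x))" using Q.integrable_exp_bounded[OF m insert.prems(2)] by simp
  have iP: "integrable ?P (\<lambda>x. exp (l * Z' x))" using P.integrable_exp_bounded[OF Z'm Z'b] by simp
  have iQ0: "integrable ?Q Z" by (rule Q.integrable_interval_bounded[OF m Zb])
  have me: "(\<lambda>x. exp (l * Z x)) \<in> borel_measurable ?Q" by measurable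
  have "(\<integral>x. exp (l * Z x) \<partial>?Q) = (\<integral>x. (\<integral>y. exp (l * Z (x(i := y))) \<partial>M) \<partial>?P)"
    by (rule PiM_integral_insert[OF fin i iQ])
  also have "\<dots> \<le> (\<integral>x. exp (l * Z' x) * exp (l\<^sup>2 * c\<^sup>2 / 8) \<partial>?P)"
  proof (rule integral_mono')
    show "integrable ?P (\<lambda>x. exp (l * Z' x) * exp (l\<^sup>2 * c\<^sup>2 / 8))" using iP by simp
  qed (use inner in auto)
  also have "\<dots> = (\<integral>x. exp (l * Z' x) \<partial>?P) * exp (l\<^sup>2 * c\<^sup>2 / 8)" by simp
  also have "\<dots> \<le> exp (l * (\<integral>x. Z' x \<partial>?P) + real (card I) * (l\<^sup>2 * c\<^sup>2 / 8)) * exp (l\<^sup>2 * c\<^sup>2 / 8)"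
    by (intro mult_right_mono insert.IH[OF Z'm Z'b Z'd]) auto
  also have "(\<integral>x. Z' x \<partial>?P) = (\<integral>x. Z x \<partial>?Q)"
    unfolding Z'_def by (rule PiM_integral_insert[OF fin i iQ0, symmetric])
  also have "exp (l * (\<integral>x. Z x \<partial>?Q) + real (card I) * (l\<^sup>2 * c\<^sup>2 / 8)) * exp (l\<^sup>2 * c\<^sup>2 / 8)
      = exp (l * (\<integral>x. Z x \<partial>?Q) + real (card (insert i I)) * (l\<^sup>2 * c\<^sup>2 / 8))"
    using fin i by (simp add: mult_exp_exp algebra_simps)
  finally show ?case .
qed

lemma mcdiarmid_PiM:
  fixes I :: "'i set" and Z :: "('i \<Rightarrow> 'a) \<Rightarrow> real"
  defines "Q \<equiv> iid I"
  assumes fin: "finite I" "I \<noteq> {}" and c: "0 < c" and t: "0 < t"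
    and m[measurable]: "Z \<in> borel_measurable Q"
    and Z: "\<And>x. x \<in> space Q \<Longrightarrow> \<bar>Z x\<bar> \<le> B"
    and d: "\<And>k x y y'. k \<in> I \<Longrightarrow> x \<in> space Q \<Longrightarrow> y \<in> space M \<Longrightarrow> y' \<in> space M \<Longrightarrow>
      Z (x(k := y)) \<le> Z (x(k := y')) + c"
  shows "measure Q {x \<in> space Q. (\<integral>x. Z x \<partial>Q) + t \<le> Z x}
    \<le> exp (- (2 * t\<^sup>2 / (real (card I) * c\<^sup>2)))"
proof -
  interpret Q: prob_space Q unfolding Q_def by (rule PiM_prob_space)
  define N where "N = real (card I) * c\<^sup>2"
  define a where "a = (\<integral>x. Z x \<partial>Q)"
  have N: "0 < N" using fin c by (simp add: N_def card_gt_0_iff)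
  \<comment> \<open>The minimizer of \<open>N * l^2 / 8 - l * t\<close>.\<close>
  define l where "l = 4 * t / N"
  have l: "0 < l" using N t by (simp add: l_def)
  have int: "integrable Q (\<lambda>x. exp (l * Z x))" using Q.integrable_exp_bounded[OF m Z] by simp
  have "{x \<in> space Q. a + t \<le> Z x} = {x \<in> space Q. exp (l * (a + t)) \<le> exp (l * Z x)}"
    using l by auto
  also have "measure Q \<dots> \<le> (\<integral>x. exp (l * Z x) \<partial>Q) / exp (l * (a + t))"
    by (intro integral_Markov_inequality_measure[where A = "{}"] int) auto
  also have "\<dots> \<le> exp (l * a + real (card I) * (l\<^sup>2 * c\<^sup>2 / 8)) / exp (l * (a + t))"
    unfolding a_def Q_def
    by (intro divide_right_mono mcdiarmid_mgf[OF fin(1) m[unfolded Q_def] Z[unfolded Q_def] d[unfolded Q_def] l]) auto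
  also have "\<dots> = exp (N * l\<^sup>2 / 8 - l * t)" by (simp add: N_def algebra_simps flip: exp_diff)
  also have "N * l\<^sup>2 / 8 - l * t = - (2 * t\<^sup>2 / N)"
    using N by (simp add: l_def field_simps power2_eq_square)
  finally show ?thesis by (simp only: a_def N_def)
qed

end

section \<open>\<open>L\<^sub>p\<close> norms and duality\<close>

abbreviation abs_moment :: "real \<Rightarrow> 'a measure \<Rightarrow> ('a \<Rightarrow> real) \<Rightarrow> ennreal" where
  "abs_moment p \<mu> g \<equiv> \<integral>\<^sup>+ x. ennreal (\<bar>g x\<bar> powr p) \<partial>\<mu>"

section \<open>Powers on the extended half-line and their relation to \<open>Lp_norm\<close>\<close>

lemma enn_powr_ennreal: "0 \<le> r \<Longrightarrow> enn_powr (ennreal r) a = ennreal (r powr a)"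
  by (simp add: enn_powr_def)

lemma enn_powr_top [simp]: "enn_powr \<top> a = \<top>"
  by (simp add: enn_powr_def)

lemma enn_powr_0 [simp]: "enn_powr 0 a = 0"
  by (simp add: enn_powr_def)

lemma enn_powr_less_top: "enn_powr x a < \<top> \<longleftrightarrow> x < \<top>"
  by (auto simp: enn_powr_def less_top)

lemma enn_powr_1 [simp]: "enn_powr x 1 = x"
  by (cases x) (auto simp: enn_powr_def)

lemma enn_powr_mono: "x \<le> y \<Longrightarrow> 0 \<le> a \<Longrightarrow> enn_powr x a \<le> enn_powr y a"
  by (cases x; cases y) (auto simp: enn_powr_def top_unique intro!: ennreal_leI powr_mono2)

lemma enn_powr_powr: "enn_powr (enn_powr x a) b = enn_powr x (a * b)"
  by (cases x) (auto simp: enn_powr_def powr_powr)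

lemma enn_powr_eq_0_iff: "enn_powr x a = 0 \<longleftrightarrow> x = 0"
  by (cases x) (auto simp: enn_powr_def ennreal_eq_0_iff)

lemma enn_powr_mult: "enn_powr (x * y) a = enn_powr x a * enn_powr y a"
proof (cases "x = \<top> \<or> y = \<top>")
  case True
  then show ?thesis
    by (cases "x = 0 \<or> y = 0")
      (auto simp: ennreal_mult_eq_top_iff ennreal_top_mult ennreal_mult_top enn_powr_eq_0_iff)
next
  case False
  then obtain r t where "x = ennreal r" "0 \<le> r" "y = ennreal t" "0 \<le> t"
    by (metis ennreal_cases)
  then show ?thesis by (simp add: enn_powr_ennreal powr_mult flip: ennreal_mult)
qed

lemma borel_measurable_enn_powr [measurable]:
  assumes [measurable]: "f \<in> borel_measurable M"
  shows "(\<lambda>x. enn_powr (f x) a) \<in> borel_measurable M"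
  unfolding enn_powr_def by measurable

lemma Lp_norm_powr: "0 < p \<Longrightarrow> enn_powr (Lp_norm p \<mu> g) p = (abs_moment p \<mu> g)"
  by (simp add: Lp_norm_def enn_powr_powr)

lemma Lp_norm_le_iff:
  assumes "0 < p" "0 \<le> c"
  shows "Lp_norm p \<mu> g \<le> ennreal c \<longleftrightarrow> (abs_moment p \<mu> g) \<le> ennreal (c powr p)"
proof
  assume "Lp_norm p \<mu> g \<le> ennreal c"
  from enn_powr_mono[OF this, of p] assms
  show "(abs_moment p \<mu> g) \<le> ennreal (c powr p)"
    by (simp add: Lp_norm_powr enn_powr_ennreal)
next
  assume "(abs_moment p \<mu> g) \<le> ennreal (c powr p)"
  from enn_powr_mono[OF this, of "1 / p"] assms
  show "Lp_norm p \<mu> g \<le> ennreal c" by (simp add: Lp_norm_def enn_powr_ennreal powr_powr)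
qed

lemma Lp_norm_enn2real_powr:
  assumes "0 < p" "Lp_norm p \<mu> g < \<top>"
  shows "(abs_moment p \<mu> g) = ennreal (enn2real (Lp_norm p \<mu> g) powr p)"
  using assms Lp_norm_powr[of p \<mu> g]
  by (metis enn2real_nonneg enn_powr_ennreal ennreal_enn2real)

lemma Lp_norm_cong_AE:
  assumes "AE y in \<mu>. \<bar>f y\<bar> = \<bar>g y\<bar>" shows "Lp_norm p \<mu> f = Lp_norm p \<mu> g"
  unfolding Lp_norm_def using assms by (intro arg_cong2[where f = enn_powr] nn_integral_cong_AE) auto

lemma Lp_norm_cmult:
  assumes [measurable]: "g \<in> borel_measurable \<mu>" and "0 < p"
  shows "Lp_norm p \<mu> (\<lambda>y. c * g y) = ennreal \<bar>c\<bar> * Lp_norm p \<mu> g"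
proof -
  have "(abs_moment p \<mu> (\<lambda>y. c * g y)) = ennreal (\<bar>c\<bar> powr p) * (abs_moment p \<mu> g)"
    by (simp add: abs_mult powr_mult ennreal_mult nn_integral_cmult)
  then show ?thesis using assms by (simp add: Lp_norm_def enn_powr_mult enn_powr_ennreal powr_powr)
qed

text \<open>Convexity up to the boundary: if one point is 0, the claim reduces to
  \<open>v powr p \<le> v\<close> for the weight \<open>v\<close> of the other.\<close>

lemma powr_convex_nonneg:
  fixes x y u p :: real
  assumes "1 \<le> p" "0 \<le> x" "0 \<le> y" "0 \<le> u" "u \<le> 1"
  shows "(u * x + (1 - u) * y) powr p \<le> u * x powr p + (1 - u) * y powr p"
proof -
  have le: "v powr p \<le> v" if "0 \<le> v" "v \<le> 1" for v :: real
    using powr_mono'[of 1 p v] that assms(1) by simp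
  consider "x = 0" | "y = 0" | "0 < x" "0 < y" using assms by linarith
  then show ?thesis
  proof cases
    case 1
    then show ?thesis using le[of "1 - u"] assms by (simp add: powr_mult mult_right_mono)
  next
    case 2
    then show ?thesis using le[of u] assms by (simp add: powr_mult mult_right_mono)
  next
    case 3
    show ?thesis
      using convex_onD[OF powr_convex[OF assms(1)], of "1 - u" x y] assms 3 by (simp add: algebra_simps)
  qed
qed

lemma nn_integral_linear_comb_le:
  assumes [measurable]: "F \<in> borel_measurable \<mu>" "G \<in> borel_measurable \<mu>"
    and le: "\<And>y. \<phi> y \<le> a * F y + c * G y" and nn: "0 \<le> a" "0 \<le> c" "\<And>y. 0 \<le> F y" "\<And>y. 0 \<le> G y" "0 \<le> A" "0 \<le> B"
    and AB: "(\<integral>\<^sup>+ y. ennreal (F y) \<partial>\<mu>) \<le> ennreal A" "(\<integral>\<^sup>+ y. ennreal (G y) \<partial>\<mu>) \<le> ennreal B"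
  shows "(\<integral>\<^sup>+ y. ennreal (\<phi> y) \<partial>\<mu>) \<le> ennreal (a * A + c * B)"
proof -
  have "(\<integral>\<^sup>+ y. ennreal (\<phi> y) \<partial>\<mu>) \<le> (\<integral>\<^sup>+ y. ennreal a * ennreal (F y) + ennreal c * ennreal (G y) \<partial>\<mu>)"
    using le nn by (intro nn_integral_mono) (simp add: ennreal_leI flip: ennreal_mult ennreal_plus)
  also have "\<dots> = ennreal a * (\<integral>\<^sup>+ y. ennreal (F y) \<partial>\<mu>) + ennreal c * (\<integral>\<^sup>+ y. ennreal (G y) \<partial>\<mu>)"
    by (simp add: nn_integral_add nn_integral_cmult)
  also have "\<dots> \<le> ennreal a * ennreal A + ennreal c * ennreal B"
    by (intro add_mono mult_left_mono AB) auto
  finally show ?thesis using nn by (simp flip: ennreal_mult ennreal_plus)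
qed

text \<open>Minkowski's inequality from convexity of the \<open>p\<close>-th power alone, so
  \<open>p = 1\<close> is included: \<open>(f + g) / (A + B)\<close> is a convex combination of
  \<open>f / A\<close> and \<open>g / B\<close>. \<open>A\<close> and \<open>B\<close> exceed the
  norms by \<open>e / 2\<close>, which keeps them positive when a norm is 0; then \<open>e\<close>
  tends to 0.\<close>

lemma Lp_norm_triangle:
  assumes [measurable]: "f \<in> borel_measurable \<mu>" "g \<in> borel_measurable \<mu>" and p: "1 \<le> p"
  shows "Lp_norm p \<mu> (\<lambda>y. f y + g y) \<le> Lp_norm p \<mu> f + Lp_norm p \<mu> g"
proof (cases "Lp_norm p \<mu> f < \<top> \<and> Lp_norm p \<mu> g < \<top>")
  case True
  define a b where "a = enn2real (Lp_norm p \<mu> f)" and "b = enn2real (Lp_norm p \<mu> g)"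
  have ab: "Lp_norm p \<mu> f = ennreal a" "Lp_norm p \<mu> g = ennreal b" "0 \<le> a" "0 \<le> b"
    using True by (auto simp: a_def b_def)
  have key: "Lp_norm p \<mu> (\<lambda>y. f y + g y) \<le> ennreal (a + b) + ennreal e" if e: "0 < e" for e
  proof -
    define A B u where "A = a + e / 2" and "B = b + e / 2" and "u = A / (A + B)"
    have AB: "0 < A" "0 < B" "a \<le> A" "b \<le> B" using e ab by (auto simp: A_def B_def)
    have u: "0 \<le> u" "u \<le> 1" "1 - u = B / (A + B)" using AB by (auto simp: u_def field_simps)
    have If: "(abs_moment p \<mu> f) \<le> ennreal (A powr p)"
      using ab AB p Lp_norm_le_iff[of p A \<mu> f] by (auto simp: ennreal_leI)
    have Ig: "(abs_moment p \<mu> g) \<le> ennreal (B powr p)"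
      using ab AB p Lp_norm_le_iff[of p B \<mu> g] by (auto simp: ennreal_leI)
    define C where "C = (A + B) powr p"
    have "\<bar>f y + g y\<bar> powr p \<le> C * u / A powr p * \<bar>f y\<bar> powr p + C * (1 - u) / B powr p * \<bar>g y\<bar> powr p" for y
    proof -
      have "\<bar>f y + g y\<bar> powr p \<le> (\<bar>f y\<bar> + \<bar>g y\<bar>) powr p" using p by (intro powr_mono2) auto
      also have "\<bar>f y\<bar> + \<bar>g y\<bar> = (A + B) * (u * (\<bar>f y\<bar> / A) + (1 - u) * (\<bar>g y\<bar> / B))"
        unfolding u(3) using AB by (simp add: u_def distrib_left)
      also have "\<dots> powr p = C * (u * (\<bar>f y\<bar> / A) + (1 - u) * (\<bar>g y\<bar> / B)) powr p"
        using AB u by (simp add: C_def powr_mult)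
      also have "\<dots> \<le> C * (u * (\<bar>f y\<bar> / A) powr p + (1 - u) * (\<bar>g y\<bar> / B) powr p)"
        using AB u p by (intro mult_left_mono powr_convex_nonneg) (auto simp: C_def)
      also have "\<dots> = C * u / A powr p * \<bar>f y\<bar> powr p + C * (1 - u) / B powr p * \<bar>g y\<bar> powr p"
        using AB by (simp add: powr_divide algebra_simps)
      finally show ?thesis .
    qed
    moreover have "0 \<le> C * u / A powr p" "0 \<le> C * (1 - u) / B powr p" using u(1,2) by (auto simp: C_def)
    ultimately have "abs_moment p \<mu> (\<lambda>y. f y + g y) \<le>
        ennreal (C * u / A powr p * A powr p + C * (1 - u) / B powr p * B powr p)"
      by (intro nn_integral_linear_comb_le[where F = "\<lambda>y. \<bar>f y\<bar> powr p" and G = "\<lambda>y. \<bar>g y\<bar> powr p"] If Ig) auto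
    also have "C * u / A powr p * A powr p + C * (1 - u) / B powr p * B powr p = C"
      using AB by (simp add: right_diff_distrib)
    finally have "(abs_moment p \<mu> (\<lambda>y. f y + g y)) \<le> ennreal ((A + B) powr p)" by (simp add: C_def)
    then have "Lp_norm p \<mu> (\<lambda>y. f y + g y) \<le> ennreal (A + B)" using AB p by (subst Lp_norm_le_iff) auto
    also have "A + B = a + b + e" by (simp add: A_def B_def)
    also have "ennreal \<dots> = ennreal (a + b) + ennreal e" using ab e by (intro ennreal_plus) auto
    finally show ?thesis .
  qed
  have "Lp_norm p \<mu> (\<lambda>y. f y + g y) \<le> ennreal (a + b)"
    by (rule ennreal_le_epsilon) (rule key)
  also have "\<dots> = Lp_norm p \<mu> f + Lp_norm p \<mu> g" unfolding ab(1,2) using ab(3,4) by (rule ennreal_plus)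
  finally show ?thesis .
qed (auto simp: less_top[symmetric])

lemma Lp_norm_sum_le:
  assumes "finite I" "\<And>i. i \<in> I \<Longrightarrow> f i \<in> borel_measurable \<mu>" "1 \<le> p"
  shows "Lp_norm p \<mu> (\<lambda>y. \<Sum>i\<in>I. f i y) \<le> (\<Sum>i\<in>I. Lp_norm p \<mu> (f i))"
  using assms
proof (induction I rule: finite_induct)
  case empty
  then show ?case by (simp add: Lp_norm_def)
next
  case (insert i I)
  have "Lp_norm p \<mu> (\<lambda>y. f i y + (\<Sum>i\<in>I. f i y)) \<le> Lp_norm p \<mu> (f i) + Lp_norm p \<mu> (\<lambda>y. \<Sum>i\<in>I. f i y)"
    using insert.prems by (intro Lp_norm_triangle) auto
  also have "\<dots> \<le> Lp_norm p \<mu> (f i) + (\<Sum>i\<in>I. Lp_norm p \<mu> (f i))"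
    using insert by (intro add_left_mono) auto
  finally show ?case using insert.hyps by simp
qed

text \<open>Young's inequality for \<open>f / A\<close> and \<open>g / B\<close>, integrated.
  \<open>A\<close> and \<open>B\<close> are positive upper bounds for the norms rather than the
  norms, which avoids the case of a vanishing norm.\<close>

lemma holder_nn_integral:
  assumes [measurable]: "f \<in> borel_measurable \<mu>" "g \<in> borel_measurable \<mu>"
    and pq: "1 < p" "1 < q" "1 / p + 1 / q = 1" and AB: "0 < A" "0 < B"
    and F: "(abs_moment p \<mu> f) \<le> ennreal (A powr p)"
    and G: "(abs_moment q \<mu> g) \<le> ennreal (B powr q)"
  shows "(\<integral>\<^sup>+ y. ennreal (\<bar>f y\<bar> * \<bar>g y\<bar>) \<partial>\<mu>) \<le> ennreal (A * B)"
proof -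
  have "\<bar>f y\<bar> * \<bar>g y\<bar> \<le> A * B / (p * A powr p) * \<bar>f y\<bar> powr p + A * B / (q * B powr q) * \<bar>g y\<bar> powr q" for y
  proof -
    have "(\<bar>f y\<bar> / A) * (\<bar>g y\<bar> / B) \<le> (\<bar>f y\<bar> / A) powr p / p + (\<bar>g y\<bar> / B) powr q / q"
      using pq AB by (intro Youngs_inequality) auto
    from mult_left_mono[OF this, of "A * B"] show ?thesis using AB by (simp add: powr_divide field_simps)
  qed
  moreover have "0 \<le> A * B / (p * A powr p)" "0 \<le> A * B / (q * B powr q)" using AB pq by auto
  ultimately have "(\<integral>\<^sup>+ y. ennreal (\<bar>f y\<bar> * \<bar>g y\<bar>) \<partial>\<mu>) \<le>
      ennreal (A * B / (p * A powr p) * A powr p + A * B / (q * B powr q) * B powr q)"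
    by (intro nn_integral_linear_comb_le[where F = "\<lambda>y. \<bar>f y\<bar> powr p" and G = "\<lambda>y. \<bar>g y\<bar> powr q"] F G) auto
  also have "A * B / (p * A powr p) * A powr p + A * B / (q * B powr q) * B powr q = A * B * (1 / p + 1 / q)"
    using AB pq by (simp add: field_simps)
  finally show ?thesis using pq by simp
qed

text \<open>Hoelder's inequality against the constant 1, whose moments on a probability space are
  1.\<close>

lemma (in prob_space) enn_powr_nn_integral_le:
  assumes [measurable]: "g \<in> borel_measurable M" and p: "1 \<le> p"
  shows "enn_powr (\<integral>\<^sup>+ x. ennreal \<bar>g x\<bar> \<partial>M) p \<le> (abs_moment p M g)"
proof (cases "p = 1 \<or> (abs_moment p M g) = \<top>")
  case True
  then show ?thesis by auto
next
  case False
  then have p: "1 < p" using p by auto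
  have fin: "(abs_moment p M g) < \<top>" using False by (simp add: less_top)
  show ?thesis
  proof (cases "(abs_moment p M g) = 0")
    case True
    then have "AE x in M. g x = 0" by (subst (asm) nn_integral_0_iff_AE) (auto simp: ennreal_eq_0_iff)
    then have "(\<integral>\<^sup>+ x. ennreal \<bar>g x\<bar> \<partial>M) = (\<integral>\<^sup>+ x. 0 \<partial>M)" by (intro nn_integral_cong_AE) auto
    then show ?thesis by simp
  next
    case False
    define A where "A = enn2real (abs_moment p M g) powr (1 / p)"
    have "0 < enn2real (abs_moment p M g)"
      using False fin by (simp add: enn2real_positive_iff zero_less_iff_neq_zero)
    then have A: "0 < A" by (simp add: A_def)
    have J: "(abs_moment p M g) = ennreal (A powr p)"
      using fin p by (simp add: A_def powr_powr)
    have q: "1 < p / (p - 1)" "1 / p + 1 / (p / (p - 1)) = 1" using p by (auto simp: field_simps)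
    have "(\<integral>\<^sup>+ x. ennreal (\<bar>g x\<bar> * \<bar>1\<bar>) \<partial>M) \<le> ennreal (A * 1)"
      using J by (intro holder_nn_integral[OF _ _ p q A]) (simp_all add: emeasure_space_1)
    then have "enn_powr (\<integral>\<^sup>+ x. ennreal \<bar>g x\<bar> \<partial>M) p \<le> enn_powr (ennreal A) p"
      using p by (intro enn_powr_mono) auto
    then show ?thesis using A by (simp add: J enn_powr_ennreal)
  qed
qed

text \<open>Outside the integrable case the Bochner integral is 0 by convention and the bound is
  trivial, so it applies without any integrability check.\<close>

lemma (in prob_space) powr_abs_expectation_le:
  fixes g :: "'a \<Rightarrow> real"
  assumes [measurable]: "g \<in> borel_measurable M" and p: "1 \<le> p"
  shows "ennreal (\<bar>expectation g\<bar> powr p) \<le> (abs_moment p M g)"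
proof (cases "integrable M g")
  case True
  have "ennreal \<bar>expectation g\<bar> \<le> (\<integral>\<^sup>+ x. ennreal \<bar>g x\<bar> \<partial>M)"
    using integral_norm_bound_ennreal[OF True] by simp
  from enn_powr_mono[OF this, of p] p have "ennreal (\<bar>expectation g\<bar> powr p) \<le> enn_powr (\<integral>\<^sup>+ x. ennreal \<bar>g x\<bar> \<partial>M) p"
    by (simp add: enn_powr_ennreal)
  also have "\<dots> \<le> (abs_moment p M g)" by (rule enn_powr_nn_integral_le) fact+
  finally show ?thesis .
qed (simp add: not_integrable_integral_eq)

text \<open>The norming functional of \<open>g\<close> in the dual of \<open>L\<^sub>p\<close>; it is zero if the norm of \<open>g\<close> is
  (by division by zero).\<close>

definition dual_fun :: "real \<Rightarrow> 't measure \<Rightarrow> ('t \<Rightarrow> real) \<Rightarrow> 't \<Rightarrow> real" where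
  "dual_fun p \<mu> g t = sgn (g t) * (\<bar>g t\<bar> / enn2real (Lp_norm p \<mu> g)) powr (p - 1)"

lemma dual_fun_measurable [measurable]:
  assumes [measurable]: "g \<in> borel_measurable \<mu>"
  shows "dual_fun p \<mu> g \<in> borel_measurable \<mu>"
  unfolding dual_fun_def[abs_def] by measurable

lemma dual_fun_norm_le:
  assumes [measurable]: "g \<in> borel_measurable \<mu>" and p: "1 < p" and fin: "Lp_norm p \<mu> g < \<top>"
  shows "(abs_moment (p / (p - 1)) \<mu> (dual_fun p \<mu> g)) \<le> 1"
proof -
  define N where "N = enn2real (Lp_norm p \<mu> g)"
  have N: "0 \<le> N" by (simp add: N_def)
  have "\<bar>dual_fun p \<mu> g t\<bar> powr (p / (p - 1)) = (\<bar>g t\<bar> / N) powr p" for t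
    using p by (simp add: dual_fun_def N_def abs_mult abs_sgn_eq powr_powr)
  then have "(abs_moment (p / (p - 1)) \<mu> (dual_fun p \<mu> g)) =
      (\<integral>\<^sup>+ t. ennreal (1 / N powr p) * ennreal (\<bar>g t\<bar> powr p) \<partial>\<mu>)"
    using N by (simp add: powr_divide flip: ennreal_mult)
  also have "\<dots> = ennreal (1 / N powr p) * ennreal (N powr p)"
    using Lp_norm_enn2real_powr[of p \<mu> g] p fin by (simp add: nn_integral_cmult N_def)
  \<comment> \<open>For \<open>N = 0\<close> division by zero makes the functional 0, so its norm is
    at most 1 but not always equal to 1.\<close>
  also have "\<dots> \<le> 1" by (cases "N = 0") (simp_all flip: ennreal_mult)
  finally show ?thesis .
qed

text \<open>The bound \<open>b\<close> may be 0, whereas \<open>holder_nn_integral\<close> takes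
  positive bounds; hence the passage through \<open>b + e\<close>.\<close>

lemma conjugate_pairing:
  assumes [measurable]: "l \<in> borel_measurable \<mu>" "k \<in> borel_measurable \<mu>" and p: "1 < p"
    and l: "(abs_moment (p / (p - 1)) \<mu> l) \<le> 1"
    and b: "0 \<le> b" "Lp_norm p \<mu> k \<le> ennreal b"
  shows "(\<integral>\<^sup>+ t. ennreal (\<bar>l t\<bar> * \<bar>k t\<bar>) \<partial>\<mu>) \<le> ennreal b"
    "integrable \<mu> (\<lambda>t. l t * k t)" "\<bar>\<integral>t. l t * k t \<partial>\<mu>\<bar> \<le> b"
proof -
  have key: "(\<integral>\<^sup>+ t. ennreal (\<bar>l t\<bar> * \<bar>k t\<bar>) \<partial>\<mu>) \<le> ennreal b + ennreal e" if e: "0 < e" for e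
  proof -
    have q: "1 < p / (p - 1)" "1 / (p / (p - 1)) + 1 / p = 1" using p by (auto simp: field_simps)
    have "Lp_norm p \<mu> k \<le> ennreal (b + e)" by (rule order_trans[OF b(2)]) (use e in \<open>simp add: ennreal_leI\<close>)
    then have "(abs_moment p \<mu> k) \<le> ennreal ((b + e) powr p)"
      using b e p by (intro Lp_norm_le_iff[THEN iffD1]) auto
    then have "(\<integral>\<^sup>+ t. ennreal (\<bar>l t\<bar> * \<bar>k t\<bar>) \<partial>\<mu>) \<le> ennreal (1 * (b + e))"
      using l b e by (intro holder_nn_integral[OF _ _ q(1) p q(2)]) auto
    then show ?thesis using b e by simp
  qed
  show le: "(\<integral>\<^sup>+ t. ennreal (\<bar>l t\<bar> * \<bar>k t\<bar>) \<partial>\<mu>) \<le> ennreal b"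
    by (rule ennreal_le_epsilon) (rule key)
  show int: "integrable \<mu> (\<lambda>t. l t * k t)"
    using le by (intro integrableI_bounded) (auto simp: abs_mult intro: order_le_less_trans)
  have "ennreal \<bar>\<integral>t. l t * k t \<partial>\<mu>\<bar> \<le> ennreal b"
    using integral_norm_bound_ennreal[OF int] le by (simp add: abs_mult)
  then show "\<bar>\<integral>t. l t * k t \<partial>\<mu>\<bar> \<le> b" using b by (simp add: ennreal_le_iff)
qed

lemma dual_fun_attains:
  assumes [measurable]: "g \<in> borel_measurable \<mu>" and p: "1 < p" and fin: "Lp_norm p \<mu> g < \<top>"
  shows "(\<integral>t. dual_fun p \<mu> g t * g t \<partial>\<mu>) = enn2real (Lp_norm p \<mu> g)"
proof -
  define N where "N = enn2real (Lp_norm p \<mu> g)"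
  have N: "0 \<le> N" by (simp add: N_def)
  have eq: "dual_fun p \<mu> g t * g t = N / N powr p * \<bar>g t\<bar> powr p" for t
  proof (cases "N = 0 \<or> g t = 0")
    case True
    then show ?thesis by (auto simp: dual_fun_def simp flip: N_def)
  next
    case False
    have "dual_fun p \<mu> g t * g t = (\<bar>g t\<bar> powr (p - 1) * \<bar>g t\<bar>) / N powr (p - 1)"
      using N by (simp add: dual_fun_def powr_divide sgn_if flip: N_def)
    also have "\<bar>g t\<bar> powr (p - 1) * \<bar>g t\<bar> = \<bar>g t\<bar> powr p"
      using False by (simp add: powr_diff)
    finally show ?thesis using False N by (simp add: powr_diff)
  qed
  have I: "(\<integral>t. \<bar>g t\<bar> powr p \<partial>\<mu>) = N powr p"
    using Lp_norm_enn2real_powr[of p \<mu> g] p fin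
    by (intro integral_eq_nn_integral[THEN trans]) (auto simp: N_def)
  show ?thesis unfolding eq integral_mult_right_zero I by (simp add: N_def)
qed

section \<open>Moments of sums of independent variables\<close>

text \<open>The tangent bound \<open>u \<le> exp (u - 1)\<close> at \<open>u = l * x / s\<close>,
  raised to the power \<open>s\<close>; equality holds at \<open>x = s / l\<close>.\<close>

lemma powr_le_exp:
  fixes x l s :: real
  assumes "0 \<le> x" "0 < l" "0 < s"
  shows "x powr s \<le> (s / (exp 1 * l)) powr s * exp (l * x)"
proof -
  have "l * x / s \<le> exp (l * x / s - 1)" using exp_ge_add_one_self[of "l * x / s - 1"] by linarith
  then have "l * x / s * exp 1 \<le> exp (l * x / s)" by (simp add: exp_diff pos_le_divide_eq)
  then have "s / (exp 1 * l) * (l * x / s * exp 1) \<le> s / (exp 1 * l) * exp (l * x / s)"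
    using assms by (intro mult_left_mono) auto
  then have "x \<le> s / (exp 1 * l) * exp (l * x / s)" using assms by simp
  then have "x powr s \<le> (s / (exp 1 * l) * exp (l * x / s)) powr s" using assms by (intro powr_mono2) auto
  also have "\<dots> = (s / (exp 1 * l)) powr s * exp (l * x / s) powr s" by (rule powr_mult)
  also have "exp (l * x / s) powr s = exp (l * x)" using assms by (simp add: powr_def)
  finally show ?thesis .
qed

text \<open>Each share \<open>u\<close> of the total satisfies \<open>u \<le> u powr t\<close>, and
  the two shares add up to 1.\<close>

lemma powr_add_le:
  fixes x y t :: real
  assumes "0 \<le> x" "0 \<le> y" "0 < t" "t \<le> 1"
  shows "(x + y) powr t \<le> x powr t + y powr t"
proof (cases "x + y = 0")
  case False
  then have p: "0 < x + y" using assms by simp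
  have le: "u * (x + y) powr t \<le> (u * (x + y)) powr t" if "0 \<le> u" "u \<le> 1" for u
  proof -
    have "u \<le> u powr t" using powr_mono'[of t 1 u] that assms by simp
    then show ?thesis using that p by (simp add: powr_mult mult_right_mono)
  qed
  have "(x + y) powr t = x / (x + y) * (x + y) powr t + y / (x + y) * (x + y) powr t"
    using p by (simp flip: distrib_right add_divide_distrib)
  also have "\<dots> \<le> (x / (x + y) * (x + y)) powr t + (y / (x + y) * (x + y)) powr t"
    using p assms by (intro add_mono le) auto
  finally show ?thesis using p by simp
qed (use assms in simp)

lemma powr_sum_two_le:
  fixes x y s :: real
  assumes "1 \<le> s"
  shows "\<bar>x + y\<bar> powr s \<le> 2 powr (s - 1) * (\<bar>x\<bar> powr s + \<bar>y\<bar> powr s)"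
proof -
  have "\<bar>x + y\<bar> powr s \<le> (2 * (1/2 * \<bar>x\<bar> + (1 - 1/2) * \<bar>y\<bar>)) powr s"
    using assms by (intro powr_mono2) auto
  also have "\<dots> = 2 powr s * (1/2 * \<bar>x\<bar> + (1 - 1/2) * \<bar>y\<bar>) powr s" by (rule powr_mult)
  also have "\<dots> \<le> 2 powr s * (1/2 * \<bar>x\<bar> powr s + (1 - 1/2) * \<bar>y\<bar> powr s)"
    using assms by (intro mult_left_mono powr_convex_nonneg) auto
  also have "\<dots> = 2 powr (s - 1) * (\<bar>x\<bar> powr s + \<bar>y\<bar> powr s)" by (simp add: powr_diff field_simps)
  finally show ?thesis .
qed

text \<open>Raise the average of the left-hand terms to the power \<open>2 / s \<ge> 1\<close>, use
  convexity and the parallelogram identity for squares, and return by subadditivity of the power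
  \<open>s / 2 \<le> 1\<close>.\<close>

lemma powr_parallelogram:
  fixes a d s :: real
  assumes "1 \<le> s" "s \<le> 2"
  shows "\<bar>a + d\<bar> powr s + \<bar>a - d\<bar> powr s \<le> 2 * \<bar>a\<bar> powr s + 2 * \<bar>d\<bar> powr s"
proof -
  have sq: "(\<bar>x\<bar> powr s) powr (2 / s) = x\<^sup>2" for x :: real
    using assms by (simp add: powr_powr)
  have sq': "(x\<^sup>2) powr (s / 2) = \<bar>x\<bar> powr s" for x :: real
  proof -
    have "x\<^sup>2 = \<bar>x\<bar> powr 2" by simp
    then show ?thesis by (simp only: powr_powr) simp
  qed
  define m where "m = 1/2 * \<bar>a + d\<bar> powr s + (1 - 1/2) * \<bar>a - d\<bar> powr s"
  have m: "0 \<le> m" by (simp add: m_def)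
  have "m powr (2 / s) \<le> 1/2 * (\<bar>a + d\<bar> powr s) powr (2 / s) + (1 - 1/2) * (\<bar>a - d\<bar> powr s) powr (2 / s)"
    unfolding m_def using assms by (intro powr_convex_nonneg) auto
  also have "\<dots> = a\<^sup>2 + d\<^sup>2" unfolding sq by (simp add: power2_eq_square field_simps)
  finally have "(m powr (2 / s)) powr (s / 2) \<le> (a\<^sup>2 + d\<^sup>2) powr (s / 2)"
    using assms by (intro powr_mono2) auto
  also have "\<dots> \<le> (a\<^sup>2) powr (s / 2) + (d\<^sup>2) powr (s / 2)" using assms by (intro powr_add_le) auto
  finally have "m \<le> \<bar>a\<bar> powr s + \<bar>d\<bar> powr s" using m assms unfolding sq' by (simp add: powr_powr)
  then show ?thesis by (simp add: m_def)
qed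

section \<open>Adding independent centred summands one coordinate at a time\<close>

context prob_space
begin

lemma PiM_nn_integral_insert:
  assumes "finite I" "i \<notin> I" "f \<in> borel_measurable (iid (insert i I))"
  shows "(\<integral>\<^sup>+x. f x \<partial>iid (insert i I)) = (\<integral>\<^sup>+x. (\<integral>\<^sup>+y. f (x(i := y)) \<partial>M) \<partial>iid I)"
proof -
  interpret product_prob_space "\<lambda>_. M" I by standard
  show ?thesis by (rule product_nn_integral_insert[OF assms])
qed

lemma PiM_nn_integral_prod:
  assumes "finite I" "\<And>i. i \<in> I \<Longrightarrow> f i \<in> borel_measurable M"
  shows "(\<integral>\<^sup>+ x. (\<Prod>i\<in>I. f i (x i)) \<partial>iid I) = (\<Prod>i\<in>I. integral\<^sup>N M (f i))"
proof -
  interpret product_prob_space "\<lambda>_. M" I by standard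
  show ?thesis by (rule product_nn_integral_prod[OF assms])
qed

text \<open>When a coordinate is integrated, the sum over the others acts as a shift. A scalar
  estimate valid for every shift, with additive cost \<open>K\<close>, therefore accumulates
  linearly.\<close>

lemma PiM_moment_le:
  fixes g :: "'a \<Rightarrow> real"
  assumes fin: "finite I" and [measurable]: "g \<in> borel_measurable M"
    and step: "\<And>a. (abs_moment s M (\<lambda>x. a + g x)) \<le> ennreal (\<bar>a\<bar> powr s) + K"
  shows "(abs_moment s (iid I) (\<lambda>x. a + (\<Sum>i\<in>I. g (x i))))
    \<le> ennreal (\<bar>a\<bar> powr s) + of_nat (card I) * K"
  using fin
proof (induction I rule: finite_induct)
  case empty
  show ?case by (simp add: PiM_empty nn_integral_count_space_finite)
next
  case (insert i I)
  interpret P: prob_space "iid I" by (rule PiM_prob_space)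
  have "(\<integral>\<^sup>+x. ennreal (\<bar>a + (\<Sum>j\<in>insert i I. g (x j))\<bar> powr s) \<partial>iid (insert i I))
      = (\<integral>\<^sup>+x. (abs_moment s M (\<lambda>y. a + (\<Sum>j\<in>insert i I. g ((x(i := y)) j)))) \<partial>iid I)"
    by (rule PiM_nn_integral_insert[OF insert.hyps]) measurable
  also have "\<dots> = (\<integral>\<^sup>+x. (abs_moment s M (\<lambda>y. (a + (\<Sum>j\<in>I. g (x j))) + g y)) \<partial>iid I)"
  proof -
    have "(\<Sum>j\<in>insert i I. g ((x(i := y)) j)) = g y + (\<Sum>j\<in>I. g (x j))" for x y
      using insert.hyps by (auto intro!: sum.cong)
    then show ?thesis by (simp only: add_ac)
  qed
  also have "\<dots> \<le> (\<integral>\<^sup>+x. ennreal (\<bar>a + (\<Sum>j\<in>I. g (x j))\<bar> powr s) + K \<partial>iid I)"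
    by (intro nn_integral_mono step)
  also have "\<dots> = (abs_moment s (iid I) (\<lambda>x. a + (\<Sum>j\<in>I. g (x j)))) + K"
    by (subst nn_integral_add) (simp_all add: P.emeasure_space_1)
  also have "\<dots> \<le> (ennreal (\<bar>a\<bar> powr s) + of_nat (card I) * K) + K"
    by (intro add_right_mono insert.IH)
  also have "\<dots> = ennreal (\<bar>a\<bar> powr s) + of_nat (card (insert i I)) * K"
    using insert.hyps by (simp add: algebra_simps)
  finally show ?case .
qed

text \<open>The cross term with \<open>a\<close> vanishes because the increment is centred, and the
  variance is at most the second moment.\<close>

lemma centered_second_moment_le:
  fixes w :: "'a \<Rightarrow> real"
  assumes [measurable]: "w \<in> borel_measurable M"
  shows "(abs_moment 2 M (\<lambda>x. a + (w x - expectation w)))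
    \<le> ennreal (\<bar>a\<bar> powr 2) + (\<integral>\<^sup>+x. ennreal ((w x)\<^sup>2) \<partial>M)"
proof (cases "(\<integral>\<^sup>+x. ennreal ((w x)\<^sup>2) \<partial>M) = \<top>")
  case False
  then have i2: "integrable M (\<lambda>x. (w x)\<^sup>2)" by (intro integrableI_bounded) (simp_all add: less_top)
  then have i1: "integrable M w" by (rule square_integrable_imp_integrable[rotated]) simp
  let ?m = "expectation w"
  have eq: "(a + (w x - ?m))\<^sup>2 = (a - ?m)\<^sup>2 + 2 * (a - ?m) * w x + (w x)\<^sup>2" for x
    by (simp add: power2_eq_square algebra_simps)
  have "(abs_moment 2 M (\<lambda>x. a + (w x - ?m))) = (\<integral>\<^sup>+x. ennreal ((a + (w x - ?m))\<^sup>2) \<partial>M)"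
    by simp
  also have "\<dots> = ennreal (expectation (\<lambda>x. (a + (w x - ?m))\<^sup>2))"
  proof (rule nn_integral_eq_integral)
    show "integrable M (\<lambda>x. (a + (w x - ?m))\<^sup>2)" unfolding eq using i1 i2 by simp
  qed simp
  also have "expectation (\<lambda>x. (a + (w x - ?m))\<^sup>2) = a\<^sup>2 - ?m\<^sup>2 + expectation (\<lambda>x. (w x)\<^sup>2)"
    using i1 i2 by (simp add: eq prob_space) (simp add: power2_eq_square algebra_simps)
  also have "ennreal \<dots> \<le> ennreal (a\<^sup>2 + expectation (\<lambda>x. (w x)\<^sup>2))" by (intro ennreal_leI) simp
  also have "\<dots> = ennreal (a\<^sup>2) + ennreal (expectation (\<lambda>x. (w x)\<^sup>2))" by (intro ennreal_plus) auto
  also have "ennreal (expectation (\<lambda>x. (w x)\<^sup>2)) = (\<integral>\<^sup>+x. ennreal ((w x)\<^sup>2) \<partial>M)"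
    by (rule nn_integral_eq_integral[symmetric]) (use i2 in auto)
  finally show ?thesis by simp
qed simp

text \<open>Subtracting an independent copy only increases the left-hand side, and makes the increment
  symmetric, so that the parallelogram inequality applies.\<close>

lemma centered_moment_le:
  fixes w :: "'a \<Rightarrow> real"
  assumes m[measurable]: "w \<in> borel_measurable M" and s: "1 \<le> s" "s \<le> 2"
  shows "(abs_moment s M (\<lambda>x. a + (w x - expectation w)))
    \<le> ennreal (\<bar>a\<bar> powr s) + ennreal (2 powr s) * (abs_moment s M w)"
proof (cases "(abs_moment s M w) = \<top>")
  case True
  then show ?thesis by (simp add: ennreal_mult_top)
next
  case False
  let ?J = "abs_moment s M w"
  have "enn_powr (\<integral>\<^sup>+ x. ennreal \<bar>w x\<bar> \<partial>M) s < \<top>"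
    using enn_powr_nn_integral_le[OF m s(1)] False by (simp add: less_top order_le_less_trans)
  then have i1: "integrable M w"
    by (intro integrableI_bounded) (simp_all add: enn_powr_less_top)
  interpret pair_sigma_finite M M ..
  have "(abs_moment s M (\<lambda>x. a + (w x - expectation w)))
      \<le> (\<integral>\<^sup>+x. (abs_moment s M (\<lambda>y. a + (w x - w y))) \<partial>M)"
  proof (rule nn_integral_mono)
    fix x
    have "expectation (\<lambda>y. a + (w x - w y)) = a + (w x - expectation w)"
      using i1 by (simp add: prob_space)
    moreover have "ennreal (\<bar>expectation (\<lambda>y. a + (w x - w y))\<bar> powr s) \<le>
        (abs_moment s M (\<lambda>y. a + (w x - w y)))"
      by (rule powr_abs_expectation_le) (use s in auto)
    ultimately show "ennreal (\<bar>a + (w x - expectation w)\<bar> powr s) \<le>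
        (abs_moment s M (\<lambda>y. a + (w x - w y)))" by simp
  qed
  also have "\<dots> \<le> ennreal (\<bar>a\<bar> powr s) + (\<integral>\<^sup>+x. (abs_moment s M (\<lambda>y. w x - w y)) \<partial>M)"
  proof -
    let ?A = "\<integral>\<^sup>+x. (abs_moment s M (\<lambda>y. a + (w x - w y))) \<partial>M"
    let ?D = "\<integral>\<^sup>+x. (abs_moment s M (\<lambda>y. w x - w y)) \<partial>M"
    \<comment> \<open>Exchanging the two copies of the variable turns \<open>a + d\<close> into
      \<open>a - d\<close> without changing the integral, so \<open>2 * ?A\<close> is the integral
      of the symmetric pair.\<close>
    have "?A = (\<integral>\<^sup>+y. (abs_moment s M (\<lambda>x. a + (w x - w y))) \<partial>M)"
      by (rule Fubini'[symmetric]) measurable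
    then have A': "?A = (\<integral>\<^sup>+x. (abs_moment s M (\<lambda>y. a - (w x - w y))) \<partial>M)" by (simp add: algebra_simps)
    have "2 * ?A = ?A + (\<integral>\<^sup>+x. (abs_moment s M (\<lambda>y. a - (w x - w y))) \<partial>M)"
      unfolding A'[symmetric] by (simp add: mult_2)
    also have "\<dots> = (\<integral>\<^sup>+x. (\<integral>\<^sup>+y. ennreal (\<bar>a + (w x - w y)\<bar> powr s) + ennreal (\<bar>a - (w x - w y)\<bar> powr s) \<partial>M) \<partial>M)"
      by (simp add: nn_integral_add)
    also have "\<dots> \<le> (\<integral>\<^sup>+x. (\<integral>\<^sup>+y. 2 * ennreal (\<bar>a\<bar> powr s) + 2 * ennreal (\<bar>w x - w y\<bar> powr s) \<partial>M) \<partial>M)"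
    proof (intro nn_integral_mono)
      fix x y
      have "ennreal (\<bar>a + (w x - w y)\<bar> powr s + \<bar>a - (w x - w y)\<bar> powr s) \<le>
          ennreal (2 * \<bar>a\<bar> powr s + 2 * \<bar>w x - w y\<bar> powr s)"
        by (intro ennreal_leI powr_parallelogram s)
      then show "ennreal (\<bar>a + (w x - w y)\<bar> powr s) + ennreal (\<bar>a - (w x - w y)\<bar> powr s) \<le>
          2 * ennreal (\<bar>a\<bar> powr s) + 2 * ennreal (\<bar>w x - w y\<bar> powr s)"
        by (simp add: ennreal_mult)
    qed
    also have "\<dots> = 2 * (ennreal (\<bar>a\<bar> powr s) + ?D)"
      by (simp add: nn_integral_add nn_integral_cmult emeasure_space_1 distrib_left)
    finally show ?thesis by (subst (asm) ennreal_mult_le_mult_iff) auto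
  qed
  also have "(\<integral>\<^sup>+x. (abs_moment s M (\<lambda>y. w x - w y)) \<partial>M) \<le>
      (\<integral>\<^sup>+x. (\<integral>\<^sup>+y. ennreal (2 powr (s - 1)) * (ennreal (\<bar>w x\<bar> powr s) + ennreal (\<bar>w y\<bar> powr s)) \<partial>M) \<partial>M)"
  proof (intro nn_integral_mono)
    fix x y
    have "\<bar>w x - w y\<bar> powr s \<le> 2 powr (s - 1) * (\<bar>w x\<bar> powr s + \<bar>w y\<bar> powr s)"
      using powr_sum_two_le[OF s(1), of "w x" "- w y"] by simp
    then show "ennreal (\<bar>w x - w y\<bar> powr s) \<le> ennreal (2 powr (s - 1)) * (ennreal (\<bar>w x\<bar> powr s) + ennreal (\<bar>w y\<bar> powr s))"
      by (simp add: ennreal_leI flip: ennreal_mult ennreal_plus)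
  qed
  also have "\<dots> = ennreal (2 powr (s - 1)) * (?J + ?J)"
    by (simp add: nn_integral_add nn_integral_cmult emeasure_space_1)
  also have "\<dots> = ennreal (2 powr (s - 1) * 2) * ?J"
    by (simp add: ennreal_mult mult.assoc flip: mult_2)
  also have "2 powr (s - 1) * 2 = 2 powr s" by (simp add: powr_diff)
  finally show ?thesis by (simp add: add_left_mono)
qed

end

section \<open>Rosenthal's inequality by truncation\<close>

lemma square_le_exp:
  assumes "0 \<le> (y::real)" shows "y\<^sup>2 \<le> exp y"
proof -
  have "y / 2 \<le> exp (y / 2 - 1)" using exp_ge_add_one_self[of "y / 2 - 1"] by linarith
  also have "\<dots> = exp (y / 2) / exp 1" by (simp add: exp_diff)
  also have "\<dots> \<le> exp (y / 2) / 2" using exp_ge_add_one_self[of 1] by (intro divide_left_mono) auto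
  finally have "y \<le> exp (y / 2)" by simp
  then have "y\<^sup>2 \<le> (exp (y / 2))\<^sup>2" using assms by (intro power_mono) auto
  then show ?thesis by (simp flip: exp_double)
qed

context prob_space
begin

text \<open>The choice of \<open>\<eta>\<close> gives
  \<open>\<bar>\<eta> * h\<bar> \<le> L / 2\<close>, so the second-order remainder carries only the
  factor \<open>exp (L / 2)\<close>, the square root of \<open>s\<close>. Mean and variance then
  contribute \<open>L / 2\<close> and \<open>(L / 2)^2 * exp (L / 2)\<close> to the total exponent,
  and the latter is at most \<open>s\<close> because
  \<open>(L / 2)^2 \<le> exp (L / 2)\<close>.\<close>

lemma truncated_exp_moment:
  fixes h :: "'a \<Rightarrow> real" and I :: "'i set"
  assumes fin: "finite I" "I \<noteq> {}" and m[measurable]: "h \<in> borel_measurable M" and A: "0 < A" and s: "1 < s"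
    and h: "\<And>x. x \<in> space M \<Longrightarrow> \<bar>h x\<bar> \<le> A"
    and h1: "real (card I) * \<bar>expectation h\<bar> \<le> A"
    and h2: "real (card I) * expectation (\<lambda>x. (h x)\<^sup>2) \<le> A\<^sup>2"
    and \<eta>: "\<bar>\<eta>\<bar> = ln s / (2 * A)"
  shows "(\<integral>\<^sup>+x. ennreal (exp (\<eta> * (\<Sum>i\<in>I. h (x i)))) \<partial>iid I) \<le> ennreal (exp (ln s / 2 + s))"
proof -
  define n where "n = real (card I)"
  define L where "L = ln s"
  have n: "0 < n" using fin by (simp add: n_def card_gt_0_iff)
  have L: "0 \<le> L" using s by (simp add: L_def)
  define \<theta> where "\<theta> = L / 2 + s"
  have i1: "integrable M h"
    by (rule integrable_const_bound[where B = A]) (use h in auto)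
  have i2: "integrable M (\<lambda>x. (h x)\<^sup>2)"
    by (rule integrable_const_bound[where B = "A\<^sup>2"]) (use h power_mono[of "\<bar>h _\<bar>" A 2] in auto)
  have ie: "integrable M (\<lambda>x. exp (\<eta> * h x))" using integrable_exp_bounded[OF m h] by simp
  have pw: "exp (\<eta> * h x) \<le> 1 + \<eta> * h x + \<eta>\<^sup>2 * exp (L / 2) * (h x)\<^sup>2" if x: "x \<in> space M" for x
  proof -
    have "\<bar>\<eta> * h x\<bar> \<le> ln s / (2 * A) * A" unfolding abs_mult \<eta> using h[OF x] A s by (intro mult_left_mono) auto
    then have "\<bar>\<eta> * h x\<bar> \<le> L / 2" using A by (simp add: L_def)
    then have "(\<eta> * h x)\<^sup>2 * exp \<bar>\<eta> * h x\<bar> \<le> (\<eta> * h x)\<^sup>2 * exp (L / 2)" by (intro mult_left_mono) auto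
    then show ?thesis using exp_remainder_le[of "\<eta> * h x"] by (simp add: power_mult_distrib mult_ac)
  qed
  have "expectation (\<lambda>x. exp (\<eta> * h x)) \<le> expectation (\<lambda>x. 1 + \<eta> * h x + \<eta>\<^sup>2 * exp (L / 2) * (h x)\<^sup>2)"
    by (intro integral_mono ie pw) (use i1 i2 in auto)
  also have "\<dots> = 1 + \<eta> * expectation h + \<eta>\<^sup>2 * exp (L / 2) * expectation (\<lambda>x. (h x)\<^sup>2)"
    using i1 i2 by (simp add: prob_space)
  also have "\<dots> \<le> 1 + L / (2 * A) * (A / n) + (L / (2 * A))\<^sup>2 * exp (L / 2) * (A\<^sup>2 / n)"
  proof (intro add_mono order_refl)
    have "\<eta> * expectation h \<le> \<bar>\<eta>\<bar> * \<bar>expectation h\<bar>" by (metis abs_ge_self abs_mult)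
    also have "\<dots> \<le> L / (2 * A) * (A / n)"
      unfolding \<eta> L_def[symmetric] using h1 n A L by (intro mult_left_mono) (auto simp: n_def field_simps)
    finally show "\<eta> * expectation h \<le> L / (2 * A) * (A / n)" .
    have "\<eta>\<^sup>2 = (L / (2 * A))\<^sup>2" using \<eta> by (metis L_def power2_abs)
    then show "\<eta>\<^sup>2 * exp (L / 2) * expectation (\<lambda>x. (h x)\<^sup>2) \<le> (L / (2 * A))\<^sup>2 * exp (L / 2) * (A\<^sup>2 / n)"
      using h2 n by (simp only:) (intro mult_left_mono, auto simp: n_def field_simps)
  qed
  also have "\<dots> = 1 + (L / 2 + (L / 2)\<^sup>2 * exp (L / 2)) / n"
    using A n by (simp add: field_simps power2_eq_square)
  also have "\<dots> \<le> 1 + \<theta> / n"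
  proof -
    have "(L / 2)\<^sup>2 * exp (L / 2) \<le> exp (L / 2) * exp (L / 2)"
      using L by (intro mult_right_mono square_le_exp) auto
    also have "\<dots> = s" using s by (simp add: L_def flip: exp_add)
    finally show ?thesis using n by (simp add: \<theta>_def divide_right_mono)
  qed
  also have "\<dots> \<le> exp (\<theta> / n)" by (rule exp_ge_add_one_self)
  finally have E: "expectation (\<lambda>x. exp (\<eta> * h x)) \<le> exp (\<theta> / n)" .
  have "(\<integral>\<^sup>+x. ennreal (exp (\<eta> * (\<Sum>i\<in>I. h (x i)))) \<partial>iid I) =
      (\<integral>\<^sup>+x. (\<Prod>i\<in>I. ennreal (exp (\<eta> * h (x i)))) \<partial>iid I)"
    using fin by (simp add: prod_ennreal exp_sum sum_distrib_left)
  also have "\<dots> = (\<Prod>i\<in>I. \<integral>\<^sup>+x. ennreal (exp (\<eta> * h x)) \<partial>M)"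
    using fin by (intro PiM_nn_integral_prod) auto
  also have "\<dots> = ennreal (expectation (\<lambda>x. exp (\<eta> * h x))) ^ card I"
    using ie by (simp add: nn_integral_eq_integral)
  also have "\<dots> \<le> ennreal (exp (\<theta> / n)) ^ card I" using E by (intro power_mono ennreal_leI) auto
  also have "\<dots> = ennreal (exp \<theta>)"
    using n by (simp add: ennreal_power n_def flip: exp_of_nat_mult)
  finally show ?thesis by (simp add: \<theta>_def L_def)
qed

text \<open>Among the summands exceeding \<open>A\<close>, \<open>(\<Sum>u\<^sub>i)\<^sup>s \<le> K\<^sup>s \<Sum>u\<^sub>i\<^sup>s\<close> with \<open>K\<close> the number of
  nonzero ones, and \<open>K\<close> has an exponential moment.\<close>

lemma large_part_moment:
  fixes g :: "'a \<Rightarrow> real" and I :: "'i set"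
  assumes fin: "finite I" "I \<noteq> {}" and m[measurable]: "g \<in> borel_measurable M" and A: "0 < A" and s: "1 < s"
    and g2: "of_nat (card I) * (\<integral>\<^sup>+x. ennreal ((g x)\<^sup>2) \<partial>M) \<le> ennreal (A\<^sup>2)"
  defines "b \<equiv> \<lambda>x. if A < \<bar>g x\<bar> then 1 else 0 :: real"
  shows "(\<integral>\<^sup>+x. ennreal ((\<Sum>i\<in>I. \<bar>g (x i)\<bar> * b (x i)) powr s) \<partial>iid I)
    \<le> ennreal ((s / (exp 1 * ln s)) powr s * (s * exp (s - 1))) *
      (of_nat (card I) * (abs_moment s M g))"
proof -
  define L where "L = ln s"
  define n where "n = real (card I)"
  have n: "0 < n" using fin by (simp add: n_def card_gt_0_iff)
  have L: "0 < L" "exp L = s" using s by (auto simp: L_def)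
  have bm[measurable]: "b \<in> borel_measurable M" unfolding b_def by measurable
  let ?u = "\<lambda>x. \<bar>g x\<bar> * b x"
  let ?C = "(s / (exp 1 * L)) powr s"
  let ?J = "abs_moment s M g"
  have b01: "b x = 0 \<or> b x = 1" for x by (simp add: b_def)
  have pw: "(\<Sum>i\<in>I. ?u (x i)) powr s \<le> ?C * (\<Sum>i\<in>I. ?u (x i) powr s * (\<Prod>j\<in>I. exp (L * b (x j))))" for x
  proof -
    define T where "T = (\<Sum>i\<in>I. ?u (x i) powr s) powr (1 / s)"
    have T0: "0 \<le> T" by (simp add: T_def)
    have "?u (x i) \<le> T * b (x i)" if "i \<in> I" for i
    proof (cases "b (x i) = 0")
      case False
      have "?u (x i) powr s \<le> (\<Sum>i\<in>I. ?u (x i) powr s)" using that fin by (intro member_le_sum) auto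
      then have "(?u (x i) powr s) powr (1 / s) \<le> T" unfolding T_def using s by (intro powr_mono2) auto
      then show ?thesis using False b01[of "x i"] s by (simp add: powr_powr)
    qed simp
    then have "(\<Sum>i\<in>I. ?u (x i)) \<le> T * (\<Sum>i\<in>I. b (x i))" unfolding sum_distrib_left by (rule sum_mono)
    then have "(\<Sum>i\<in>I. ?u (x i)) powr s \<le> (T * (\<Sum>i\<in>I. b (x i))) powr s"
      using s by (intro powr_mono2 sum_nonneg) (auto simp: b_def)
    also have "\<dots> = T powr s * (\<Sum>i\<in>I. b (x i)) powr s" by (rule powr_mult)
    also have "\<dots> \<le> T powr s * (?C * exp (L * (\<Sum>i\<in>I. b (x i))))"
      using s L by (intro mult_left_mono powr_le_exp sum_nonneg) (auto simp: b_def)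
    also have "T powr s = (\<Sum>i\<in>I. ?u (x i) powr s)" using s by (simp add: T_def powr_powr sum_nonneg)
    also have "exp (L * (\<Sum>i\<in>I. b (x i))) = (\<Prod>j\<in>I. exp (L * b (x j)))" using fin by (simp add: exp_sum sum_distrib_left)
    finally show ?thesis unfolding sum_distrib_right[symmetric] by (simp only: mult_ac)
  qed
  \<comment> \<open>\<open>\<phi> i j\<close> is the factor of coordinate \<open>j\<close> in the
    term for summand \<open>i\<close>; independence then splits the integral of each term into a
    product.\<close>
  define \<phi> where "\<phi> i j y = (if j = i then ennreal (?u y powr s) else 1) * ennreal (exp (L * b y))" for i j :: 'i and y
  have \<phi>m: "\<phi> i j \<in> borel_measurable M" for i j unfolding \<phi>_def by measurable
  \<comment> \<open>Chebyshev's inequality in pointwise form: \<open>exp (L * b)\<close> is 1 or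
    \<open>s\<close>, hence at most \<open>1 + (s - 1) * g^2 / A^2\<close>, and \<open>n\<close>
    times the second moment of \<open>g\<close> is at most \<open>A^2\<close>.\<close>
  have P: "(\<integral>\<^sup>+y. ennreal (exp (L * b y)) \<partial>M) \<le> ennreal (exp ((s - 1) / n))"
  proof -
    have "(\<integral>\<^sup>+y. ennreal (exp (L * b y)) \<partial>M) \<le> (\<integral>\<^sup>+y. 1 + ennreal ((s - 1) / A\<^sup>2) * ennreal ((g y)\<^sup>2) \<partial>M)"
    proof (rule nn_integral_mono)
      fix y
      have "exp (L * b y) \<le> 1 + (s - 1) / A\<^sup>2 * (g y)\<^sup>2"
      proof (cases "A < \<bar>g y\<bar>")
        case True
        then have "A\<^sup>2 \<le> (g y)\<^sup>2" using A by (simp add: abs_le_square_iff[symmetric])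
        then have "(s - 1) * 1 \<le> (s - 1) * ((g y)\<^sup>2 / A\<^sup>2)" using A s by (intro mult_left_mono) (auto simp: field_simps)
        then show ?thesis using True L by (simp add: b_def)
      next
        case False
        then show ?thesis using s by (simp add: b_def)
      qed
      then have "ennreal (exp (L * b y)) \<le> ennreal (1 + (s - 1) / A\<^sup>2 * (g y)\<^sup>2)" by (rule ennreal_leI)
      also have "\<dots> = 1 + ennreal ((s - 1) / A\<^sup>2) * ennreal ((g y)\<^sup>2)"
        using s by (subst ennreal_plus) (simp_all only: ennreal_mult ennreal_1 zero_le_one
            zero_le_power2 zero_le_divide_iff diff_ge_0_iff_ge less_imp_le mult_nonneg_nonneg simp_thms)
      finally show "ennreal (exp (L * b y)) \<le> 1 + ennreal ((s - 1) / A\<^sup>2) * ennreal ((g y)\<^sup>2)" .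
    qed
    also have "\<dots> = 1 + ennreal ((s - 1) / A\<^sup>2) * (\<integral>\<^sup>+y. ennreal ((g y)\<^sup>2) \<partial>M)"
      by (simp add: nn_integral_add nn_integral_cmult emeasure_space_1)
    also have "\<dots> \<le> 1 + ennreal ((s - 1) / A\<^sup>2) * ennreal (A\<^sup>2 / n)"
    proof (intro add_left_mono mult_left_mono)
      have "ennreal n * (\<integral>\<^sup>+y. ennreal ((g y)\<^sup>2) \<partial>M) \<le> ennreal n * ennreal (A\<^sup>2 / n)"
        using g2 n by (simp add: n_def ennreal_of_nat_eq_real_of_nat flip: ennreal_mult)
      then show "(\<integral>\<^sup>+y. ennreal ((g y)\<^sup>2) \<partial>M) \<le> ennreal (A\<^sup>2 / n)"
        using n by (subst (asm) ennreal_mult_le_mult_iff) auto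
    qed simp
    also have "\<dots> = ennreal (1 + (s - 1) / n)" using A s n by (simp flip: ennreal_mult ennreal_plus ennreal_1)
    also have "\<dots> \<le> ennreal (exp ((s - 1) / n))" by (intro ennreal_leI exp_ge_add_one_self)
    finally show ?thesis .
  qed
  have one: "(\<Prod>j\<in>I. integral\<^sup>N M (\<phi> i j)) \<le> ennreal (s * exp (s - 1)) * ?J" if i: "i \<in> I" for i
  proof -
    have "integral\<^sup>N M (\<phi> i i) \<le> (\<integral>\<^sup>+y. ennreal s * ennreal (\<bar>g y\<bar> powr s) \<partial>M)"
    proof (rule nn_integral_mono)
      fix y
      have "?u y powr s * exp (L * b y) \<le> \<bar>g y\<bar> powr s * s"
        using L s by (intro mult_mono) (auto simp: b_def)
      then show "\<phi> i i y \<le> ennreal s * ennreal (\<bar>g y\<bar> powr s)"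
        using s by (simp add: \<phi>_def ennreal_leI mult.commute flip: ennreal_mult)
    qed
    then have a: "integral\<^sup>N M (\<phi> i i) \<le> ennreal s * ?J" by (simp add: nn_integral_cmult)
    \<comment> \<open>The remaining \<open>n - 1\<close> factors together contribute at most
      \<open>exp (s - 1)\<close>, uniformly in \<open>n\<close>.\<close>
    have "(\<Prod>j\<in>I - {i}. integral\<^sup>N M (\<phi> i j)) = (\<integral>\<^sup>+y. ennreal (exp (L * b y)) \<partial>M) ^ card (I - {i})"
    proof -
      have "(\<Prod>j\<in>I - {i}. integral\<^sup>N M (\<phi> i j)) = (\<Prod>j\<in>I - {i}. \<integral>\<^sup>+y. ennreal (exp (L * b y)) \<partial>M)"
        by (rule prod.cong) (auto simp: \<phi>_def[abs_def])
      then show ?thesis by simp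
    qed
    also have "\<dots> \<le> ennreal (exp ((s - 1) / n)) ^ card (I - {i})" by (intro power_mono P) auto
    also have "\<dots> = ennreal (exp (real (card (I - {i})) * ((s - 1) / n)))"
      by (simp add: ennreal_power flip: exp_of_nat_mult)
    also have "\<dots> \<le> ennreal (exp (s - 1))"
    proof -
      have "real (card (I - {i})) * ((s - 1) / n) \<le> n * ((s - 1) / n)"
        unfolding n_def using s fin by (intro mult_right_mono) (auto intro!: card_mono)
      then show ?thesis using n by (intro ennreal_leI) simp
    qed
    finally have c: "(\<Prod>j\<in>I - {i}. integral\<^sup>N M (\<phi> i j)) \<le> ennreal (exp (s - 1))" .
    have "(\<Prod>j\<in>I. integral\<^sup>N M (\<phi> i j)) = integral\<^sup>N M (\<phi> i i) * (\<Prod>j\<in>I - {i}. integral\<^sup>N M (\<phi> i j))"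
      using fin i by (simp add: prod.remove)
    also have "\<dots> \<le> (ennreal s * ?J) * ennreal (exp (s - 1))" by (intro mult_mono a c) auto
    also have "\<dots> = ennreal (s * exp (s - 1)) * ?J" using s by (simp add: ennreal_mult mult_ac)
    finally show ?thesis .
  qed
  have "(\<integral>\<^sup>+x. ennreal ((\<Sum>i\<in>I. ?u (x i)) powr s) \<partial>iid I) \<le>
      (\<integral>\<^sup>+x. ennreal ?C * (\<Sum>i\<in>I. \<Prod>j\<in>I. \<phi> i j (x j)) \<partial>iid I)"
  proof (rule nn_integral_mono)
    fix x
    let ?F = "\<lambda>i. ?u (x i) powr s * (\<Prod>j\<in>I. exp (L * b (x j)))"
    have F0: "0 \<le> ?F i" for i by (intro mult_nonneg_nonneg prod_nonneg) auto
    have "(\<Prod>j\<in>I. \<phi> i j (x j)) = ennreal (?F i)" if "i \<in> I" for i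
      using fin that by (simp add: \<phi>_def prod.distrib prod.delta ennreal_mult prod_nonneg prod_ennreal)
    then have "(\<Sum>i\<in>I. \<Prod>j\<in>I. \<phi> i j (x j)) = (\<Sum>i\<in>I. ennreal (?F i))" by (rule sum.cong[OF refl])
    also have "\<dots> = ennreal (\<Sum>i\<in>I. ?F i)" by (rule sum_ennreal) (rule F0)
    finally have "ennreal ?C * (\<Sum>i\<in>I. \<Prod>j\<in>I. \<phi> i j (x j)) = ennreal (?C * (\<Sum>i\<in>I. ?F i))"
      by (simp only: ennreal_mult powr_ge_zero sum_nonneg F0)
    then show "ennreal ((\<Sum>i\<in>I. ?u (x i)) powr s) \<le> ennreal ?C * (\<Sum>i\<in>I. \<Prod>j\<in>I. \<phi> i j (x j))"
      using ennreal_leI[OF pw[of x]] by simp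
  qed
  also have "\<dots> = ennreal ?C * (\<Sum>i\<in>I. \<integral>\<^sup>+x. (\<Prod>j\<in>I. \<phi> i j (x j)) \<partial>iid I)"
  proof -
    have [measurable]: "(\<lambda>x. \<Prod>j\<in>I. \<phi> i j (x j)) \<in> borel_measurable (iid I)" for i
      using \<phi>m by (intro borel_measurable_prod_ennreal measurable_compose[OF measurable_component_singleton]) auto
    show ?thesis by (simp add: nn_integral_cmult nn_integral_sum)
  qed
  also have "\<dots> = ennreal ?C * (\<Sum>i\<in>I. \<Prod>j\<in>I. integral\<^sup>N M (\<phi> i j))"
    using fin \<phi>m by (simp add: PiM_nn_integral_prod)
  also have "\<dots> \<le> ennreal ?C * (\<Sum>i\<in>I. ennreal (s * exp (s - 1)) * ?J)"
    by (intro mult_left_mono sum_mono one) auto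
  also have "\<dots> = ennreal (?C * (s * exp (s - 1))) * (of_nat (card I) * ?J)"
    using s by (simp add: ennreal_mult mult_ac)
  finally show ?thesis by (simp add: L_def)
qed

text \<open>\<open>g\<close> is replaced by 0 where it exceeds \<open>A\<close> in modulus. The
  bounded part \<open>h\<close> is not centred, but since \<open>g\<close> is, its mean is minus
  that of the large part, and so at most \<open>A / n\<close> in modulus. \<open>A\<close> may be
  any positive bound for the standard deviation of the sum.\<close>

lemma rosenthal:
  fixes g :: "'a \<Rightarrow> real" and I :: "'i set"
  assumes fin: "finite I" "I \<noteq> {}" and m[measurable]: "g \<in> borel_measurable M" and A: "0 < A" and s: "2 \<le> s"
    and g2: "of_nat (card I) * (\<integral>\<^sup>+x. ennreal ((g x)\<^sup>2) \<partial>M) \<le> ennreal (A\<^sup>2)"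
    and g1: "expectation g = 0"
  shows "(abs_moment s (iid I) (\<lambda>x. \<Sum>i\<in>I. g (x i)))
    \<le> ennreal ((15 * s / ln s) powr s) *
      (ennreal (A powr s) + of_nat (card I) * (abs_moment s M g))"
proof -
  define L where "L = ln s"
  define n where "n = real (card I)"
  have n: "0 < n" using fin by (simp add: n_def card_gt_0_iff)
  have L: "0 < L" "exp L = s" using s by (auto simp: L_def)
  define b where "b x = (if A < \<bar>g x\<bar> then 1 else 0 :: real)" for x
  have bm[measurable]: "b \<in> borel_measurable M" unfolding b_def[abs_def] by measurable
  define h where "h x = g x - g x * b x" for x
  have hm[measurable]: "h \<in> borel_measurable M" unfolding h_def[abs_def] by measurable
  let ?Q = "iid I" and ?J = "abs_moment s M g"
  have g2': "(\<integral>\<^sup>+y. ennreal ((g y)\<^sup>2) \<partial>M) \<le> ennreal (A\<^sup>2 / n)"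
  proof -
    have "ennreal n * (\<integral>\<^sup>+y. ennreal ((g y)\<^sup>2) \<partial>M) \<le> ennreal n * ennreal (A\<^sup>2 / n)"
      using g2 n by (simp add: n_def ennreal_of_nat_eq_real_of_nat flip: ennreal_mult)
    then show ?thesis using n by (subst (asm) ennreal_mult_le_mult_iff) auto
  qed
  have i2: "integrable M (\<lambda>x. (g x)\<^sup>2)"
    using g2' by (intro integrableI_bounded) (auto intro: order_le_less_trans)
  have i1: "integrable M g" by (rule square_integrable_imp_integrable[OF _ i2]) simp
  have e2: "n * expectation (\<lambda>x. (g x)\<^sup>2) \<le> A\<^sup>2"
  proof -
    have "ennreal (expectation (\<lambda>x. (g x)\<^sup>2)) \<le> ennreal (A\<^sup>2 / n)"
      using g2' nn_integral_eq_integral[OF i2] by simp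
    then show ?thesis using n A by (subst (asm) ennreal_le_iff) (auto simp: field_simps)
  qed
  have hA: "\<bar>h x\<bar> \<le> A" for x using A by (auto simp: h_def b_def)
  have gb: "integrable M (\<lambda>x. g x * b x)"
    by (rule Bochner_Integration.integrable_bound[OF i1]) (auto simp: b_def)
  have h1: "n * \<bar>expectation h\<bar> \<le> A"
  proof -
    have "\<bar>expectation h\<bar> = \<bar>expectation (\<lambda>x. g x * b x)\<bar>"
      using i1 gb g1 by (simp add: h_def[abs_def])
    also have "\<dots> \<le> expectation (\<lambda>x. \<bar>g x * b x\<bar>)" by (rule integral_abs_bound)
    also have "\<dots> \<le> expectation (\<lambda>x. (g x)\<^sup>2 / A)"
    proof (rule integral_mono)
      fix x
      show "\<bar>g x * b x\<bar> \<le> (g x)\<^sup>2 / A"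
      proof (cases "A < \<bar>g x\<bar>")
        case True
        then have "\<bar>g x\<bar> * A \<le> \<bar>g x\<bar> * \<bar>g x\<bar>" by (intro mult_left_mono) auto
        then show ?thesis using True A by (simp add: b_def field_simps power2_eq_square)
      qed (use A in \<open>simp add: b_def\<close>)
    qed (use gb i2 in auto)
    also have "\<dots> = expectation (\<lambda>x. (g x)\<^sup>2) / A" by simp
    finally have "n * \<bar>expectation h\<bar> \<le> n * (expectation (\<lambda>x. (g x)\<^sup>2) / A)" using n by (intro mult_left_mono) auto
    also have "\<dots> \<le> A\<^sup>2 / A" using e2 A by (simp add: divide_right_mono)
    finally show ?thesis using A by (simp add: power2_eq_square)
  qed
  have h2: "n * expectation (\<lambda>x. (h x)\<^sup>2) \<le> A\<^sup>2"
  proof -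
    have le: "(h x)\<^sup>2 \<le> (g x)\<^sup>2" for x by (simp add: h_def b_def)
    have "integrable M (\<lambda>x. (h x)\<^sup>2)"
      by (rule Bochner_Integration.integrable_bound[OF i2]) (use le in auto)
    then have "expectation (\<lambda>x. (h x)\<^sup>2) \<le> expectation (\<lambda>x. (g x)\<^sup>2)" using i2 le by (intro integral_mono) auto
    then show ?thesis using e2 n by (meson mult_left_mono order_trans less_imp_le)
  qed
  define \<eta> where "\<eta> = L / (2 * A)"
  have \<eta>: "0 < \<eta>" using L A by (simp add: \<eta>_def)
  define C1 where "C1 = (s / (exp 1 * \<eta>)) powr s"
  define C2 where "C2 = (s / (exp 1 * L)) powr s * (s * exp (s - 1))"
  have C: "0 \<le> C1" "0 \<le> C2" using s by (auto simp: C1_def C2_def)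
  have small: "(abs_moment s ?Q (\<lambda>x. \<Sum>i\<in>I. h (x i))) \<le> ennreal (C1 * (2 * exp (L / 2 + s)))"
  proof -
    have "(abs_moment s ?Q (\<lambda>x. \<Sum>i\<in>I. h (x i))) \<le>
        (\<integral>\<^sup>+x. ennreal C1 * (ennreal (exp (\<eta> * (\<Sum>i\<in>I. h (x i)))) + ennreal (exp (- \<eta> * (\<Sum>i\<in>I. h (x i))))) \<partial>?Q)"
    proof (rule nn_integral_mono)
      fix x
      let ?S = "\<Sum>i\<in>I. h (x i)"
      have "\<bar>?S\<bar> powr s \<le> C1 * exp (\<eta> * \<bar>?S\<bar>)" unfolding C1_def using \<eta> s by (intro powr_le_exp) auto
      also have "\<dots> \<le> C1 * (exp (\<eta> * ?S) + exp (- \<eta> * ?S))"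
        using C by (intro mult_left_mono) (auto simp: abs_if)
      finally show "ennreal (\<bar>?S\<bar> powr s) \<le> ennreal C1 * (ennreal (exp (\<eta> * ?S)) + ennreal (exp (- \<eta> * ?S)))"
        using C by (simp add: ennreal_leI flip: ennreal_mult ennreal_plus)
    qed
    also have "\<dots> = ennreal C1 * ((\<integral>\<^sup>+x. ennreal (exp (\<eta> * (\<Sum>i\<in>I. h (x i)))) \<partial>?Q)
        + (\<integral>\<^sup>+x. ennreal (exp (- \<eta> * (\<Sum>i\<in>I. h (x i)))) \<partial>?Q))"
      by (simp add: nn_integral_cmult nn_integral_add)
    also have "\<dots> \<le> ennreal C1 * (ennreal (exp (L / 2 + s)) + ennreal (exp (L / 2 + s)))"
    proof (intro mult_left_mono add_mono)
      have ex: "(\<integral>\<^sup>+x. ennreal (exp (e * (\<Sum>i\<in>I. h (x i)))) \<partial>?Q) \<le> ennreal (exp (L / 2 + s))"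
        if "\<bar>e\<bar> = ln s / (2 * A)" for e
        unfolding L_def
        by (rule truncated_exp_moment[OF fin hm A _ hA h1[unfolded n_def] h2[unfolded n_def] that]) (use s in simp)
      have ab: "\<bar>\<eta>\<bar> = ln s / (2 * A)" "\<bar>- \<eta>\<bar> = ln s / (2 * A)" using \<eta> unfolding \<eta>_def L_def by linarith+
      show "(\<integral>\<^sup>+x. ennreal (exp (\<eta> * (\<Sum>i\<in>I. h (x i)))) \<partial>?Q) \<le> ennreal (exp (L / 2 + s))"
        "(\<integral>\<^sup>+x. ennreal (exp (- \<eta> * (\<Sum>i\<in>I. h (x i)))) \<partial>?Q) \<le> ennreal (exp (L / 2 + s))"
        using ex[OF ab(1)] ex[OF ab(2)] .
    qed simp
    also have "\<dots> = ennreal (C1 * (2 * exp (L / 2 + s)))"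
      by (subst ennreal_plus[symmetric], simp, simp, subst ennreal_mult[symmetric]) (use C in auto)
    finally show ?thesis .
  qed
  have large: "(\<integral>\<^sup>+x. ennreal ((\<Sum>i\<in>I. \<bar>g (x i)\<bar> * b (x i)) powr s) \<partial>?Q) \<le> ennreal C2 * (of_nat (card I) * ?J)"
    unfolding C2_def L_def b_def[abs_def] using s by (intro large_part_moment[OF fin m A _ g2]) auto
  have "(abs_moment s ?Q (\<lambda>x. \<Sum>i\<in>I. g (x i))) \<le>
      (\<integral>\<^sup>+x. ennreal (2 powr s) * (ennreal (\<bar>\<Sum>i\<in>I. h (x i)\<bar> powr s) + ennreal ((\<Sum>i\<in>I. \<bar>g (x i)\<bar> * b (x i)) powr s)) \<partial>?Q)"
  proof (rule nn_integral_mono)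
    fix x
    let ?S1 = "\<Sum>i\<in>I. h (x i)" and ?S2 = "\<Sum>i\<in>I. g (x i) * b (x i)" and ?U = "\<Sum>i\<in>I. \<bar>g (x i)\<bar> * b (x i)"
    have "\<bar>?S2\<bar> \<le> (\<Sum>i\<in>I. \<bar>g (x i) * b (x i)\<bar>)" by (rule sum_abs)
    also have "\<dots> = ?U" by (simp add: abs_mult b_def cong: sum.cong)
    finally have U: "\<bar>?S2\<bar> powr s \<le> ?U powr s" using s by (intro powr_mono2) auto
    have "(\<Sum>i\<in>I. g (x i)) = ?S1 + ?S2" by (simp add: h_def flip: sum.distrib)
    then have "\<bar>\<Sum>i\<in>I. g (x i)\<bar> powr s \<le> 2 powr (s - 1) * (\<bar>?S1\<bar> powr s + \<bar>?S2\<bar> powr s)"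
      using powr_sum_two_le[of s ?S1 ?S2] s by simp
    also have "\<dots> \<le> 2 powr s * (\<bar>?S1\<bar> powr s + ?U powr s)"
      using U by (intro mult_mono add_mono) auto
    finally show "ennreal (\<bar>\<Sum>i\<in>I. g (x i)\<bar> powr s) \<le>
        ennreal (2 powr s) * (ennreal (\<bar>?S1\<bar> powr s) + ennreal (?U powr s))"
      by (simp add: ennreal_leI flip: ennreal_mult ennreal_plus)
  qed
  also have "\<dots> = ennreal (2 powr s) * ((abs_moment s ?Q (\<lambda>x. \<Sum>i\<in>I. h (x i))) +
      (\<integral>\<^sup>+x. ennreal ((\<Sum>i\<in>I. \<bar>g (x i)\<bar> * b (x i)) powr s) \<partial>?Q))"
    by (simp add: nn_integral_cmult nn_integral_add)
  also have "\<dots> \<le> ennreal (2 powr s) * (ennreal (C1 * (2 * exp (L / 2 + s))) + ennreal C2 * (of_nat (card I) * ?J))"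
    by (intro mult_left_mono add_mono small large) auto
  also have "\<dots> = ennreal (2 powr s * (C1 * (2 * exp (L / 2 + s)))) + ennreal (2 powr s * C2) * (of_nat (card I) * ?J)"
    using C by (simp add: distrib_left ennreal_mult mult.assoc)
  also have "\<dots> \<le> ennreal ((15 * s / L) powr s * A powr s) + ennreal ((15 * s / L) powr s) * (of_nat (card I) * ?J)"
  proof -
    \<comment> \<open>Both parts carry the factor \<open>K\<close>. For the bounded part there
      remain \<open>4 powr s\<close> and
      \<open>2 * exp (L / 2) \<le> 1 + s \<le> exp s \<le> (15/4) powr s\<close>; for the large part
      \<open>2 powr s\<close> and \<open>s / exp 1 \<le> (15/2) powr s\<close>. Each product is at
      most \<open>15 powr s\<close>.\<close>
    define K where "K = (s / L) powr s"
    have K: "0 \<le> K" by (simp add: K_def)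
    have e1: "exp 1 powr s = exp s" by (simp add: powr_def)
    have es: "exp s \<le> (15/4) powr s"
    proof -
      have "exp 1 powr s \<le> (15/4) powr s" using s exp_le by (intro powr_mono2) auto
      then show ?thesis by (simp add: e1)
    qed
    have C1': "C1 = 2 powr s * A powr s * K / exp s"
    proof -
      have "s / (exp 1 * \<eta>) = 2 * A * (s / L) / exp 1" using A L by (simp add: \<eta>_def field_simps)
      then show ?thesis using e1 by (simp add: C1_def K_def powr_mult powr_divide)
    qed
    have C2': "C2 = K * (s / exp 1)"
      by (simp add: C2_def K_def powr_divide powr_mult e1 exp_diff)
    have "2 * exp (L / 2) \<le> 1 + exp (L / 2) * exp (L / 2)"
      using sum_squares_bound[of 1 "exp (L / 2)"] by (simp add: power2_eq_square)
    also have "\<dots> = 1 + s" using L by (simp flip: exp_add)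
    also have "\<dots> \<le> exp s" by (rule exp_ge_add_one_self)
    finally have r: "2 * exp (L / 2) \<le> (15/4) powr s" using es by linarith
    have "2 powr s * (C1 * (2 * exp (L / 2 + s))) = (4 powr s * K * A powr s) * (2 * exp (L / 2))"
      using powr_mult[of 2 2 s] by (simp add: C1' exp_add)
    also have "\<dots> \<le> (4 powr s * K * A powr s) * (15/4) powr s" using r K by (intro mult_left_mono) auto
    also have "\<dots> = (15 * s / L) powr s * A powr s"
      using powr_mult[of 4 "15/4" s] powr_mult[of 15 "s / L" s] by (simp add: K_def mult_ac)
    finally have 1: "2 powr s * (C1 * (2 * exp (L / 2 + s))) \<le> (15 * s / L) powr s * A powr s" .
    have "s / exp 1 \<le> s / 1" using s by (intro divide_left_mono) auto
    also have "s / 1 \<le> (15/4) powr s" using exp_ge_add_one_self[of s] es by linarith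
    also have "\<dots> \<le> (15/2) powr s" using s by (intro powr_mono2) auto
    finally have "2 powr s * C2 \<le> 2 powr s * (K * (15/2) powr s)" unfolding C2' using K by (intro mult_left_mono) auto
    also have "\<dots> = (15 * s / L) powr s"
      using powr_mult[of 2 "15/2" s] powr_mult[of 15 "s / L" s] by (simp add: K_def mult_ac)
    finally have 2: "2 powr s * C2 \<le> (15 * s / L) powr s" .
    show ?thesis by (intro add_mono mult_right_mono ennreal_leI 1 2) auto
  qed
  also have "\<dots> = ennreal ((15 * s / ln s) powr s) * (ennreal (A powr s) + of_nat (card I) * ?J)"
    by (simp add: L_def distrib_left ennreal_mult)
  finally show ?thesis .
qed

end

section \<open>Norms of sums of independent random functions\<close>

text \<open>A Schur test in the \<open>L\<^sub>2\<close> sense: with \<open>p\<close> conjugate to \<open>s\<close> and \<open>q = 2 s / (s + 2)\<close>, write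
  \<open>l w = (l\<^sup>p w\<^sup>q)\<^sup>1\<^sup>/\<^sup>2 l\<^sup>1\<^sup>-\<^sup>p\<^sup>/\<^sup>2 w\<^sup>1\<^sup>-\<^sup>q\<^sup>/\<^sup>2\<close>, apply Cauchy-Schwarz and then Hoelder to the square of the last
  two factors.\<close>

lemma schur_test_square:
  fixes w :: "'t \<Rightarrow> 'x \<Rightarrow> real"
  assumes "sigma_finite_measure \<tau>" "sigma_finite_measure N"
    and w[measurable]: "case_prod w \<in> borel_measurable (\<tau> \<Otimes>\<^sub>M N)" and s: "2 \<le> s"
    and l[measurable]: "l \<in> borel_measurable \<tau>"
    and lp: "(abs_moment (s / (s - 1)) \<tau> l) \<le> 1"
    and m: "0 < m"
    and w1: "\<And>x. x \<in> space N \<Longrightarrow> Lp_norm (2 * s / (s + 2)) \<tau> (\<lambda>t. w t x) \<le> ennreal m"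
    and w2: "\<And>t. t \<in> space \<tau> \<Longrightarrow> Lp_norm (2 * s / (s + 2)) N (w t) \<le> ennreal m"
  shows "(\<integral>\<^sup>+ x. (\<integral>\<^sup>+ t. ennreal (\<bar>l t\<bar> * \<bar>w t x\<bar>) \<partial>\<tau>)\<^sup>2 \<partial>N) \<le> ennreal (m\<^sup>2)"
proof -
  interpret T: sigma_finite_measure \<tau> by fact
  interpret N: sigma_finite_measure N by fact
  interpret TN: pair_sigma_finite \<tau> N ..
  define p q where "p = s / (s - 1)" and "q = 2 * s / (s + 2)"
  have pq: "1 < p" "p \<le> 2" "1 \<le> q" "q < 2" using s by (auto simp: p_def q_def field_simps)
  have wx[measurable]: "(\<lambda>t. w t x) \<in> borel_measurable \<tau>" if "x \<in> space N" for x
    using measurable_compose[OF measurable_Pair2'[OF that] w] by simp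
  have wq: "(abs_moment q \<tau> (\<lambda>t. w t x)) \<le> ennreal (m powr q)" if "x \<in> space N" for x
    using w1[OF that] pq m Lp_norm_le_iff[of q m \<tau> "\<lambda>t. w t x"] by (simp add: q_def)
  have wq2: "(abs_moment q N (w t)) \<le> ennreal (m powr q)" if "t \<in> space \<tau>" for t
    using w2[OF that] pq m Lp_norm_le_iff[of q m N "w t"] by (simp add: q_def)
  have rest: "(\<integral>\<^sup>+ t. ennreal (\<bar>l t\<bar> powr (2 - p) * \<bar>w t x\<bar> powr (2 - q)) \<partial>\<tau>) \<le> ennreal (m powr (2 - q))"
    if x: "x \<in> space N" for x
  proof (cases "s = 2")
    case True
    then have pq2: "p = 2" "q = 1" by (auto simp: p_def q_def)
    \<comment> \<open>At \<open>s = 2\<close> the Hoelder exponent for \<open>l\<close> would be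
      infinite. The factor \<open>\<bar>l t\<bar> powr 0\<close> is bounded by 1 instead; it is 0
      where \<open>l\<close> vanishes, since \<open>0 powr 0 = 0\<close>.\<close>
    have "(\<integral>\<^sup>+ t. ennreal (\<bar>l t\<bar> powr (2 - p) * \<bar>w t x\<bar> powr (2 - q)) \<partial>\<tau>) \<le> (abs_moment q \<tau> (\<lambda>t. w t x))"
      by (intro nn_integral_mono ennreal_leI) (simp add: pq2)
    then show ?thesis using wq[OF x] by (simp add: pq2)
  next
    case False
    then have s: "2 < s" using s by simp
    then have p2: "p < 2" "1 < q" by (auto simp: p_def q_def field_simps)
    \<comment> \<open>These exponents equal \<open>s / (s - 2)\<close> and \<open>s / 2\<close>,
      which are conjugate; they turn the factors into the \<open>p\<close>-th power of
      \<open>l\<close> and the \<open>q\<close>-th power of \<open>w\<close>. This is what fixes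
      \<open>q = 2 * s / (s + 2)\<close>.\<close>
    let ?P = "p / (2 - p)" and ?Q = "q / (2 - q)"
    note [measurable] = wx[OF x]
    have e: "1 < ?P" "1 < ?Q" using p2 pq by (auto simp: field_simps)
    have c: "1 / ?P + 1 / ?Q = 1" using s by (simp add: p_def q_def divide_simps)
    have "(\<integral>\<^sup>+ t. ennreal (\<bar>\<bar>l t\<bar> powr (2 - p)\<bar> * \<bar>\<bar>w t x\<bar> powr (2 - q)\<bar>) \<partial>\<tau>) \<le> ennreal (1 * m powr (2 - q))"
    proof (rule holder_nn_integral[OF _ _ e c])
      show "(\<integral>\<^sup>+ t. ennreal (\<bar>\<bar>l t\<bar> powr (2 - p)\<bar> powr ?P) \<partial>\<tau>) \<le> ennreal (1 powr ?P)"
        using p2 lp by (simp add: powr_powr flip: p_def)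
      show "(\<integral>\<^sup>+ t. ennreal (\<bar>\<bar>w t x\<bar> powr (2 - q)\<bar> powr ?Q) \<partial>\<tau>) \<le> ennreal ((m powr (2 - q)) powr ?Q)"
        using pq wq[OF x] by (simp add: powr_powr)
    qed (use m in auto)
    then show ?thesis by simp
  qed
  have "(\<integral>\<^sup>+ x. (\<integral>\<^sup>+ t. ennreal (\<bar>l t\<bar> * \<bar>w t x\<bar>) \<partial>\<tau>)\<^sup>2 \<partial>N) \<le>
      (\<integral>\<^sup>+ x. (\<integral>\<^sup>+ t. ennreal (\<bar>l t\<bar> powr p * \<bar>w t x\<bar> powr q) \<partial>\<tau>) * ennreal (m powr (2 - q)) \<partial>N)"
  proof (rule nn_integral_mono)
    fix x assume x: "x \<in> space N"
    note [measurable] = wx[OF x]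
    let ?f = "\<lambda>t. ennreal (\<bar>l t\<bar> powr (p / 2) * \<bar>w t x\<bar> powr (q / 2))"
    let ?g = "\<lambda>t. ennreal (\<bar>l t\<bar> powr (1 - p / 2) * \<bar>w t x\<bar> powr (1 - q / 2))"
    have fg: "ennreal (\<bar>l t\<bar> * \<bar>w t x\<bar>) = ?f t * ?g t" for t
    proof -
      have "(a powr (c / 2) * a powr (1 - c / 2)) = a" if "0 \<le> a" for a c :: real
        using that by (simp flip: powr_add)
      note e = this[of "\<bar>l t\<bar>" p] this[of "\<bar>w t x\<bar>" q]
      have "\<bar>l t\<bar> * \<bar>w t x\<bar> = (\<bar>l t\<bar> powr (p / 2) * \<bar>l t\<bar> powr (1 - p / 2)) * (\<bar>w t x\<bar> powr (q / 2) * \<bar>w t x\<bar> powr (1 - q / 2))"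
        by (simp only: e abs_ge_zero)
      also have "\<dots> = (\<bar>l t\<bar> powr (p / 2) * \<bar>w t x\<bar> powr (q / 2)) * (\<bar>l t\<bar> powr (1 - p / 2) * \<bar>w t x\<bar> powr (1 - q / 2))"
        by (simp only: mult_ac)
      finally show ?thesis by (subst ennreal_mult[symmetric]) auto
    qed
    have sq: "(a powr c)\<^sup>2 = a powr (2 * c)" if "0 \<le> a" for a c :: real
      by (simp only: power2_eq_square powr_add[symmetric] mult_2)
    have f2: "(?f t)\<^sup>2 = ennreal (\<bar>l t\<bar> powr p * \<bar>w t x\<bar> powr q)" for t
      by (simp add: ennreal_power power_mult_distrib sq)
    have g2: "(?g t)\<^sup>2 = ennreal (\<bar>l t\<bar> powr (2 - p) * \<bar>w t x\<bar> powr (2 - q))" for t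
      by (simp add: ennreal_power power_mult_distrib sq right_diff_distrib)
    have "(\<integral>\<^sup>+ t. ennreal (\<bar>l t\<bar> * \<bar>w t x\<bar>) \<partial>\<tau>)\<^sup>2 \<le> (\<integral>\<^sup>+ t. (?f t)\<^sup>2 \<partial>\<tau>) * (\<integral>\<^sup>+ t. (?g t)\<^sup>2 \<partial>\<tau>)"
      unfolding fg by (rule Cauchy_Schwarz_nn_integral) measurable
    also have "\<dots> \<le> (\<integral>\<^sup>+ t. ennreal (\<bar>l t\<bar> powr p * \<bar>w t x\<bar> powr q) \<partial>\<tau>) * ennreal (m powr (2 - q))"
      unfolding f2 g2 by (intro mult_left_mono rest x) simp
    finally show "(\<integral>\<^sup>+ t. ennreal (\<bar>l t\<bar> * \<bar>w t x\<bar>) \<partial>\<tau>)\<^sup>2 \<le>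
        (\<integral>\<^sup>+ t. ennreal (\<bar>l t\<bar> powr p * \<bar>w t x\<bar> powr q) \<partial>\<tau>) * ennreal (m powr (2 - q))" .
  qed
  also have "\<dots> = (\<integral>\<^sup>+ x. (\<integral>\<^sup>+ t. ennreal (\<bar>l t\<bar> powr p * \<bar>w t x\<bar> powr q) \<partial>\<tau>) \<partial>N) * ennreal (m powr (2 - q))"
    by (rule nn_integral_multc) measurable
  also have "(\<integral>\<^sup>+ x. (\<integral>\<^sup>+ t. ennreal (\<bar>l t\<bar> powr p * \<bar>w t x\<bar> powr q) \<partial>\<tau>) \<partial>N) =
      (\<integral>\<^sup>+ t. (\<integral>\<^sup>+ x. ennreal (\<bar>l t\<bar> powr p * \<bar>w t x\<bar> powr q) \<partial>N) \<partial>\<tau>)"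
    by (rule TN.Fubini') measurable
  also have "\<dots> \<le> (\<integral>\<^sup>+ t. ennreal (\<bar>l t\<bar> powr p) * ennreal (m powr q) \<partial>\<tau>)"
  proof (rule nn_integral_mono)
    fix t assume t: "t \<in> space \<tau>"
    have [measurable]: "w t \<in> borel_measurable N"
      using measurable_compose[OF measurable_Pair1'[OF t] w] by simp
    have "(\<integral>\<^sup>+ x. ennreal (\<bar>l t\<bar> powr p * \<bar>w t x\<bar> powr q) \<partial>N) = ennreal (\<bar>l t\<bar> powr p) * (abs_moment q N (w t))"
      by (simp add: ennreal_mult nn_integral_cmult)
    also have "\<dots> \<le> ennreal (\<bar>l t\<bar> powr p) * ennreal (m powr q)" by (intro mult_left_mono wq2 t) simp
    finally show "(\<integral>\<^sup>+ x. ennreal (\<bar>l t\<bar> powr p * \<bar>w t x\<bar> powr q) \<partial>N) \<le> ennreal (\<bar>l t\<bar> powr p) * ennreal (m powr q)" .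
  qed
  also have "\<dots> = (abs_moment p \<tau> l) * ennreal (m powr q)"
    by (rule nn_integral_multc) measurable
  also have "\<dots> \<le> 1 * ennreal (m powr q)" using lp by (intro mult_right_mono) (simp_all add: p_def)
  finally have "(\<integral>\<^sup>+ x. (\<integral>\<^sup>+ t. ennreal (\<bar>l t\<bar> * \<bar>w t x\<bar>) \<partial>\<tau>)\<^sup>2 \<partial>N) \<le> 1 * ennreal (m powr q) * ennreal (m powr (2 - q))"
    by (simp add: mult_right_mono)
  also have "\<dots> = ennreal (m powr q * m powr (2 - q))" by (simp add: ennreal_mult)
  also have "m powr q * m powr (2 - q) = m\<^sup>2" using m by (simp flip: powr_add)
  finally show ?thesis .
qed

section \<open>The centred random function, its sums and their norms\<close>

locale random_kernel =
  fixes \<tau> :: "'t measure" and N :: "'x measure" and w :: "'t \<Rightarrow> 'x \<Rightarrow> real" and s b :: real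
  assumes tau_sigma_finite: "sigma_finite_measure \<tau>" and N_prob: "prob_space N"
    and w_meas [measurable]: "case_prod w \<in> borel_measurable (\<tau> \<Otimes>\<^sub>M N)"
    and s_ge: "1 \<le> s" and b_nonneg: "0 \<le> b"
    and w_norm: "\<And>x. x \<in> space N \<Longrightarrow> Lp_norm s \<tau> (\<lambda>t. w t x) \<le> ennreal b"
begin

sublocale T: sigma_finite_measure \<tau> by (rule tau_sigma_finite)
sublocale N: prob_space N by (rule N_prob)
sublocale TN: pair_sigma_finite \<tau> N ..

text \<open>Where \<open>w t\<close> is not integrable this is 0 by convention. Such
  \<open>t\<close> form a null set, since by \<open>w_powr_integral\<close> almost every
  \<open>w t\<close> has a finite \<open>s\<close>-th moment.\<close>

definition w_mean :: "'t \<Rightarrow> real" where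
  "w_mean t = (\<integral>x. w t x \<partial>N)"

definition h :: "'x \<Rightarrow> 't \<Rightarrow> real" where
  "h x t = w t x - w_mean t"

text \<open>With the index set as an argument, the leave-one-out sum is \<open>S (I - {k})\<close>
  at the same point \<open>x\<close>, and it visibly ignores the value of \<open>x\<close> at
  \<open>k\<close>.\<close>

definition S :: "'i set \<Rightarrow> ('i \<Rightarrow> 'x) \<Rightarrow> 't \<Rightarrow> real" where
  "S I x t = (\<Sum>i\<in>I. h (x i) t)"

definition Z :: "'i set \<Rightarrow> ('i \<Rightarrow> 'x) \<Rightarrow> real" where
  "Z I x = enn2real (Lp_norm s \<tau> (S I x))"

lemma w_meas1: "t \<in> space \<tau> \<Longrightarrow> w t \<in> borel_measurable N"
  using measurable_compose[OF measurable_Pair1' w_meas] by simp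

lemma w_meas2: "x \<in> space N \<Longrightarrow> (\<lambda>t. w t x) \<in> borel_measurable \<tau>"
  using measurable_compose[OF measurable_Pair2' w_meas] by simp

lemma w_mean_meas [measurable]: "w_mean \<in> borel_measurable \<tau>"
  unfolding w_mean_def[abs_def] by measurable

lemma h_pair_meas [measurable]: "(\<lambda>(t, x). h x t) \<in> borel_measurable (\<tau> \<Otimes>\<^sub>M N)"
  unfolding h_def by measurable

lemma h_meas: "x \<in> space N \<Longrightarrow> h x \<in> borel_measurable \<tau>"
  using w_meas2[of x] unfolding h_def[abs_def] by measurable

lemma S_meas: "x \<in> space (N.iid I) \<Longrightarrow> J \<subseteq> I \<Longrightarrow> S J x \<in> borel_measurable \<tau>"
  unfolding S_def[abs_def] by (intro borel_measurable_sum h_meas) (auto simp: space_PiM)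

lemma S_pair_meas: "J \<subseteq> I \<Longrightarrow> (\<lambda>(x, t). S J x t) \<in> borel_measurable (N.iid I \<Otimes>\<^sub>M \<tau>)"
proof -
  assume J: "J \<subseteq> I"
  have "(\<lambda>(x, t). h (x i) t) \<in> borel_measurable (N.iid I \<Otimes>\<^sub>M \<tau>)" if "i \<in> J" for i
  proof -
    have "i \<in> I" using that J by auto
    then have "(\<lambda>z. (snd z, fst z i)) \<in> measurable (N.iid I \<Otimes>\<^sub>M \<tau>) (\<tau> \<Otimes>\<^sub>M N)"
      by measurable
    from measurable_compose[OF this h_pair_meas] show ?thesis by (simp add: case_prod_unfold)
  qed
  then show ?thesis unfolding S_def case_prod_unfold by (intro borel_measurable_sum) auto
qed

lemma S_norm_meas:
  assumes "J \<subseteq> I" shows "(\<lambda>x. Lp_norm s \<tau> (S J x)) \<in> borel_measurable (N.iid I)"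
proof -
  note [measurable] = S_pair_meas[OF assms]
  show ?thesis unfolding Lp_norm_def by measurable
qed

lemma Z_meas: "J \<subseteq> I \<Longrightarrow> Z J \<in> borel_measurable (N.iid I)"
  using S_norm_meas[of J I] unfolding Z_def[abs_def] by measurable

lemma w_powr_integral: "(\<integral>\<^sup>+ t. (abs_moment s N (w t)) \<partial>\<tau>) \<le> ennreal (b powr s)"
proof -
  have "(\<integral>\<^sup>+ t. (abs_moment s N (w t)) \<partial>\<tau>) = (\<integral>\<^sup>+ x. (abs_moment s \<tau> (\<lambda>t. w t x)) \<partial>N)"
    by (rule TN.Fubini'[symmetric]) measurable
  also have "\<dots> \<le> (\<integral>\<^sup>+ x. ennreal (b powr s) \<partial>N)"
    using w_norm s_ge b_nonneg by (intro nn_integral_mono) (simp flip: Lp_norm_le_iff)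
  finally show ?thesis by (simp add: N.emeasure_space_1)
qed

lemma w_mean_norm: "Lp_norm s \<tau> w_mean \<le> ennreal b"
proof -
  have "(abs_moment s \<tau> w_mean) \<le> (\<integral>\<^sup>+ t. (abs_moment s N (w t)) \<partial>\<tau>)"
    unfolding w_mean_def by (intro nn_integral_mono N.powr_abs_expectation_le w_meas1 s_ge)
  also note w_powr_integral
  finally show ?thesis using s_ge b_nonneg by (subst Lp_norm_le_iff) auto
qed

lemma h_norm: assumes x: "x \<in> space N" shows "Lp_norm s \<tau> (h x) \<le> ennreal (2 * b)"
proof -
  note [measurable] = w_meas2[OF x]
  have "Lp_norm s \<tau> (\<lambda>t. w t x + - 1 * w_mean t) \<le> Lp_norm s \<tau> (\<lambda>t. w t x) + Lp_norm s \<tau> (\<lambda>t. - 1 * w_mean t)"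
    by (rule Lp_norm_triangle) (use s_ge in auto)
  also have "Lp_norm s \<tau> (\<lambda>t. - 1 * w_mean t) = Lp_norm s \<tau> w_mean"
    by (rule Lp_norm_cong_AE) simp
  also have "Lp_norm s \<tau> (\<lambda>t. w t x) + Lp_norm s \<tau> w_mean \<le> ennreal b + ennreal b"
    by (intro add_mono w_norm x w_mean_norm)
  also have "\<dots> = ennreal (2 * b)" using b_nonneg by (subst ennreal_plus[symmetric]) auto
  finally show ?thesis by (simp add: h_def[abs_def])
qed

lemma S_norm:
  assumes "finite I" "x \<in> space (N.iid I)" "J \<subseteq> I"
  shows "Lp_norm s \<tau> (S J x) \<le> ennreal (real (card J) * (2 * b))"
proof -
  have xi: "x i \<in> space N" if "i \<in> J" for i using assms that by (auto simp: space_PiM)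
  have fJ: "finite J" using assms finite_subset by blast
  have "Lp_norm s \<tau> (S J x) \<le> (\<Sum>i\<in>J. Lp_norm s \<tau> (h (x i)))"
    unfolding S_def[abs_def] by (rule Lp_norm_sum_le[OF fJ h_meas[OF xi] s_ge])
  also have "\<dots> \<le> (\<Sum>i\<in>J. ennreal (2 * b))" by (intro sum_mono h_norm xi)
  also have "\<dots> = ennreal (real (card J) * (2 * b))"
    using b_nonneg by (simp add: ennreal_mult ennreal_of_nat_eq_real_of_nat)
  finally show ?thesis .
qed

lemma Z_ennreal:
  assumes "finite I" "x \<in> space (N.iid I)" "J \<subseteq> I"
  shows "Lp_norm s \<tau> (S J x) = ennreal (Z J x)"
  using S_norm[OF assms] by (simp add: Z_def order_le_less_trans)

lemma Z_bounds:
  assumes "finite I" "x \<in> space (N.iid I)" "J \<subseteq> I"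
  shows "0 \<le> Z J x" "Z J x \<le> real (card I) * (2 * b)"
proof -
  show z: "0 \<le> Z J x" by (simp add: Z_def)
  have "ennreal (Z J x) \<le> ennreal (real (card J) * (2 * b))" using S_norm[OF assms] Z_ennreal[OF assms] by simp
  then have "Z J x \<le> real (card J) * (2 * b)" using b_nonneg by (subst (asm) ennreal_le_iff) auto
  also have "\<dots> \<le> real (card I) * (2 * b)"
    using b_nonneg assms by (intro mult_right_mono) (auto intro: card_mono)
  finally show "Z J x \<le> real (card I) * (2 * b)" .
qed

lemma Z_le_add:
  assumes I: "finite I" "k \<in> I" and x: "x \<in> space (N.iid I)"
  shows "Z I x \<le> Z (I - {k}) x + 2 * b"
proof -
  have xk: "x k \<in> space N" using I x by (auto simp: space_PiM)
  have S: "S I x t = S (I - {k}) x t + h (x k) t" for t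
    unfolding S_def using I by (simp add: sum.remove[of I k])
  have "Lp_norm s \<tau> (S I x) \<le> Lp_norm s \<tau> (S (I - {k}) x) + Lp_norm s \<tau> (h (x k))"
    unfolding S[abs_def] by (rule Lp_norm_triangle[OF S_meas[OF x] h_meas[OF xk] s_ge]) auto
  also have "\<dots> \<le> Lp_norm s \<tau> (S (I - {k}) x) + ennreal (2 * b)" by (intro add_left_mono h_norm xk)
  finally have "ennreal (Z I x) \<le> ennreal (Z (I - {k}) x + 2 * b)"
    using Z_ennreal[OF I(1) x, of I] Z_ennreal[OF I(1) x, of "I - {k}"] b_nonneg Z_bounds(1)[OF I(1) x, of "I - {k}"]
    by simp
  then show ?thesis using b_nonneg Z_bounds(1)[OF I(1) x, of "I - {k}"] by (subst (asm) ennreal_le_iff) auto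
qed

text \<open>The means cancel when one summand is exchanged, so the oscillation is
  \<open>2 * b\<close> and not the \<open>4 * b\<close> that two centred functions would suggest;
  the Hoeffding exponent gains a factor four.\<close>

lemma Z_upd_le:
  assumes I: "finite I" "k \<in> I" and x: "x \<in> space (N.iid I)" and y: "y \<in> space N" "y' \<in> space N"
  shows "Z I (x(k := y)) \<le> Z I (x(k := y')) + 2 * b"
proof -
  have sp: "x(k := u) \<in> space (N.iid I)" if "u \<in> space N" for u
    using N.PiM_upd_space[OF x that, of k] I by (simp add: insert_absorb)
  have S: "S I (x(k := y)) t = S I (x(k := y')) t + (w t y + - 1 * w t y')" for t
  proof -
    have "S I (x(k := u)) t = S (I - {k}) x t + h u t" for u
      unfolding S_def using I by (simp add: sum.remove[of I k])
    then show ?thesis by (simp add: h_def)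
  qed
  note [measurable] = w_meas2[OF y(1)] w_meas2[OF y(2)] S_meas[OF sp[OF y(2)] order_refl]
  have "ennreal (Z I (x(k := y))) = Lp_norm s \<tau> (S I (x(k := y)))"
    by (rule Z_ennreal[OF I(1) sp[OF y(1)] order_refl, symmetric])
  also have "\<dots> \<le> Lp_norm s \<tau> (S I (x(k := y'))) + Lp_norm s \<tau> (\<lambda>t. w t y + - 1 * w t y')"
    unfolding S[abs_def] by (rule Lp_norm_triangle) (use s_ge in auto)
  also have "Lp_norm s \<tau> (\<lambda>t. w t y + - 1 * w t y') \<le> Lp_norm s \<tau> (\<lambda>t. w t y) + Lp_norm s \<tau> (\<lambda>t. - 1 * w t y')"
    by (rule Lp_norm_triangle) (use s_ge in auto)
  also have "Lp_norm s \<tau> (\<lambda>t. - 1 * w t y') = Lp_norm s \<tau> (\<lambda>t. w t y')"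
    by (rule Lp_norm_cong_AE) simp
  also have "Lp_norm s \<tau> (\<lambda>t. w t y) + Lp_norm s \<tau> (\<lambda>t. w t y') \<le> ennreal b + ennreal b"
    by (intro add_mono w_norm y)
  also have "\<dots> = ennreal (2 * b)" using b_nonneg by (subst ennreal_plus[symmetric]) auto
  also have "Lp_norm s \<tau> (S I (x(k := y'))) = ennreal (Z I (x(k := y')))"
    by (rule Z_ennreal[OF I(1) sp[OF y(2)] order_refl])
  also have "ennreal (Z I (x(k := y'))) + ennreal (2 * b) = ennreal (Z I (x(k := y')) + 2 * b)"
    using b_nonneg by (intro ennreal_plus[symmetric] Z_bounds(1)[OF I(1) sp[OF y(2)] order_refl]) auto
  finally have "ennreal (Z I (x(k := y))) \<le> ennreal (Z I (x(k := y')) + 2 * b)"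
    by (simp only: add_left_mono)
  then show ?thesis using b_nonneg Z_bounds(1)[OF I(1) sp[OF y(2)], of I] by (subst (asm) ennreal_le_iff) auto
qed

text \<open>The leave-one-out norms add up to at least \<open>(n - 1) Z\<close> because the leave-one-out sums
  add up to \<open>(n - 1) S\<close>.\<close>

lemma sum_Z_diff_le:
  assumes I: "finite I" and x: "x \<in> space (N.iid I)"
  shows "(\<Sum>k\<in>I. Z I x - Z (I - {k}) x) \<le> Z I x"
proof (cases "I = {}")
  case False
  then have n: "1 \<le> real (card I)" using I by (simp add: Suc_leI card_gt_0_iff)
  have eq: "(\<Sum>k\<in>I. S (I - {k}) x t) = (real (card I) - 1) * S I x t" for t
  proof -
    have "S (I - {k}) x t = S I x t - h (x k) t" if "k \<in> I" for k
      unfolding S_def using that I by (simp add: sum.remove[of I k])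
    then have "(\<Sum>k\<in>I. S (I - {k}) x t) = (\<Sum>k\<in>I. S I x t - h (x k) t)" by (rule sum.cong[OF refl])
    then show ?thesis by (simp add: sum_subtractf algebra_simps) (simp add: S_def)
  qed
  have "ennreal (real (card I) - 1) * Lp_norm s \<tau> (S I x) = Lp_norm s \<tau> (\<lambda>t. (real (card I) - 1) * S I x t)"
    using Lp_norm_cmult[OF S_meas[OF x order_refl], of s "real (card I) - 1"] n s_ge by simp
  also have "\<dots> = Lp_norm s \<tau> (\<lambda>t. \<Sum>k\<in>I. S (I - {k}) x t)" by (simp only: eq)
  also have "\<dots> \<le> (\<Sum>k\<in>I. Lp_norm s \<tau> (S (I - {k}) x))"
    by (intro Lp_norm_sum_le I S_meas[OF x] s_ge) auto
  also have "\<dots> = (\<Sum>k\<in>I. ennreal (Z (I - {k}) x))" by (intro sum.cong refl Z_ennreal[OF I x]) auto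
  also have "\<dots> = ennreal (\<Sum>k\<in>I. Z (I - {k}) x)" by (intro sum_ennreal Z_bounds(1)[OF I x]) auto
  finally have "ennreal ((real (card I) - 1) * Z I x) \<le> ennreal (\<Sum>k\<in>I. Z (I - {k}) x)"
    using n Z_ennreal[OF I x, of I] Z_bounds(1)[OF I x, of I] by (simp add: ennreal_mult)
  then have "(real (card I) - 1) * Z I x \<le> (\<Sum>k\<in>I. Z (I - {k}) x)"
    by (subst (asm) ennreal_le_iff) (auto intro!: sum_nonneg Z_bounds(1)[OF I x])
  then show ?thesis by (simp add: sum_subtractf algebra_simps)
qed (simp add: Z_def)

text \<open>\<open>G\<close> pairs a fixed dual element with a centred summand. Hoelder's inequality
  makes \<open>l t * w t y\<close> integrable on the product, so Fubini's theorem identifies the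
  mean of the uncentred pairing \<open>G0\<close> with the pairing \<open>c\<close> of
  \<open>l\<close> and \<open>w_mean\<close>. The variance is at most the second moment of
  \<open>G0\<close>, and with absolute values inside the integral this is the quantity bounded by
  the Schur test.\<close>

lemma functional_centered:
  assumes s: "1 < s" and l[measurable]: "l \<in> borel_measurable \<tau>"
    and lp: "(abs_moment (s / (s - 1)) \<tau> l) \<le> 1"
  defines "G \<equiv> \<lambda>y. \<integral>t. l t * h y t \<partial>\<tau>"
  shows "G \<in> borel_measurable N" "\<And>y. y \<in> space N \<Longrightarrow> \<bar>G y\<bar> \<le> 2 * b" "(\<integral>y. G y \<partial>N) = 0"
    "(\<integral>\<^sup>+ y. (\<integral>\<^sup>+ t. ennreal (\<bar>l t\<bar> * \<bar>w t y\<bar>) \<partial>\<tau>)\<^sup>2 \<partial>N) \<le> ennreal \<sigma>2 \<Longrightarrow> 0 \<le> \<sigma>2 \<Longrightarrow> (\<integral>y. (G y)\<^sup>2 \<partial>N) \<le> \<sigma>2"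
proof -
  show Gm[measurable]: "G \<in> borel_measurable N" unfolding G_def by measurable
  show Gb: "\<bar>G y\<bar> \<le> 2 * b" if "y \<in> space N" for y
    unfolding G_def
    by (rule conjugate_pairing(3)[OF l h_meas[OF that] s lp _ h_norm[OF that]]) (use b_nonneg in simp)
  define G0 where "G0 y = (\<integral>t. l t * w t y \<partial>\<tau>)" for y
  have G0m[measurable]: "G0 \<in> borel_measurable N" unfolding G0_def[abs_def] by measurable
  define c where "c = (\<integral>t. l t * w_mean t \<partial>\<tau>)"
  have G: "G y = G0 y - c" if "y \<in> space N" for y
  proof -
    have "G y = (\<integral>t. l t * w t y - l t * w_mean t \<partial>\<tau>)" by (simp add: G_def h_def right_diff_distrib)
    also have "\<dots> = G0 y - c" unfolding G0_def c_def
      by (rule Bochner_Integration.integral_diff[OF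
            conjugate_pairing(2)[OF l w_meas2[OF that] s lp b_nonneg w_norm[OF that]]
            conjugate_pairing(2)[OF l w_mean_meas s lp b_nonneg w_mean_norm]])
    finally show ?thesis .
  qed
  have G0b: "\<bar>G0 y\<bar> \<le> b" if "y \<in> space N" for y
    unfolding G0_def by (rule conjugate_pairing(3)[OF l w_meas2[OF that] s lp b_nonneg w_norm[OF that]])
  have iG0: "integrable N G0" by (rule N.integrable_const_bound[OF AE_I2]) (use G0b in auto)
  have "(\<integral>\<^sup>+ z. ennreal (norm (case z of (t, y) \<Rightarrow> l t * w t y)) \<partial>(\<tau> \<Otimes>\<^sub>M N)) =
      (\<integral>\<^sup>+ y. (\<integral>\<^sup>+ t. ennreal (\<bar>l t\<bar> * \<bar>w t y\<bar>) \<partial>\<tau>) \<partial>N)"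
    by (subst TN.nn_integral_snd[symmetric]) (simp_all add: abs_mult)
  also have "\<dots> \<le> (\<integral>\<^sup>+ y. ennreal b \<partial>N)"
    by (intro nn_integral_mono conjugate_pairing(1)[OF l w_meas2 s lp b_nonneg w_norm])
  also have "\<dots> < \<infinity>" by (simp add: N.emeasure_space_1)
  finally have "integrable (\<tau> \<Otimes>\<^sub>M N) (case_prod (\<lambda>t y. l t * w t y))"
    by (intro integrableI_bounded) auto
  from TN.Fubini_integral[OF this] have "(\<integral>y. G0 y \<partial>N) = c"
    by (simp add: G0_def c_def w_mean_def)
  moreover have "(\<integral>y. G y \<partial>N) = (\<integral>y. G0 y - c \<partial>N)" by (rule Bochner_Integration.integral_cong) (simp_all add: G)
  ultimately show "(\<integral>y. G y \<partial>N) = 0" using iG0 by (simp add: N.prob_space)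
  have EG0: "N.expectation G0 = c" by fact
  assume v: "(\<integral>\<^sup>+ y. (\<integral>\<^sup>+ t. ennreal (\<bar>l t\<bar> * \<bar>w t y\<bar>) \<partial>\<tau>)\<^sup>2 \<partial>N) \<le> ennreal \<sigma>2" and s2: "0 \<le> \<sigma>2"
  have "(\<integral>\<^sup>+ y. ennreal ((G y)\<^sup>2) \<partial>N) = (abs_moment 2 N (\<lambda>y. 0 + (G0 y - N.expectation G0)))"
    by (rule nn_integral_cong) (simp add: G EG0)
  also have "\<dots> \<le> ennreal (\<bar>0\<bar> powr 2) + (\<integral>\<^sup>+ y. ennreal ((G0 y)\<^sup>2) \<partial>N)"
    by (rule N.centered_second_moment_le) measurable
  also have "\<dots> = (\<integral>\<^sup>+ y. ennreal ((G0 y)\<^sup>2) \<partial>N)" by simp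
  also have "\<dots> \<le> (\<integral>\<^sup>+ y. (\<integral>\<^sup>+ t. ennreal (\<bar>l t\<bar> * \<bar>w t y\<bar>) \<partial>\<tau>)\<^sup>2 \<partial>N)"
  proof (rule nn_integral_mono)
    fix y assume y: "y \<in> space N"
    have "ennreal \<bar>G0 y\<bar> \<le> (\<integral>\<^sup>+ t. ennreal (\<bar>l t\<bar> * \<bar>w t y\<bar>) \<partial>\<tau>)"
      using integral_norm_bound_ennreal[OF conjugate_pairing(2)[OF l w_meas2[OF y] s lp b_nonneg w_norm[OF y]]]
      by (simp add: G0_def abs_mult)
    then have "(ennreal \<bar>G0 y\<bar>)\<^sup>2 \<le> (\<integral>\<^sup>+ t. ennreal (\<bar>l t\<bar> * \<bar>w t y\<bar>) \<partial>\<tau>)\<^sup>2" by (intro power_mono) auto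
    then show "ennreal ((G0 y)\<^sup>2) \<le> (\<integral>\<^sup>+ t. ennreal (\<bar>l t\<bar> * \<bar>w t y\<bar>) \<partial>\<tau>)\<^sup>2" by (simp add: ennreal_power)
  qed
  also note v
  finally have le: "(\<integral>\<^sup>+ y. ennreal ((G y)\<^sup>2) \<partial>N) \<le> ennreal \<sigma>2" .
  have "integrable N (\<lambda>y. (G y)\<^sup>2)"
    using le by (intro integrableI_bounded) (auto intro: order_le_less_trans)
  then have "ennreal (\<integral>y. (G y)\<^sup>2 \<partial>N) \<le> ennreal \<sigma>2" using le by (simp add: nn_integral_eq_integral)
  then show "(\<integral>y. (G y)\<^sup>2 \<partial>N) \<le> \<sigma>2" using s2 by (simp add: ennreal_le_iff)
qed

text \<open>Division by \<open>c = 2 * b\<close> normalizes the increments. The functional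
  \<open>l k x\<close> attains the norm on the sum without summand \<open>k\<close> and has dual
  norm at most 1; paired with the full sum it gives at most \<open>Z I x\<close>. Subtracting, its
  pairing with the \<open>k\<close>-th summand bounds the increment from below.\<close>

lemma Z_tail_bernstein:
  fixes I :: "'i set"
  defines "Q \<equiv> N.iid I"
  assumes s: "1 < s" and b: "0 < b" and I: "finite I" and s2: "0 \<le> \<sigma>2" and z: "0 < z"
    and var: "\<And>l. l \<in> borel_measurable \<tau> \<Longrightarrow> (abs_moment (s / (s - 1)) \<tau> l) \<le> 1 \<Longrightarrow>
      (\<integral>\<^sup>+ y. (\<integral>\<^sup>+ t. ennreal (\<bar>l t\<bar> * \<bar>w t y\<bar>) \<partial>\<tau>)\<^sup>2 \<partial>N) \<le> ennreal \<sigma>2"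
  shows "measure Q {x \<in> space Q. (\<integral>x. Z I x \<partial>Q) + z \<le> Z I x}
    \<le> exp (- (z\<^sup>2 / (2 * (real (card I) * \<sigma>2 + 4 * b * (\<integral>x. Z I x \<partial>Q)) + 4 / 3 * b * z)))"
proof -
  interpret Q: prob_space Q unfolding Q_def by (rule N.PiM_prob_space)
  define c where "c = 2 * b"
  have c: "0 < c" using b by (simp add: c_def)
  define l where "l k x = dual_fun s \<tau> (S (I - {k}) x)" for k x
  define W where "W k x = (\<integral>t. l k x t * h (x k) t \<partial>\<tau>) / c" for k x
  have Sk: "S (I - {k}) x \<in> borel_measurable \<tau>" if "x \<in> space Q" for k x
    using S_meas[of x I "I - {k}"] that by (auto simp: Q_def)
  have xk: "x k \<in> space N" if "k \<in> I" "x \<in> space Q" for k x using that by (auto simp: Q_def space_PiM)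
  have fin: "Lp_norm s \<tau> (S J x) < \<top>" if "x \<in> space Q" "J \<subseteq> I" for J x
    using Z_ennreal[OF I that(1)[unfolded Q_def] that(2)] by simp
  have lm: "l k x \<in> borel_measurable \<tau>" if "x \<in> space Q" for k x
    unfolding l_def by (rule dual_fun_measurable[OF Sk[OF that]])
  have lp: "(abs_moment (s / (s - 1)) \<tau> (l k x)) \<le> 1" if "x \<in> space Q" for k x
    unfolding l_def by (rule dual_fun_norm_le[OF Sk[OF that] s fin[OF that]]) auto
  have l_upd: "l k (x(k := y)) = l k x" and S_upd: "S (I - {k}) (x(k := y)) = S (I - {k}) x" for k x y
    by (auto simp: l_def S_def[abs_def] intro!: arg_cong[where f = "dual_fun s \<tau>"])
  have Z_upd: "Z (I - {k}) (x(k := y)) = Z (I - {k}) x" for k x y by (simp only: Z_def S_upd)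
  have Wm: "W k \<in> borel_measurable Q" if k: "k \<in> I" for k
  proof -
    have [measurable]: "(\<lambda>(x, t). S (I - {k}) x t) \<in> borel_measurable (Q \<Otimes>\<^sub>M \<tau>)"
      unfolding Q_def by (rule S_pair_meas) auto
    have [measurable]: "(\<lambda>x. Lp_norm s \<tau> (S (I - {k}) x)) \<in> borel_measurable Q"
      unfolding Q_def by (rule S_norm_meas) auto
    have "(\<lambda>(x, t). S {k} x t) \<in> borel_measurable (Q \<Otimes>\<^sub>M \<tau>)"
      unfolding Q_def by (rule S_pair_meas) (use k in auto)
    then have [measurable]: "(\<lambda>(x, t). h (x k) t) \<in> borel_measurable (Q \<Otimes>\<^sub>M \<tau>)" by (simp add: S_def)
    show ?thesis unfolding W_def[abs_def] l_def dual_fun_def by measurable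
  qed
  have Wb: "\<bar>W k x\<bar> \<le> 1" if "k \<in> I" "x \<in> space Q" for k x
    using functional_centered(2)[OF s lm[OF that(2)] lp[OF that(2)] xk[OF that], of k] c
    by (simp add: W_def c_def abs_divide divide_le_eq)
  have W_le: "W k x \<le> Z I x / c - Z (I - {k}) x / c" if k: "k \<in> I" and x: "x \<in> space Q" for k x
  proof -
    have xQ: "x \<in> space (N.iid I)" using x by (simp add: Q_def)
    have SI: "S I x t = S (I - {k}) x t + h (x k) t" for t
      unfolding S_def using I k by (simp add: sum.remove[of I k])
    have SIm: "S I x \<in> borel_measurable \<tau>" by (rule S_meas[OF xQ order_refl])
    have nI: "Lp_norm s \<tau> (S I x) \<le> ennreal (Z I x)" using Z_ennreal[OF I xQ order_refl] by simp
    have nk: "Lp_norm s \<tau> (S (I - {k}) x) \<le> ennreal (Z (I - {k}) x)" using Z_ennreal[OF I xQ, of "I - {k}"] by auto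
    note zI = Z_bounds(1)[OF I xQ order_refl] and zk = Z_bounds(1)[OF I xQ, of "I - {k}", OF Diff_subset]
    have i1: "integrable \<tau> (\<lambda>t. l k x t * S (I - {k}) x t)"
      by (rule conjugate_pairing(2)[OF lm[OF x] Sk[OF x] s lp[OF x] zk nk])
    have i2: "integrable \<tau> (\<lambda>t. l k x t * h (x k) t)"
      by (rule conjugate_pairing(2)[OF lm[OF x] h_meas[OF xk[OF k x]] s lp[OF x] _ h_norm[OF xk[OF k x]]])
        (use b in simp)
    have "(\<integral>t. l k x t * S I x t \<partial>\<tau>) \<le> Z I x"
      using conjugate_pairing(3)[OF lm[OF x] SIm s lp[OF x] zI nI, of k] by linarith
    moreover have "(\<integral>t. l k x t * S I x t \<partial>\<tau>) = (\<integral>t. l k x t * S (I - {k}) x t \<partial>\<tau>) + (\<integral>t. l k x t * h (x k) t \<partial>\<tau>)"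
      unfolding SI distrib_left by (rule Bochner_Integration.integral_add[OF i1 i2])
    moreover have "(\<integral>t. l k x t * S (I - {k}) x t \<partial>\<tau>) = Z (I - {k}) x"
      unfolding l_def Z_def by (rule dual_fun_attains[OF Sk[OF x] s fin[OF x]]) auto
    ultimately have "(\<integral>t. l k x t * h (x k) t \<partial>\<tau>) \<le> Z I x - Z (I - {k}) x" by linarith
    then have "W k x \<le> (Z I x - Z (I - {k}) x) / c" unfolding W_def using c by (intro divide_right_mono) auto
    then show ?thesis by (simp add: diff_divide_distrib)
  qed
  have ins: "insert k (I - {k}) = I" if "k \<in> I" for k using that by auto
  let ?B = "real (card I) * (2 * b) / c"
  have Zk: "0 \<le> Z (I - {k}) x / c" "Z (I - {k}) x / c \<le> ?B" if "x \<in> space Q" for k x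
    using Z_bounds[OF I that[unfolded Q_def], of "I - {k}"] c by (auto intro: divide_right_mono)
  let ?e = "\<lambda>u k x. exp (u * (Z (I - {k}) x / c))" and ?G = "\<lambda>k x y. \<integral>t. l k x t * h y t \<partial>\<tau>"
  \<comment> \<open>Weight and functional do not depend on the value at \<open>k\<close>, so only
    the summand is integrated inside. Applied with \<open>F\<close> the identity, the square and the
    constant 1, this yields the mean, the variance and the total weight.\<close>
  have iter: "(\<integral>x. ?e u k x * F (W k x) \<partial>Q) =
      (\<integral>x. ?e u k x * (\<integral>y. F ((?G k x y) / c) \<partial>N) \<partial>N.iid (I - {k}))"
    if k: "k \<in> I" and F[measurable]: "F \<in> borel_measurable borel" and Fb: "\<And>v. \<bar>v\<bar> \<le> 1 \<Longrightarrow> \<bar>F v\<bar> \<le> (1::real)"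
    for k F u
  proof -
    note [measurable] = Wm[OF k]
    have [measurable]: "(\<lambda>x. Z (I - {k}) x) \<in> borel_measurable Q" unfolding Q_def by (rule Z_meas) auto
    have "integrable Q (\<lambda>x. ?e u k x * F (W k x))"
    proof (rule Q.integrable_const_bound[OF AE_I2])
      fix x assume x: "x \<in> space Q"
      have "u * (Z (I - {k}) x / c) \<le> \<bar>u\<bar> * ?B" using Zk[OF x, of k] by (intro mult_mono) auto
      then have "?e u k x * \<bar>F (W k x)\<bar> \<le> exp (\<bar>u\<bar> * ?B) * 1"
        using Fb[OF Wb[OF k x]] by (intro mult_mono) auto
      then show "norm (?e u k x * F (W k x)) \<le> exp (\<bar>u\<bar> * ?B) * 1" by (simp add: abs_mult)
    qed measurable
    then have int: "integrable (N.iid (insert k (I - {k}))) (\<lambda>x. ?e u k x * F (W k x))"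
      unfolding ins[OF k] Q_def .
    have "(\<integral>x. ?e u k x * F (W k x) \<partial>Q) =
        (\<integral>x. (\<integral>y. ?e u k (x(k := y)) * F (W k (x(k := y))) \<partial>N) \<partial>N.iid (I - {k}))"
      unfolding Q_def using N.PiM_integral_insert[OF _ _ int] I by (simp only: ins[OF k]) simp
    then show ?thesis unfolding W_def l_upd Z_upd fun_upd_same integral_mult_right_zero .
  qed
  have lJ: "l k x \<in> borel_measurable \<tau>" "(abs_moment (s / (s - 1)) \<tau> (l k x)) \<le> 1"
    if "k \<in> I" "x \<in> space (N.iid (I - {k}))" for k x
  proof -
    \<comment> \<open>Points over \<open>I - {k}\<close> do not belong to \<open>Q\<close>; filling
      in any value at \<open>k\<close> leaves the functional unchanged.\<close>
    obtain y where y: "y \<in> space N" using N.not_empty by auto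
    have "x(k := y) \<in> space Q"
      using N.PiM_upd_space[OF that(2) y, of k] unfolding ins[OF that(1)] Q_def .
    from lm[OF this, of k] lp[OF this, of k]
    show "l k x \<in> borel_measurable \<tau>" "(abs_moment (s / (s - 1)) \<tau> (l k x)) \<le> 1"
      unfolding l_upd .
  qed
  have W_mean: "(\<integral>x. ?e u k x * W k x \<partial>Q) = 0" if k: "k \<in> I" for k u
  proof -
    have "(\<integral>x. ?e u k x * W k x \<partial>Q) = (\<integral>x. ?e u k x *
        (\<integral>y. (?G k x y) / c \<partial>N) \<partial>N.iid (I - {k}))"
      using iter[OF k, of "\<lambda>v. v" u] by simp
    also have "\<dots> = (\<integral>x. 0 \<partial>N.iid (I - {k}))"
      by (rule Bochner_Integration.integral_cong[OF refl])
        (simp add: functional_centered(3)[OF s lJ[OF k]])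
    finally show ?thesis by simp
  qed
  have W_var: "(\<integral>x. ?e u k x * (W k x)\<^sup>2 \<partial>Q) \<le>
      \<sigma>2 / c\<^sup>2 * (\<integral>x. ?e u k x \<partial>Q)" if k: "k \<in> I" for k u
  proof -
    let ?P = "N.iid (I - {k})"
    interpret P: prob_space ?P by (rule N.PiM_prob_space)
    have sq1: "\<bar>v\<^sup>2\<bar> \<le> (1::real)" if "\<bar>v\<bar> \<le> 1" for v using power_mono[OF that, of 2] by simp
    have "(\<integral>x. ?e u k x * (W k x)\<^sup>2 \<partial>Q) = (\<integral>x. ?e u k x *
        (\<integral>y. ((?G k x y) / c)\<^sup>2 \<partial>N) \<partial>?P)"
      by (rule iter[OF k]) (use sq1 in auto)
    also have "\<dots> \<le> (\<integral>x. ?e u k x * (\<sigma>2 / c\<^sup>2) \<partial>?P)"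
    proof (rule integral_mono')
      have [measurable]: "Z (I - {k}) \<in> borel_measurable ?P" by (rule Z_meas) auto
      have "integrable ?P (\<lambda>x. ?e u k x)"
      proof (rule P.integrable_exp_bounded(1))
        show "\<bar>Z (I - {k}) x / c\<bar> \<le> real (card (I - {k})) * (2 * b) / c" if "x \<in> space ?P" for x
          using Z_bounds[OF _ that order_refl] I c by (auto intro: divide_right_mono)
      qed measurable
      then show "integrable ?P (\<lambda>x. ?e u k x * (\<sigma>2 / c\<^sup>2))"
        by (rule integrable_mult_left)
      show "?e u k x * (\<integral>y. ((?G k x y) / c)\<^sup>2 \<partial>N) \<le>
          ?e u k x * (\<sigma>2 / c\<^sup>2)" if x: "x \<in> space ?P" for x
      proof (rule mult_left_mono)
        have "(\<integral>y. (?G k x y)\<^sup>2 \<partial>N) \<le> \<sigma>2"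
          by (rule functional_centered(4)[OF s lJ[OF k x] var[OF lJ[OF k x]] s2])
        then show "(\<integral>y. ((?G k x y) / c)\<^sup>2 \<partial>N) \<le> \<sigma>2 / c\<^sup>2"
          by (simp add: power_divide divide_right_mono)
      qed simp
      show "0 \<le> ?e u k x * (\<sigma>2 / c\<^sup>2)" for x using s2 by simp
    qed
    also have "\<dots> = \<sigma>2 / c\<^sup>2 * (\<integral>x. ?e u k x \<partial>?P)" by simp
    also have "(\<integral>x. ?e u k x \<partial>?P) = (\<integral>x. ?e u k x \<partial>Q)"
      using iter[OF k, of "\<lambda>_. 1" u] by (simp add: N.prob_space)
    finally show ?thesis .
  qed
  have "measure Q {x \<in> space Q. (\<integral>x. Z I x / c \<partial>Q) + z / c \<le> Z I x / c}
    \<le> exp (- ((z / c)\<^sup>2 / (2 * (real (card I) * (\<sigma>2 / c\<^sup>2) + 2 * (\<integral>x. Z I x / c \<partial>Q)) + 2 / 3 * (z / c))))"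
    unfolding Q_def
  proof (rule N.bousquet_PiM[where Zk = "\<lambda>k x. Z (I - {k}) x / c" and W = W and B = ?B])
    show "(\<lambda>x. Z I x / c) \<in> borel_measurable (N.iid I)" using Z_meas[of I I] by simp
    show "(\<lambda>x. Z (I - {k}) x / c) \<in> borel_measurable (N.iid I)" for k using Z_meas[of "I - {k}" I] by simp
    show "0 \<le> Z I x / c" "Z I x / c \<le> ?B" if "x \<in> space (N.iid I)" for x
      using Z_bounds[OF I that order_refl] c by (auto intro: divide_right_mono)
    show "0 \<le> Z (I - {k}) x / c" "Z (I - {k}) x / c \<le> ?B" if "x \<in> space (N.iid I)" for k x
      using Zk[unfolded Q_def, OF that] .
    show "Z (I - {k}) (x(k := y)) / c = Z (I - {k}) x / c" for k x y by (simp only: Z_upd)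
    show "W k \<in> borel_measurable (N.iid I)" if "k \<in> I" for k using Wm[OF that] unfolding Q_def .
    show "\<bar>W k x\<bar> \<le> 1" "W k x \<le> Z I x / c - Z (I - {k}) x / c"
      if "k \<in> I" "x \<in> space (N.iid I)" for k x
      using Wb[unfolded Q_def, OF that] W_le[unfolded Q_def, OF that] .
    show "Z I x / c - Z (I - {k}) x / c \<le> 1" if "k \<in> I" "x \<in> space (N.iid I)" for k x
      using Z_le_add[OF I that] c by (simp add: c_def divide_simps)
    show "(\<Sum>k\<in>I. Z I x / c - Z (I - {k}) x / c) \<le> Z I x / c" if "x \<in> space (N.iid I)" for x
      using divide_right_mono[OF sum_Z_diff_le[OF I that], of c] c by (simp add: sum_divide_distrib diff_divide_distrib)
    show "(\<integral>x. ?e u k x * W k x \<partial>N.iid I) = 0" if "k \<in> I" for k u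
      using W_mean[OF that] unfolding Q_def .
    show "(\<integral>x. ?e u k x * (W k x)\<^sup>2 \<partial>N.iid I) \<le>
      \<sigma>2 / c\<^sup>2 * (\<integral>x. ?e u k x \<partial>N.iid I)" if "k \<in> I" for k u
      using W_var[OF that] unfolding Q_def .
  qed (use I z c s2 in auto)
  also have "{x \<in> space Q. (\<integral>x. Z I x / c \<partial>Q) + z / c \<le> Z I x / c} = {x \<in> space Q. (\<integral>x. Z I x \<partial>Q) + z \<le> Z I x}"
    using c by (simp add: divide_le_cancel flip: add_divide_distrib)
  also have "(z / c)\<^sup>2 / (2 * (real (card I) * (\<sigma>2 / c\<^sup>2) + 2 * (\<integral>x. Z I x / c \<partial>Q)) + 2 / 3 * (z / c)) =
      z\<^sup>2 / (2 * (real (card I) * \<sigma>2 + 4 * b * (\<integral>x. Z I x \<partial>Q)) + 4 / 3 * b * z)"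
  proof -
    define E where "E = (\<integral>x. Z I x \<partial>Q)"
    \<comment> \<open>Scaling back by \<open>c^2\<close> with \<open>c = 2 * b\<close>: the mean
      term \<open>2 * E / c\<close> becomes \<open>4 * b * E\<close>, and \<open>2/3 * z / c\<close>
      becomes \<open>4/3 * b * z\<close>.\<close>
    have "2 * (real (card I) * (\<sigma>2 / c\<^sup>2) + 2 * (E / c)) + 2 / 3 * (z / c) =
        (2 * (real (card I) * \<sigma>2 + 4 * b * E) + 4 / 3 * b * z) / c\<^sup>2"
      using c by (simp add: c_def field_simps power2_eq_square)
    then show ?thesis using c by (simp add: power_divide flip: E_def)
  qed
  finally show ?thesis .
qed

lemma Z_tail_hoeffding:
  fixes I :: "'i set"
  defines "Q \<equiv> N.iid I"
  assumes b: "0 < b" and I: "finite I" "I \<noteq> {}" and z: "0 < z"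
  shows "measure Q {x \<in> space Q. (\<integral>x. Z I x \<partial>Q) + z \<le> Z I x}
    \<le> exp (- (z\<^sup>2 / (2 * real (card I) * b\<^sup>2)))"
proof -
  have "measure Q {x \<in> space Q. (\<integral>x. Z I x \<partial>Q) + z \<le> Z I x}
    \<le> exp (- (2 * z\<^sup>2 / (real (card I) * (2 * b)\<^sup>2)))"
    unfolding Q_def
  proof (rule N.mcdiarmid_PiM[OF I _ z])
    show "\<bar>Z I x\<bar> \<le> real (card I) * (2 * b)" if "x \<in> space (N.iid I)" for x
      using Z_bounds[OF I(1) that order_refl] by simp
  qed (use b Z_meas[of I I] Z_upd_le[OF I(1)] in auto)
  also have "2 * z\<^sup>2 / (real (card I) * (2 * b)\<^sup>2) = z\<^sup>2 / (2 * real (card I) * b\<^sup>2)"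
    by (simp add: power_mult_distrib)
  finally show ?thesis .
qed

end

section \<open>The mean of the norm\<close>

text \<open>Subadditivity of the power \<open>1 / s\<close>, read backwards. It gathers the variance
  and moment terms of Rosenthal's inequality under one \<open>s\<close>-th root with constant
  one.\<close>

lemma enn_powr_superadditive:
  assumes "1 \<le> s" shows "enn_powr a s + enn_powr c s \<le> enn_powr (a + c) s"
proof (cases "a = \<top> \<or> c = \<top>")
  case False
  then obtain x y where xy: "a = ennreal x" "0 \<le> x" "c = ennreal y" "0 \<le> y" by (metis ennreal_cases)
  have "(x powr s + y powr s) powr (1 / s) \<le> (x powr s) powr (1 / s) + (y powr s) powr (1 / s)"
    using assms by (intro powr_add_le) auto
  also have "\<dots> = x + y" using assms xy by (simp add: powr_powr)
  finally have "((x powr s + y powr s) powr (1 / s)) powr s \<le> (x + y) powr s"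
    using assms by (intro powr_mono2) auto
  then have "x powr s + y powr s \<le> (x + y) powr s" using assms by (simp add: powr_powr)
  then have "ennreal (x powr s + y powr s) \<le> ennreal ((x + y) powr s)" by (rule ennreal_leI)
  then show ?thesis using xy by (simp add: enn_powr_ennreal flip: ennreal_plus)
qed auto

section \<open>Moments of centred scalar sums for large exponents\<close>

context prob_space
begin

text \<open>The factor \<open>2 powr s\<close> becomes the 2 in front of
  \<open>n powr (1 / s)\<close> in \<open>rho\<close> for \<open>s > 2\<close>.\<close>

lemma centered_moment_crude:
  fixes v :: "'a \<Rightarrow> real"
  assumes [measurable]: "v \<in> borel_measurable M" and s: "1 \<le> s"
  shows "(abs_moment s M (\<lambda>x. v x - expectation v)) \<le> ennreal (2 powr s) * (abs_moment s M v)"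
proof -
  let ?J = "abs_moment s M v"
  have "(abs_moment s M (\<lambda>x. v x - expectation v)) \<le>
      (\<integral>\<^sup>+x. ennreal (2 powr (s - 1)) * (ennreal (\<bar>v x\<bar> powr s) + ennreal (\<bar>expectation v\<bar> powr s)) \<partial>M)"
  proof (intro nn_integral_mono)
    fix x
    have "\<bar>v x - expectation v\<bar> powr s \<le> 2 powr (s - 1) * (\<bar>v x\<bar> powr s + \<bar>expectation v\<bar> powr s)"
      using powr_sum_two_le[OF s, of "v x" "- expectation v"] by simp
    then show "ennreal (\<bar>v x - expectation v\<bar> powr s) \<le>
        ennreal (2 powr (s - 1)) * (ennreal (\<bar>v x\<bar> powr s) + ennreal (\<bar>expectation v\<bar> powr s))"
      by (simp add: ennreal_leI flip: ennreal_mult ennreal_plus)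
  qed
  also have "\<dots> = ennreal (2 powr (s - 1)) * (?J + ennreal (\<bar>expectation v\<bar> powr s))"
    by (simp add: nn_integral_add nn_integral_cmult emeasure_space_1)
  also have "\<dots> \<le> ennreal (2 powr (s - 1)) * (?J + ?J)"
    by (intro mult_left_mono add_left_mono powr_abs_expectation_le s) auto
  also have "\<dots> = ennreal (2 powr (s - 1) * 2) * ?J"
    by (simp add: ennreal_mult mult.assoc flip: mult_2)
  also have "2 powr (s - 1) * 2 = 2 powr s" by (simp add: powr_diff)
  finally show ?thesis .
qed

text \<open>\<open>rosenthal\<close> takes a positive real level \<open>A\<close>. An infinite
  second moment makes the right-hand side infinite; a vanishing one is handled by letting
  \<open>A\<close> tend to 0 along \<open>A powr s = e / ?C\<close>; otherwise \<open>A\<close> is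
  the square root of \<open>n\<close> times the second moment.\<close>

lemma rosenthal_centered:
  fixes v :: "'a \<Rightarrow> real" and I :: "'i set"
  assumes I: "finite I" "I \<noteq> {}" and [measurable]: "v \<in> borel_measurable M" and s: "2 \<le> s"
  shows "(abs_moment s (iid I) (\<lambda>x. \<Sum>i\<in>I. v (x i) - expectation v))
    \<le> ennreal ((15 * s / ln s) powr s) *
      (enn_powr (of_nat (card I) * (\<integral>\<^sup>+x. ennreal ((v x)\<^sup>2) \<partial>M)) (s / 2)
        + of_nat (card I) * (ennreal (2 powr s) * (abs_moment s M v)))"
    (is "?L \<le> ennreal ?C * (enn_powr ?V _ + ?R)")
proof (cases "?V = \<top>")
  case True
  have "ennreal ?C \<noteq> 0" using s by simp
  then show ?thesis unfolding True by (simp add: ennreal_mult_top)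
next
  case False
  let ?g = "\<lambda>x. v x - expectation v"
  have C: "0 < ?C" using s by simp
  have n: "of_nat (card I) \<noteq> (0::ennreal)" using I by simp
  have "(\<integral>\<^sup>+x. ennreal ((v x)\<^sup>2) \<partial>M) \<noteq> \<top>" using False n by (auto simp: ennreal_mult_eq_top_iff)
  then have i2: "integrable M (\<lambda>x. (v x)\<^sup>2)" by (intro integrableI_bounded) (simp_all add: less_top)
  have i1: "integrable M v" by (rule square_integrable_imp_integrable[OF _ i2]) simp
  have g1: "expectation ?g = 0" using i1 by (simp add: prob_space)
  have "(\<integral>\<^sup>+x. ennreal ((?g x)\<^sup>2) \<partial>M) \<le> (\<integral>\<^sup>+x. ennreal ((v x)\<^sup>2) \<partial>M)"
    using centered_second_moment_le[of v 0] by simp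
  then have g2: "of_nat (card I) * (\<integral>\<^sup>+x. ennreal ((?g x)\<^sup>2) \<partial>M) \<le> ?V" by (intro mult_left_mono) auto
  define a where "a = enn2real ?V"
  have a: "?V = ennreal a" "0 \<le> a" using False by (auto simp: a_def less_top)
  have bound: "?L \<le> ennreal ?C * (ennreal (A powr s) + ?R)" if A: "0 < A" "a \<le> A\<^sup>2" for A
  proof -
    have "?L \<le> ennreal ?C * (ennreal (A powr s) + of_nat (card I) * (abs_moment s M ?g))"
      using g1 A a by (intro rosenthal[OF I _ A(1) s] order_trans[OF g2]) (auto intro: ennreal_leI)
    also have "\<dots> \<le> ennreal ?C * (ennreal (A powr s) + ?R)"
      using s by (intro mult_left_mono add_left_mono centered_moment_crude) auto
    finally show ?thesis .
  qed
  show ?thesis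
  proof (cases "a = 0")
    case True
    have "?L \<le> ennreal ?C * ?R + ennreal e" if e: "0 < e" for e
    proof -
      define A where "A = (e / ?C) powr (1 / s)"
      have A: "0 < A" "a \<le> A\<^sup>2" "A powr s = e / ?C"
        using e C s True by (auto simp: A_def powr_powr)
      have "?L \<le> ennreal ?C * (ennreal (e / ?C) + ?R)" using bound[OF A(1,2)] unfolding A(3) .
      also have "\<dots> = ennreal ?C * ?R + ennreal (?C * (e / ?C))"
        using e C by (simp add: distrib_left add.commute flip: ennreal_mult)
      finally show ?thesis using C by simp
    qed
    then have "?L \<le> ennreal ?C * ?R" by (rule ennreal_le_epsilon)
    then show ?thesis by (rule order_trans) (intro mult_left_mono, auto)
  next
    case False
    have A: "0 < sqrt a" "a \<le> (sqrt a)\<^sup>2" using False a by auto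
    have "sqrt a powr s = a powr (s / 2)"
      using a by (simp add: powr_powr flip: powr_half_sqrt)
    then show ?thesis using bound[OF A] a by (simp add: enn_powr_ennreal)
  qed
qed

end

section \<open>From scalar moments to the mean of the norm\<close>

context random_kernel
begin

abbreviation Sig :: ennreal where
  "Sig \<equiv> enn_powr (\<integral>\<^sup>+ t. enn_powr (\<integral>\<^sup>+ x. ennreal ((w t x)\<^sup>2) \<partial>N) (s / 2) \<partial>\<tau>) (1 / s)"

lemma expectation_Z_nonneg: "0 \<le> (\<integral>x. Z I x \<partial>N.iid I)"
  by (rule integral_nonneg_AE) (simp add: Z_def)

lemma expectation_Z_le:
  assumes I: "finite I"
    and K: "\<And>t. t \<in> space \<tau> \<Longrightarrow> (\<integral>\<^sup>+x. ennreal (\<bar>\<Sum>i\<in>I. w t (x i) - (\<integral>x. w t x \<partial>N)\<bar> powr s) \<partial>N.iid I) \<le> K t"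
  shows "ennreal (\<integral>x. Z I x \<partial>N.iid I) \<le> enn_powr (\<integral>\<^sup>+t. K t \<partial>\<tau>) (1 / s)"
proof -
  let ?Q = "N.iid I"
  interpret Q: prob_space ?Q by (rule N.PiM_prob_space)
  interpret QT: pair_sigma_finite ?Q \<tau> ..
  note [measurable] = S_pair_meas[OF order_refl[of I]] Z_meas[OF order_refl[of I]]
  have "ennreal (\<bar>\<integral>x. Z I x \<partial>?Q\<bar> powr s) \<le> (abs_moment s ?Q (Z I))"
    using s_ge by (intro Q.powr_abs_expectation_le) auto
  also have "\<dots> = (\<integral>\<^sup>+x. (abs_moment s \<tau> (S I x)) \<partial>?Q)"
  proof (rule nn_integral_cong)
    fix x assume x: "x \<in> space ?Q"
    have "Lp_norm s \<tau> (S I x) < \<top>" using Z_ennreal[OF I x order_refl] by simp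
    then show "ennreal (\<bar>Z I x\<bar> powr s) = (abs_moment s \<tau> (S I x))"
      using s_ge by (simp add: Lp_norm_enn2real_powr Z_def)
  qed
  also have "\<dots> = (\<integral>\<^sup>+t. (abs_moment s ?Q (\<lambda>x. S I x t)) \<partial>\<tau>)"
    by (rule QT.Fubini'[symmetric]) measurable
  also have "\<dots> \<le> (\<integral>\<^sup>+t. K t \<partial>\<tau>)"
    using K by (intro nn_integral_mono) (simp add: S_def h_def w_mean_def)
  finally have "enn_powr (ennreal (\<bar>\<integral>x. Z I x \<partial>?Q\<bar> powr s)) (1 / s) \<le> enn_powr (\<integral>\<^sup>+t. K t \<partial>\<tau>) (1 / s)"
    using s_ge by (intro enn_powr_mono) auto
  then show ?thesis using s_ge expectation_Z_nonneg[of I] by (simp add: enn_powr_ennreal powr_powr)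
qed

lemma enn_powr_Sig:
  "enn_powr Sig s = (\<integral>\<^sup>+ t. enn_powr (\<integral>\<^sup>+ x. ennreal ((w t x)\<^sup>2) \<partial>N) (s / 2) \<partial>\<tau>)"
  using s_ge by (simp add: enn_powr_powr)

lemma integral_variance_part:
  "(\<integral>\<^sup>+ t. enn_powr (of_nat n * (\<integral>\<^sup>+ x. ennreal ((w t x)\<^sup>2) \<partial>N)) (s / 2) \<partial>\<tau>) = enn_powr (ennreal (sqrt (real n)) * Sig) s"
proof -
  have n: "enn_powr (of_nat n) (s / 2) = enn_powr (ennreal (sqrt (real n))) s"
    by (simp add: enn_powr_ennreal ennreal_of_nat_eq_real_of_nat powr_powr flip: powr_half_sqrt)
  show ?thesis
    unfolding enn_powr_mult n enn_powr_Sig by (rule nn_integral_cmult) measurable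
qed

text \<open>At each \<open>t\<close> the \<open>s\<close>-th moment is reduced to the second by
  Jensen's inequality with exponent \<open>2 / s \<ge> 1\<close>; by orthogonality the latter is at
  most \<open>n\<close> times the second moment of \<open>w t\<close>.\<close>

lemma expectation_Z_le_Sig:
  assumes I: "finite I" and s: "s \<le> 2"
  shows "ennreal (\<integral>x. Z I x \<partial>N.iid I) \<le> ennreal (sqrt (real (card I))) * Sig"
proof -
  let ?Q = "N.iid I"
  interpret Q: prob_space ?Q by (rule N.PiM_prob_space)
  have "ennreal (\<integral>x. Z I x \<partial>?Q) \<le>
      enn_powr (\<integral>\<^sup>+ t. enn_powr (of_nat (card I) * (\<integral>\<^sup>+ x. ennreal ((w t x)\<^sup>2) \<partial>N)) (s / 2) \<partial>\<tau>) (1 / s)"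
  proof (rule expectation_Z_le[OF I])
    fix t assume t: "t \<in> space \<tau>"
    note [measurable] = w_meas1[OF t]
    let ?S = "\<lambda>x. \<Sum>i\<in>I. w t (x i) - (\<integral>x. w t x \<partial>N)"
    have "enn_powr (\<integral>\<^sup>+x. ennreal \<bar>\<bar>?S x\<bar> powr s\<bar> \<partial>?Q) (2 / s) \<le> (\<integral>\<^sup>+x. ennreal (\<bar>\<bar>?S x\<bar> powr s\<bar> powr (2 / s)) \<partial>?Q)"
      using s s_ge by (intro Q.enn_powr_nn_integral_le) auto
    also have "\<dots> = (abs_moment 2 ?Q (\<lambda>x. 0 + ?S x))"
      using s_ge by (simp add: powr_powr)
    also have "\<dots> \<le> ennreal (\<bar>0\<bar> powr 2) + of_nat (card I) * (\<integral>\<^sup>+ x. ennreal ((w t x)\<^sup>2) \<partial>N)"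
      by (rule N.PiM_moment_le[OF I]) (use N.centered_second_moment_le[of "w t"] in simp_all)
    finally have "enn_powr (enn_powr (abs_moment s ?Q ?S) (2 / s)) (s / 2) \<le>
        enn_powr (of_nat (card I) * (\<integral>\<^sup>+ x. ennreal ((w t x)\<^sup>2) \<partial>N)) (s / 2)"
      using s_ge by (intro enn_powr_mono) auto
    then show "(abs_moment s ?Q ?S) \<le>
        enn_powr (of_nat (card I) * (\<integral>\<^sup>+ x. ennreal ((w t x)\<^sup>2) \<partial>N)) (s / 2)"
      using s_ge by (simp add: enn_powr_powr)
  qed
  then show ?thesis unfolding integral_variance_part using s_ge by (simp add: enn_powr_powr)
qed

lemma integral_moment_part:
  "(\<integral>\<^sup>+ t. of_nat n * (ennreal (2 powr s) * (abs_moment s N (w t))) \<partial>\<tau>)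
    \<le> enn_powr (2 * ennreal (real n powr (1 / s)) * ennreal b) s"
proof -
  have "(\<integral>\<^sup>+ t. of_nat n * (ennreal (2 powr s) * (abs_moment s N (w t))) \<partial>\<tau>) =
      of_nat n * (ennreal (2 powr s) * (\<integral>\<^sup>+ t. (abs_moment s N (w t)) \<partial>\<tau>))"
    by (simp add: nn_integral_cmult)
  also have "\<dots> \<le> of_nat n * (ennreal (2 powr s) * ennreal (b powr s))"
    by (intro mult_left_mono w_powr_integral) auto
  also have "\<dots> = enn_powr (2 * ennreal (real n powr (1 / s)) * ennreal b) s"
  proof -
    have two: "enn_powr 2 s = ennreal (2 powr s)" using enn_powr_ennreal[of 2 s] by simp
    show ?thesis unfolding two enn_powr_mult
      using s_ge b_nonneg by (simp add: enn_powr_ennreal powr_powr ennreal_of_nat_eq_real_of_nat mult_ac)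
  qed
  finally show ?thesis .
qed

text \<open>Each summand adds at most \<open>2 powr s\<close> times its \<open>s\<close>-th moment,
  a type-\<open>s\<close> inequality. The resulting factor 2 is below the 4 in
  \<open>rho\<close>.\<close>

lemma expectation_Z_le_type:
  assumes I: "finite I" and s: "s \<le> 2"
  shows "ennreal (\<integral>x. Z I x \<partial>N.iid I) \<le> 2 * ennreal (real (card I) powr (1 / s)) * ennreal b"
proof -
  let ?Q = "N.iid I"
  have "ennreal (\<integral>x. Z I x \<partial>?Q) \<le>
      enn_powr (\<integral>\<^sup>+ t. of_nat (card I) * (ennreal (2 powr s) * (abs_moment s N (w t))) \<partial>\<tau>) (1 / s)"
  proof (rule expectation_Z_le[OF I])
    fix t assume t: "t \<in> space \<tau>"
    note [measurable] = w_meas1[OF t]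
    let ?S = "\<lambda>x. \<Sum>i\<in>I. w t (x i) - (\<integral>x. w t x \<partial>N)"
    have "(abs_moment s ?Q (\<lambda>x. 0 + ?S x))
      \<le> ennreal (\<bar>0\<bar> powr s) + of_nat (card I) * (ennreal (2 powr s) * (abs_moment s N (w t)))"
      by (rule N.PiM_moment_le[OF I]) (use N.centered_moment_le[OF w_meas1[OF t] s_ge s] in simp_all)
    then show "(abs_moment s ?Q ?S) \<le>
        of_nat (card I) * (ennreal (2 powr s) * (abs_moment s N (w t)))"
      by simp
  qed
  also have "\<dots> \<le> enn_powr (enn_powr (2 * ennreal (real (card I) powr (1 / s)) * ennreal b) s) (1 / s)"
    using s_ge by (intro enn_powr_mono integral_moment_part) auto
  finally show ?thesis using s_ge by (simp add: enn_powr_powr)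
qed

lemma expectation_Z_le_rosenthal:
  assumes I: "finite I" "I \<noteq> {}" and s: "2 \<le> s"
  shows "ennreal (\<integral>x. Z I x \<partial>N.iid I) \<le> ennreal (15 * s / ln s) *
    (ennreal (sqrt (real (card I))) * Sig + 2 * ennreal (real (card I) powr (1 / s)) * ennreal b)"
    (is "_ \<le> ennreal ?c * (?A + ?B)")
proof -
  let ?Q = "N.iid I" and ?C = "ennreal (?c powr s)"
  let ?v = "\<lambda>t. enn_powr (of_nat (card I) * (\<integral>\<^sup>+x. ennreal ((w t x)\<^sup>2) \<partial>N)) (s / 2)"
  let ?m = "\<lambda>t. of_nat (card I) * (ennreal (2 powr s) * (abs_moment s N (w t)))"
  have c: "0 \<le> ?c" using s by simp
  have "ennreal (\<integral>x. Z I x \<partial>?Q) \<le> enn_powr (\<integral>\<^sup>+ t. ?C * (?v t + ?m t) \<partial>\<tau>) (1 / s)"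
    by (rule expectation_Z_le[OF I(1)]) (rule N.rosenthal_centered[OF I w_meas1 s])
  also have "\<dots> \<le> enn_powr (enn_powr (ennreal ?c * (?A + ?B)) s) (1 / s)"
  proof (rule enn_powr_mono)
    have "(\<integral>\<^sup>+ t. ?C * (?v t + ?m t) \<partial>\<tau>) = ?C * ((\<integral>\<^sup>+ t. ?v t \<partial>\<tau>) + (\<integral>\<^sup>+ t. ?m t \<partial>\<tau>))"
      by (simp add: nn_integral_cmult nn_integral_add)
    also have "\<dots> \<le> ?C * (enn_powr ?A s + enn_powr ?B s)"
      by (intro mult_left_mono add_mono integral_moment_part order_eq_refl[OF integral_variance_part]) auto
    also have "\<dots> \<le> ?C * enn_powr (?A + ?B) s"
      by (intro mult_left_mono enn_powr_superadditive s_ge) auto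
    also have "\<dots> = enn_powr (ennreal ?c * (?A + ?B)) s"
      using c by (simp add: enn_powr_mult enn_powr_ennreal)
    finally show "(\<integral>\<^sup>+ t. ?C * (?v t + ?m t) \<partial>\<tau>) \<le> enn_powr (ennreal ?c * (?A + ?B)) s" .
  qed (use s in auto)
  finally show ?thesis using s by (simp add: enn_powr_powr)
qed

text \<open>Turns the factor \<open>Sig\<close> of the mean bound into \<open>M_norm\<close> at
  \<open>s = 2\<close>, the form in which \<open>rho\<close> is stated there.\<close>

lemma Sig_le: assumes s: "s = 2" shows "Sig \<le> ennreal b"
proof -
  have "enn_powr Sig s \<le> ennreal (b powr s)"
    unfolding enn_powr_Sig using w_powr_integral by (simp add: s)
  then have "enn_powr (enn_powr Sig s) (1 / s) \<le> enn_powr (ennreal (b powr s)) (1 / s)"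
    using s_ge by (intro enn_powr_mono) auto
  then show ?thesis using s_ge b_nonneg by (simp add: enn_powr_powr enn_powr_ennreal powr_powr)
qed

end

section \<open>The exponential bound\<close>

text \<open>An infinite \<open>Den\<close> makes the quotient 0 and the right-hand side 1.\<close>

lemma exp_le_exp_minus:
  assumes "0 < D" "ennreal D \<le> Den" and that: "0 \<le> y"
  shows "exp (- (y / D)) \<le> exp_minus (ennreal y / Den)"
proof (cases "Den = \<top>")
  case True
  then show ?thesis using assms that by (simp add: exp_minus_def)
next
  case False
  then obtain d where d: "Den = ennreal d" "0 \<le> d" by (metis ennreal_cases)
  then have dD: "D \<le> d" "0 < d" using assms by (auto simp: ennreal_le_iff)
  have "ennreal y / Den = ennreal (y / d)" using d dD that by (simp add: divide_ennreal)
  then show ?thesis using dD assms that by (simp add: exp_minus_def divide_left_mono frac_le)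
qed

theorem theorem1:
  fixes \<tau> :: "'t measure"
    and \<nu> :: "'x::{banach, second_countable_topology} measure"
    and P :: "'a measure"
    and X :: "'a \<Rightarrow> 'x"
    and Xs :: "nat \<Rightarrow> 'a \<Rightarrow> 'x"
    and f :: "'x \<Rightarrow> real"
    and w :: "'t \<Rightarrow> 'x \<Rightarrow> real"
    and c2 :: "real \<Rightarrow> real"
    and n :: nat
    and s z :: real
  assumes "sigma_finite_measure \<tau>"
    and "sigma_finite_measure \<nu>"
    and "space \<nu> = UNIV"
    and "prob_space P"
    and "complete_measure P"
    and "\<And>x. 0 \<le> f x"
    and "distributed P \<nu> X (\<lambda>x. ennreal (f x))"
    and "n \<ge> 1"
    and "prob_space.indep_vars P (\<lambda>_. \<nu>) Xs {1..n}"
    and "\<And>i. i \<in> {1..n} \<Longrightarrow> distr P \<nu> (Xs i) = distr P \<nu> X"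
    and "\<And>p. 1 < p \<Longrightarrow> operator_bound_const TYPE('t) TYPE('x) p (c2 p)"
    and "\<And>p. 1 < p \<Longrightarrow> operator_bound_const TYPE('x) TYPE('t) p (c2 p)"
    and "1 \<le> s"
    and "case_prod w \<in> borel_measurable (\<tau> \<Otimes>\<^sub>M \<nu>)"
    and "assumption_A1 s \<tau> w"
    and "M_norm s \<tau> \<nu> w < \<infinity>"
    and "0 < z"
  shows "measure P {\<omega> \<in> space P. rho n s \<tau> \<nu> w f + ennreal z \<le> Lp_norm s \<tau> (xi P X Xs n w \<omega>)}
    \<le> exp_minus (ennreal (z\<^sup>2) /
        (omega_sq c2 n s \<tau> \<nu> w f / 3
          + 4 / 3 * ennreal (c_star c2 s) * M_norm s \<tau> \<nu> w * ennreal z))"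
proof -
  interpret P: prob_space P by fact
  define I where "I = {1..n}"
  have I: "finite I" "I \<noteq> {}" "card I = n" using assms(8) by (auto simp: I_def)
  define N where "N = distr P \<nu> X"
  have Xm[measurable]: "X \<in> measurable P \<nu>" using assms(7) by (simp add: distributed_def)
  have fm[measurable]: "(\<lambda>x. ennreal (f x)) \<in> borel_measurable \<nu>" using assms(7) by (simp add: distributed_def)
  have Nd: "N = density \<nu> (\<lambda>x. ennreal (f x))" using assms(7) by (simp add: distributed_def N_def)
  have setsN[measurable_cong]: "sets N = sets \<nu>" and spN: "space N = UNIV" by (simp_all add: N_def assms(3))
  have pN: "prob_space N" unfolding N_def by (rule P.prob_space_distr) measurable
  define M where "M = M_norm s \<tau> \<nu> w"
  define b where "b = enn2real M"
  have M: "M = ennreal b" "0 \<le> b" using assms(16) by (auto simp: M_def b_def)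
  have wm: "case_prod w \<in> borel_measurable (\<tau> \<Otimes>\<^sub>M N)"
    using assms(14) by (simp cong: measurable_cong_sets sets_pair_measure_cong add: setsN)
  have wb: "Lp_norm s \<tau> (\<lambda>t. w t x) \<le> ennreal b" for x
    unfolding M(1)[symmetric] M_def M_norm_def by (intro max.coboundedI1 SUP_upper) (simp add: assms(3))
  interpret K: random_kernel \<tau> N w s b
    by (rule random_kernel.intro[OF assms(1) pN wm assms(13) M(2) wb])
  define Q where "Q = PiM I (\<lambda>_. N)"
  interpret Q: prob_space Q unfolding Q_def by (rule K.N.PiM_prob_space)
  \<comment> \<open>Restricting the tuple to \<open>I\<close> places it in the extensional product
    space; by independence its law is the product of copies of \<open>N\<close>.\<close>
  define V where "V \<omega> = (\<lambda>i\<in>I. Xs i \<omega>)" for \<omega>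
  have Xsm: "Xs i \<in> measurable P \<nu>" if "i \<in> I" for i
    using assms(9) that unfolding I_def by (auto simp: P.indep_vars_def)
  have setsQ: "sets Q = sets (PiM I (\<lambda>_. \<nu>))" unfolding Q_def by (intro sets_PiM_cong) (auto simp: setsN)
  have Vm: "V \<in> measurable P (PiM I (\<lambda>_. \<nu>))" unfolding V_def[abs_def] by (intro measurable_restrict Xsm)
  have VmQ[measurable]: "V \<in> measurable P Q" using Vm by (simp cong: measurable_cong_sets add: setsQ)
  have law: "distr P Q V = Q"
  proof -
    have "distr P (PiM I (\<lambda>_. \<nu>)) V = PiM I (\<lambda>i. distr P \<nu> (Xs i))"
      using assms(9) P.indep_vars_iff_distr_eq_PiM'[of I Xs "\<lambda>_. \<nu>"] I Xsm unfolding V_def[abs_def] I_def by auto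
    also have "\<dots> = Q" unfolding Q_def N_def using assms(10) by (intro PiM_cong) (auto simp: I_def)
    finally show ?thesis by (metis distr_cong setsQ)
  qed
  have norm_eq: "Lp_norm s \<tau> (xi P X Xs n w \<omega>) = ennreal (K.Z I (V \<omega>))" if \<omega>: "\<omega> \<in> space P" for \<omega>
  proof -
    have "V \<omega> \<in> space Q" by (rule measurable_space[OF VmQ \<omega>])
    then have "ennreal (K.Z I (V \<omega>)) = Lp_norm s \<tau> (K.S I (V \<omega>))"
      using K.Z_ennreal[OF I(1), of "V \<omega>" I] by (simp add: Q_def)
    also have "\<dots> = Lp_norm s \<tau> (xi P X Xs n w \<omega>)"
    proof (rule Lp_norm_cong_AE[OF AE_I2])
      fix t assume t: "t \<in> space \<tau>"
      have "w t \<in> borel_measurable \<nu>" using K.w_meas1[OF t] by (simp cong: measurable_cong_sets add: setsN)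
      then have "(\<integral>\<omega>'. w t (X \<omega>') \<partial>P) = (\<integral>x. w t x \<partial>N)" unfolding N_def by (subst integral_distr) auto
      then have "(\<integral>\<omega>'. w t (X \<omega>') \<partial>P) = K.w_mean t" by (simp only: K.w_mean_def)
      then show "\<bar>K.S I (V \<omega>) t\<bar> = \<bar>xi P X Xs n w \<omega> t\<bar>"
        by (simp add: K.S_def xi_def K.h_def V_def I_def)
    qed
    finally show ?thesis ..
  qed
  define E where "E = (\<integral>x. K.Z I x \<partial>Q)"
  have E0: "0 \<le> E" unfolding E_def Q_def by (rule K.expectation_Z_nonneg)
  let ?ev = "{\<omega> \<in> space P. rho n s \<tau> \<nu> w f + ennreal z \<le> Lp_norm s \<tau> (xi P X Xs n w \<omega>)}"
  let ?Den = "omega_sq c2 n s \<tau> \<nu> w f / 3 + 4 / 3 * ennreal (c_star c2 s) * M_norm s \<tau> \<nu> w * ennreal z"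
  have Zm[measurable]: "K.Z I \<in> borel_measurable Q" unfolding Q_def by (rule K.Z_meas) simp
  \<comment> \<open>Everything is reduced to \<open>E \<le> rho\<close>. An infinite
    \<open>rho\<close> is harmless: the norm is finite, so the event is then empty.\<close>
  have ev_le: "measure P ?ev \<le> measure Q {x \<in> space Q. E + z \<le> K.Z I x}" if "ennreal E \<le> rho n s \<tau> \<nu> w f"
  proof -
    have "?ev \<subseteq> {\<omega> \<in> space P. E + z \<le> K.Z I (V \<omega>)}"
    proof safe
      fix \<omega> assume \<omega>: "\<omega> \<in> space P" and le: "rho n s \<tau> \<nu> w f + ennreal z \<le> Lp_norm s \<tau> (xi P X Xs n w \<omega>)"
      have "ennreal (E + z) \<le> rho n s \<tau> \<nu> w f + ennreal z"
        using that E0 assms(17) by (simp add: ennreal_plus add_right_mono)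
      also note le
      also note norm_eq[OF \<omega>]
      finally show "E + z \<le> K.Z I (V \<omega>)" by (subst (asm) ennreal_le_iff) (simp_all add: K.Z_def)
    qed
    then have "measure P ?ev \<le> measure P {\<omega> \<in> space P. E + z \<le> K.Z I (V \<omega>)}"
      by (intro P.finite_measure_mono) measurable
    also have "\<dots> = measure (distr P Q V) {x \<in> space Q. E + z \<le> K.Z I x}"
      by (subst measure_distr) (auto intro!: arg_cong[where f = "measure P"] dest: measurable_space[OF VmQ])
    finally show ?thesis unfolding law .
  qed
  have SigK: "K.Sig = Sigma_norm s \<tau> \<nu> w f"
  proof -
    have "(\<integral>\<^sup>+ x. ennreal ((w t x)\<^sup>2) \<partial>N) = (\<integral>\<^sup>+ x. ennreal ((w t x)\<^sup>2 * f x) \<partial>\<nu>)" if t: "t \<in> space \<tau>" for t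
    proof -
      have [measurable]: "w t \<in> borel_measurable \<nu>" using K.w_meas1[OF t] by (simp cong: measurable_cong_sets add: setsN)
      have "(\<integral>\<^sup>+ x. ennreal ((w t x)\<^sup>2) \<partial>N) = (\<integral>\<^sup>+ x. ennreal (f x) * ennreal ((w t x)\<^sup>2) \<partial>\<nu>)"
        unfolding Nd by (rule nn_integral_density) measurable
      then show ?thesis using assms(6) by (simp add: ennreal_mult mult.commute)
    qed
    then show ?thesis unfolding Sigma_norm_def by (simp cong: nn_integral_cong)
  qed
  have nz: "0 < real n" using assms(8) by simp
  have Mn: "M_norm s \<tau> \<nu> w = ennreal b" using M(1) unfolding M_def .
  consider "b = 0" | "0 < b" "s < 2" | "0 < b" "2 \<le> s" using M(2) by linarith
  then show ?thesis
  proof cases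
    case 1
    \<comment> \<open>The tail bounds take \<open>0 < b\<close>. For \<open>b = 0\<close> the norm
      vanishes while the threshold is at least \<open>z > 0\<close>.\<close>
    have "?ev = {}"
    proof safe
      fix \<omega> assume \<omega>: "\<omega> \<in> space P" and le: "rho n s \<tau> \<nu> w f + ennreal z \<le> Lp_norm s \<tau> (xi P X Xs n w \<omega>)"
      have "V \<omega> \<in> space Q" by (rule measurable_space[OF VmQ \<omega>])
      then have "K.Z I (V \<omega>) \<le> 0" using K.Z_bounds(2)[OF I(1) _ order_refl, of "V \<omega>"] 1 by (simp add: Q_def)
      then have "rho n s \<tau> \<nu> w f + ennreal z \<le> 0" using le norm_eq[OF \<omega>] by (simp add: ennreal_neg)
      then show "\<omega> \<in> {}" using assms(17) by (simp add: ennreal_eq_0_iff)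
    qed
    then have "measure P ?ev = 0" by (simp only: measure_empty)
    then show ?thesis by (simp only: exp_minus_def) simp
  next
    case 2
    have "ennreal E \<le> rho n s \<tau> \<nu> w f"
    proof -
      have "2 * ennreal (real n powr (1 / s)) * ennreal b \<le> 4 * ennreal (real n powr (1 / s)) * ennreal b"
        by (intro mult_right_mono) auto
      then show ?thesis
        using K.expectation_Z_le_Sig[OF I(1)] K.expectation_Z_le_type[OF I(1)] 2
        unfolding SigK by (simp add: rho_def Mn E_def Q_def I(3) Let_def)
    qed
    from ev_le[OF this] have "measure P ?ev \<le> exp (- (z\<^sup>2 / (2 * real n * b\<^sup>2)))"
      using K.Z_tail_hoeffding[OF 2(1) I(1,2) assms(17)] unfolding Q_def[symmetric] E_def[symmetric] I(3) by linarith
    also have "\<dots> \<le> exp_minus (ennreal (z\<^sup>2) / ?Den)"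
    proof (rule exp_le_exp_minus)
      have "ennreal (2 * real n * b\<^sup>2) \<le> ennreal (b\<^sup>2 * (14 * real n + 96 * real n powr (1 / s)) / 3)"
      proof (rule ennreal_leI)
        \<comment> \<open>Bounded differences give the denominator \<open>2 * n * b^2\<close>, and a
          third of \<open>14 * n * b^2\<close> already exceeds it.\<close>
        have "b\<^sup>2 * (6 * real n) \<le> b\<^sup>2 * (14 * real n + 96 * real n powr (1 / s))"
          by (intro mult_left_mono) (auto intro: add_increasing2)
        then show "2 * real n * b\<^sup>2 \<le> b\<^sup>2 * (14 * real n + 96 * real n powr (1 / s)) / 3"
          by (simp only: mult.assoc mult.commute[of "b\<^sup>2"] pos_le_divide_eq zero_less_numeral)
      qed
      also have "\<dots> = omega_sq c2 n s \<tau> \<nu> w f / 3"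
        using 2 by (simp add: omega_sq_def Mn Let_def ennreal_of_nat_eq_real_of_nat
            divide_ennreal[symmetric] ennreal_mult ennreal_plus ennreal_power)
      finally show "ennreal (2 * real n * b\<^sup>2) \<le> ?Den" by (rule order_trans) simp
    qed (use nz 2 in auto)
    finally show ?thesis .
  next
    case 3
    \<comment> \<open>One coefficient for \<open>s = 2\<close> and \<open>s > 2\<close>: at least 1,
      and for \<open>s > 2\<close> at least the constant of Rosenthal's inequality.\<close>
    define c where "c = (if s = 2 then 1 else c3 c2 s)"
    have c: "1 \<le> c" "s \<noteq> 2 \<Longrightarrow> 15 * s / ln s \<le> c"
    proof -
      show "15 * s / ln s \<le> c" if "s \<noteq> 2" using that 3 by (simp add: c_def c3_def c1_def)
      show "1 \<le> c"
      proof (cases "s = 2")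
        case False
        have "ln s \<le> s" using 3 by (intro order_trans[OF ln_le_minus_one]) auto
        then have "1 \<le> 15 * s / ln s" using 3 False by (simp add: le_divide_eq)
        then show ?thesis using \<open>s \<noteq> 2 \<Longrightarrow> 15 * s / ln s \<le> c\<close> False by linarith
      qed (simp add: c_def)
    qed
    have cstar: "c_star c2 s = c" using 3 by (simp add: c_star_def c_def)
    \<comment> \<open>At \<open>s = 2\<close> this is 1, so the same mixed norm appears in both
      branches of \<open>omega_sq\<close>.\<close>
    define q where "q = 2 * s / (s + 2)"
    define Mq where "Mq = M_norm q \<tau> N w"
    define R where "R = (if s = 2 then ennreal (sqrt (real n)) * ennreal b
      else ennreal (15 * s / ln s) * (ennreal (sqrt (real n)) * K.Sig + 2 * ennreal (real n powr (1 / s)) * ennreal b))"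
    have R: "rho n s \<tau> \<nu> w f = R"
      using 3 by (simp add: rho_def R_def Mn SigK c1_def Let_def)
    have ER: "ennreal E \<le> R"
    proof (cases "s = 2")
      case True
      have "ennreal E \<le> ennreal (sqrt (real n)) * K.Sig"
        using K.expectation_Z_le_Sig[OF I(1)] True by (simp add: E_def Q_def I(3))
      also have "\<dots> \<le> ennreal (sqrt (real n)) * ennreal b" by (intro mult_left_mono K.Sig_le True) simp
      finally show ?thesis using True by (simp add: R_def)
    next
      case False
      then show ?thesis
        using K.expectation_Z_le_rosenthal[OF I(1,2) 3(2)] by (simp add: R_def E_def Q_def I(3))
    qed
    \<comment> \<open>The second summand is \<open>8 * R * b\<close> for \<open>s = 2\<close>, and
      for \<open>s > 2\<close> it is \<open>8 * R * b\<close> with \<open>c\<close> in place of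
      Rosenthal's constant. So it dominates \<open>8 * E * b\<close>, the mean term of the Bernstein
      denominator.\<close>
    have Den: "?Den = 2 * ennreal c * of_nat n * Mq\<^sup>2 +
        (if s = 2 then 8 * ennreal (sqrt (real n)) * (ennreal b)\<^sup>2
         else 8 * ennreal c * (ennreal (sqrt (real n)) * K.Sig + 2 * ennreal (real n powr (1 / s)) * ennreal b) * ennreal b)
        + 4 / 3 * ennreal c * ennreal b * ennreal z"
    proof -
      have third: "6 * x / 3 = 2 * x" "24 * x / 3 = 8 * x" for x :: ennreal
      proof -
        have "(6::ennreal) / 3 = 2" "(24::ennreal) / 3 = 8"
          using divide_ennreal[of 6 3] divide_ennreal[of 24 3] by simp_all
        then show "6 * x / 3 = 2 * x" "24 * x / 3 = 8 * x"
          by (metis ennreal_times_divide mult.commute)+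
      qed
      have "omega_sq c2 n s \<tau> \<nu> w f / 3 = 2 * ennreal c * of_nat n * Mq\<^sup>2 +
        (if s = 2 then 8 * ennreal (sqrt (real n)) * (ennreal b)\<^sup>2
         else 8 * ennreal c * (ennreal (sqrt (real n)) * K.Sig + 2 * ennreal (real n powr (1 / s)) * ennreal b) * ennreal b)"
      proof (cases "s = 2")
        case True
        have "omega_sq c2 n s \<tau> \<nu> w f = 6 * (of_nat n * Mq\<^sup>2) + 24 * (ennreal (sqrt (real n)) * (ennreal b)\<^sup>2)"
          using True Mn by (simp add: omega_sq_def Mq_def q_def Nd Let_def mult.assoc)
        then show ?thesis using True by (simp add: add_divide_distrib_ennreal third c_def mult.assoc)
      next
        case False
        have eq: "omega_sq c2 n s \<tau> \<nu> w f = 6 * (ennreal c * (of_nat n * Mq\<^sup>2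
            + 4 * ennreal (sqrt (real n)) * K.Sig * ennreal b + 8 * ennreal (real n powr (1 / s)) * (ennreal b)\<^sup>2))"
          using False 3 SigK by (simp add: omega_sq_def Mq_def q_def Nd Mn Let_def mult.assoc c_def)
        have eight: "(8::ennreal) = 2 * 4" by simp
        show ?thesis unfolding eq third using False
          by (simp only: eight if_False distrib_left distrib_right power2_eq_square mult_ac add_ac)
      qed
      then show ?thesis by (simp only: cstar Mn)
    qed
    show ?thesis
    proof (cases "Mq = \<top>")
      case True
      \<comment> \<open>Finiteness of \<open>M_norm s\<close> with respect to \<open>\<nu>\<close>
        does not bound this mixed norm; when it is infinite, the claimed bound is 1.\<close>
      have dt: "?Den = \<top>" using c nz unfolding Den True by (simp add: ennreal_mult_top ennreal_top_mult)
      have "exp_minus (ennreal (z\<^sup>2) / ?Den) = 1" unfolding dt by (simp add: exp_minus_def)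
      then show ?thesis by (simp only: P.prob_le_1)
    next
      case False
      define m where "m = enn2real Mq"
      have m: "Mq = ennreal m" "0 \<le> m" using False by (auto simp: m_def less_top)
      have var: "(\<integral>\<^sup>+ y. (\<integral>\<^sup>+ t. ennreal (\<bar>l t\<bar> * \<bar>w t y\<bar>) \<partial>\<tau>)\<^sup>2 \<partial>N) \<le> ennreal (m\<^sup>2)"
        if l: "l \<in> borel_measurable \<tau>" "(abs_moment (s / (s - 1)) \<tau> l) \<le> 1" for l
      proof -
        have bd: "(\<integral>\<^sup>+ y. (\<integral>\<^sup>+ t. ennreal (\<bar>l t\<bar> * \<bar>w t y\<bar>) \<partial>\<tau>)\<^sup>2 \<partial>N) \<le> ennreal (k\<^sup>2)" if k: "0 < k" "m \<le> k" for k
        proof (rule schur_test_square[OF assms(1) K.N.sigma_finite_measure_axioms wm 3(2) l k(1)])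
          have Mk: "M_norm q \<tau> N w \<le> ennreal k" using m k unfolding Mq_def by (simp add: ennreal_leI)
          show "Lp_norm (2 * s / (s + 2)) \<tau> (\<lambda>t. w t x) \<le> ennreal k" if "x \<in> space N" for x
            by (rule order_trans[OF _ Mk], unfold M_norm_def q_def[symmetric]) (intro max.coboundedI1 SUP_upper that)
          show "Lp_norm (2 * s / (s + 2)) N (w t) \<le> ennreal k" if "t \<in> space \<tau>" for t
            by (rule order_trans[OF _ Mk], unfold M_norm_def q_def[symmetric]) (intro max.coboundedI2 SUP_upper that)
        qed
        show ?thesis
        proof (rule ennreal_le_epsilon)
          \<comment> \<open>\<open>m\<close> may be 0 while the Schur test takes a positive bound,
            so \<open>m^2\<close> is approached from above by \<open>m^2 + e\<close>.\<close>
          fix e :: real assume e: "0 < e"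
          have "(\<integral>\<^sup>+ y. (\<integral>\<^sup>+ t. ennreal (\<bar>l t\<bar> * \<bar>w t y\<bar>) \<partial>\<tau>)\<^sup>2 \<partial>N) \<le> ennreal ((sqrt (m\<^sup>2 + e))\<^sup>2)"
            using e m by (intro bd) (auto intro!: real_le_rsqrt add_nonneg_pos)
          also have "(sqrt (m\<^sup>2 + e))\<^sup>2 = m\<^sup>2 + e" using e by (simp add: add_nonneg_nonneg)
          finally show "(\<integral>\<^sup>+ y. (\<integral>\<^sup>+ t. ennreal (\<bar>l t\<bar> * \<bar>w t y\<bar>) \<partial>\<tau>)\<^sup>2 \<partial>N) \<le> ennreal (m\<^sup>2) + ennreal e"
            using e by (simp add: ennreal_plus)
        qed
      qed
      have s1: "1 < s" using 3 by simp
      define D where "D = 2 * (real n * m\<^sup>2 + 4 * b * E) + 4 / 3 * b * z"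
      have "measure P ?ev \<le> exp (- (z\<^sup>2 / D))"
        using ev_le[unfolded R, OF ER] K.Z_tail_bernstein[OF s1 3(1) I(1) zero_le_power2 assms(17) var]
        unfolding Q_def[symmetric] E_def[symmetric] I(3) D_def R by linarith
      also have "\<dots> \<le> exp_minus (ennreal (z\<^sup>2) / ?Den)"
      proof (rule exp_le_exp_minus)
        show "0 < D" unfolding D_def using 3 E0 assms(17) by (intro add_nonneg_pos) auto
        have "ennreal D = ennreal (2 * real n * m\<^sup>2) + ennreal (8 * E * b) + ennreal (4 / 3 * b * z)"
          unfolding D_def using 3 E0 assms(17) by (simp add: algebra_simps flip: ennreal_plus)
        also have "\<dots> = 2 * of_nat n * Mq\<^sup>2 + 8 * ennreal E * ennreal b + 4 / 3 * ennreal b * ennreal z"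
        proof -
          have "ennreal (4 / 3) = 4 / 3" using divide_ennreal[of 4 3] by simp
          moreover have "ennreal (4 / 3 * b * z) = ennreal (4 / 3) * ennreal b * ennreal z"
            using 3 assms(17) by (subst ennreal_mult) (auto simp only: ennreal_mult less_imp_le intro!: mult_nonneg_nonneg)
          ultimately have "ennreal (4 / 3 * b * z) = 4 / 3 * ennreal b * ennreal z" by simp
          moreover have "ennreal (2 * real n * m\<^sup>2) = 2 * of_nat n * Mq\<^sup>2" "ennreal (8 * E * b) = 8 * ennreal E * ennreal b"
            using 3 E0 m by (simp_all add: ennreal_mult ennreal_power ennreal_of_nat_eq_real_of_nat)
          ultimately show ?thesis by (simp only:)
        qed
        also have "\<dots> \<le> ?Den" unfolding Den
        proof (intro add_mono)
          have c1: "1 \<le> ennreal c" using c(1) by simp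
          have "1 * (2 * of_nat n * Mq\<^sup>2) \<le> ennreal c * (2 * of_nat n * Mq\<^sup>2)" using c1 by (intro mult_right_mono) auto
          then show "2 * of_nat n * Mq\<^sup>2 \<le> 2 * ennreal c * of_nat n * Mq\<^sup>2" by (simp add: mult_ac)
          have "1 * (4 / 3 * ennreal b * ennreal z) \<le> ennreal c * (4 / 3 * ennreal b * ennreal z)"
            using c1 by (intro mult_right_mono) auto
          then show "4 / 3 * ennreal b * ennreal z \<le> 4 / 3 * ennreal c * ennreal b * ennreal z" by (simp add: mult_ac)
          have "8 * ennreal E * ennreal b \<le> 8 * R * ennreal b" using ER by (intro mult_right_mono mult_left_mono) auto
          also have "\<dots> \<le> (if s = 2 then 8 * ennreal (sqrt (real n)) * (ennreal b)\<^sup>2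
            else 8 * ennreal c * (ennreal (sqrt (real n)) * K.Sig + 2 * ennreal (real n powr (1 / s)) * ennreal b) * ennreal b)"
          proof (cases "s = 2")
            case True
            then show ?thesis by (simp add: R_def power2_eq_square mult.assoc)
          next
            case False
            let ?T = "ennreal (sqrt (real n)) * K.Sig + 2 * ennreal (real n powr (1 / s)) * ennreal b"
            have "8 * (ennreal (15 * s / ln s) * ?T) * ennreal b \<le> 8 * (ennreal c * ?T) * ennreal b"
              by (intro mult_right_mono mult_left_mono ennreal_leI c(2) False) auto
            then show ?thesis using False by (simp add: R_def mult.assoc)
          qed
          finally show "8 * ennreal E * ennreal b \<le> (if s = 2 then 8 * ennreal (sqrt (real n)) * (ennreal b)\<^sup>2
            else 8 * ennreal c * (ennreal (sqrt (real n)) * K.Sig + 2 * ennreal (real n powr (1 / s)) * ennreal b) * ennreal b)" .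
        qed
        finally show "ennreal D \<le> ?Den" .
      qed simp
      finally show ?thesis .
    qed
  qed
qed

end
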